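(* Let $f\in\mathbb{C}[z]$ be a polynomial of degree $m>1$, let $C(t)$ be a cycle of $f$, and let $g\in\mathbb{C}[z]$. (1) If $C(t)$ is totally unbalanced, then $\int_{C(t)} g\equiv 0$ if and only if there exist $s\ge 1$ and polynomials $f_1,\dots,f_s,g_1,\dots,g_s,h_1,\dots,h_s\in\mathbb{C}[z]$ such that $f=f_k\circ h_k$ for every $k=1,\dots,s$, $g=g_1\circ h_1+\cdots+g_s\circ h_s$, and the projected cycle $h_k(C)$ is trivial for every $k=1,\dots,s$. (2) If $C(t)$ is unbalanced, then $\int_{C(t)} g\equiv 0$ if and only if there exist $s\ge 1$ and polynomials $f_1,\dots,f_s,g_1,\dots,g_s,h_1,\dots,h_s\in\mathbb{C}[z]$ such that $f=f_k\circ h_k$ for every $k=1,\dots,s$, $g=g_1\circ h_1+\cdots+g_s\circ h_s$, and for every $k$ one has $\int_{h_k(C(t))} g_k\equiv 0$ and the projected cycle $h_k(C)$ is trivial or balanced.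
   Context: Cycles and integrals. Let $f\in\mathbb{C}[z]$ have degree $m$, with set of critical values $\Sigma\subset\mathbb{C}$. For $t\notin\Sigma$, $z_1(t),\dots,z_m(t)$ are the distinct roots of $f(z)=t$, depending analytically on $t$ locally near a base point $t_0\notin\Sigma$. A cycle of $f$ is a formal sum $C(t)=\sum_{i=1}^m n_i z_i(t)$ with $n_i\in\mathbb{Z}$, $\sum_i n_i=0$; it is trivial if all $n_i=0$. For a polynomial $g$, $\int_{C(t)} g:=\sum_{i=1}^m n_i g(z_i(t))$; "$\equiv 0$" means identically zero in $t$. Monodromy. The monodromy group $G_f$ is the group of permutations of $\{1,\dots,m\}$ (indices of the roots $z_i(t_0)$) induced by analytic continuation along loops in $\pi_1(\mathbb{C}\setminus\Sigma,t_0)$. The loop winding once anti-clockwise around all of $\Sigma$ induces an $m$-cycle $\tau_\infty\in G_f$. $\Gamma_m(f)\subset G_f$ is the conjugacy class of $\tau_\infty$ in $G_f$. Balanced. The cycle $C(t)$ is balanced if $\sum_{i=1}^m n_{p_i}\epsilon_m^i=0$ for every $m$-cycle $\sigma=(p_1,p_2,\dots,p_m)\in\Gamma_m(f)$ (i.e. $\sigma: p_1\mapsto p_2\mapsto\cdots\mapsto p_m\mapsto p_1$), where $\epsilon_m$ is a primitive $m$-th root of unity; this does not depend on how the permutation cycle is written. $C(t)$ is unbalanced if it is not balanced. Projected cycle. If $f=f_0\circ h$ with $f_0,h\in\mathbb{C}[z]$, let $w_1(t),\dots,w_d(t)$ be the distinct values among $h(z_1(t)),\dots,h(z_m(t))$;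 these are the roots of $f_0(w)=t$. The projected cycle is the cycle $h(C(t))=\sum_{j=1}^d\tilde n_j w_j(t)$ of $f_0$, with $\tilde n_j=\sum_{i:\,h(z_i(t))=w_j(t)} n_i$. Triviality, balancedness and integrals of $h(C)$ are with respect to $f_0$. Totally unbalanced. $C(t)$ is totally unbalanced if for every $f_0,h\in\mathbb{C}[z]$ with $f=f_0\circ h$, the projected cycle $h(C)$ is unbalanced or trivial. *)

theory Defs
  imports "HOL-Complex_Analysis.Complex_Analysis" "HOL-Combinatorics.Combinatorics"
begin

section \<open>Roots of \<open>f(z) = t\<close> near a base point\<close>

definition critical_values :: "complex poly \<Rightarrow> complex set" where
  "critical_values f = {poly f z |z. poly (pderiv f) z = 0}"

definition fibre :: "complex poly \<Rightarrow> complex \<Rightarrow> complex set" where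
  "fibre f t = {x. poly f x = t}"

text \<open>
  The roots \<open>z\<^sub>1(t), \<dots>, z\<^sub>m(t)\<close> near a regular value \<open>t\<^sub>0\<close> are labelled by their values at \<open>t\<^sub>0\<close>,
  so the index set \<open>{1, \<dots>, m}\<close> is \<open>fibre f t\<^sub>0\<close>, and the branch with label \<open>x\<close> is the analytic
  solution of \<open>f(z(t)) = t\<close> near \<open>t\<^sub>0\<close> with \<open>z(t\<^sub>0) = x\<close>. Only its germ at \<open>t\<^sub>0\<close> is determined
  (the function is an arbitrary representative), and only its germ is used below.
\<close>

definition root_branch :: "complex poly \<Rightarrow> complex \<Rightarrow> complex \<Rightarrow> complex \<Rightarrow> complex" where
  "root_branch f t0 x = (SOME \<phi>. \<phi> analytic_on {t0} \<and> \<phi> t0 = x \<and>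
                               (\<forall>\<^sub>F t in nhds t0. poly f (\<phi> t) = t))"


section \<open>Cycles and integrals\<close>

text \<open>
  A cycle \<open>\<Sum>\<^sub>x n\<^sub>x z\<^sub>x(t)\<close> is given by its coefficient function; values of this function
  outside the fibre are irrelevant.
\<close>

definition is_cycle :: "complex poly \<Rightarrow> complex \<Rightarrow> (complex \<Rightarrow> int) \<Rightarrow> bool" where
  "is_cycle f t0 n \<longleftrightarrow> (\<Sum>x\<in>fibre f t0. n x) = 0"

definition trivial_cycle :: "complex poly \<Rightarrow> complex \<Rightarrow> (complex \<Rightarrow> int) \<Rightarrow> bool" where
  "trivial_cycle f t0 n \<longleftrightarrow> (\<forall>x\<in>fibre f t0. n x = 0)"

definition cycle_integral ::
    "complex poly \<Rightarrow> complex \<Rightarrow> (complex \<Rightarrow> int) \<Rightarrow> complex poly \<Rightarrow> complex \<Rightarrow> complex" where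
  "cycle_integral f t0 n g t = (\<Sum>x\<in>fibre f t0. of_int (n x) * poly g (root_branch f t0 x t))"

definition integral_vanishes ::
    "complex poly \<Rightarrow> complex \<Rightarrow> (complex \<Rightarrow> int) \<Rightarrow> complex poly \<Rightarrow> bool" where
  "integral_vanishes f t0 n g \<longleftrightarrow> (\<forall>\<^sub>F t in nhds t0. cycle_integral f t0 n g t = 0)"

text \<open>
  If \<open>f = f\<^sub>0 \<circ> h\<close>, this is the coefficient function of the cycle \<open>h(C)\<close> of \<open>f\<^sub>0\<close>. The branches
  \<open>h(z\<^sub>x(t))\<close> and \<open>w\<^sub>y(t)\<close> coincide iff they do so at \<open>t\<^sub>0\<close>, that is, iff \<open>h(x) = y\<close>.
\<close>

definition projected_cycle ::
    "complex poly \<Rightarrow> complex \<Rightarrow> complex poly \<Rightarrow> (complex \<Rightarrow> int) \<Rightarrow> complex \<Rightarrow> int" where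
  "projected_cycle f t0 h n y = (\<Sum>x\<in>{x\<in>fibre f t0. poly h x = y}. n x)"


section \<open>Monodromy\<close>

text \<open>\<open>F s\<close> represents the germ at \<open>\<gamma> s\<close> of the analytic continuation of \<open>F 0\<close> along \<open>\<gamma>\<close>.\<close>

definition analytic_continuation_along ::
    "(real \<Rightarrow> complex) \<Rightarrow> (real \<Rightarrow> complex \<Rightarrow> complex) \<Rightarrow> bool" where
  "analytic_continuation_along \<gamma> F \<longleftrightarrow>
     (\<forall>s\<in>{0..1}. F s analytic_on {\<gamma> s} \<and>
        (\<exists>e>0. \<forall>u\<in>{0..1}. \<bar>u - s\<bar> < e \<longrightarrow> (\<forall>\<^sub>F t in nhds (\<gamma> u). F u t = F s t)))"

definition induced_perm ::
    "complex poly \<Rightarrow> complex \<Rightarrow> (real \<Rightarrow> complex) \<Rightarrow> (complex \<Rightarrow> complex) \<Rightarrow> bool" where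
  "induced_perm f t0 \<gamma> \<sigma> \<longleftrightarrow> \<sigma> permutes fibre f t0 \<and>
     (\<forall>x\<in>fibre f t0. \<exists>F. analytic_continuation_along \<gamma> F \<and>
        (\<forall>\<^sub>F t in nhds t0. F 0 t = root_branch f t0 x t) \<and>
        (\<forall>\<^sub>F t in nhds t0. F 1 t = root_branch f t0 (\<sigma> x) t))"

definition monodromy_group :: "complex poly \<Rightarrow> complex \<Rightarrow> (complex \<Rightarrow> complex) set" where
  "monodromy_group f t0 =
     {\<sigma>. \<exists>\<gamma>. path \<gamma> \<and> path_image \<gamma> \<subseteq> - critical_values f \<and>
            pathstart \<gamma> = t0 \<and> pathfinish \<gamma> = t0 \<and> induced_perm f t0 \<gamma> \<sigma>}"

text \<open>
  The loop winding once anti-clockwise around all critical values: go from \<open>t\<^sub>0\<close> to a circle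
  enclosing them, once around it, and back. Different choices of the circle and of the
  connecting path \<open>p\<close> change the induced permutation only by conjugation in the monodromy group.
\<close>

definition loop_around_critical_values ::
    "complex poly \<Rightarrow> complex \<Rightarrow> (real \<Rightarrow> complex) \<Rightarrow> bool" where
  "loop_around_critical_values f t0 \<gamma> \<longleftrightarrow>
     (\<exists>R p. R > 0 \<and> critical_values f \<subseteq> ball 0 R \<and>
            path p \<and> path_image p \<subseteq> - critical_values f \<and>
            pathstart p = t0 \<and> pathfinish p = complex_of_real R \<and>
            \<gamma> = p +++ (circlepath 0 R +++ reversepath p))"

definition Gamma_class :: "complex poly \<Rightarrow> complex \<Rightarrow> (complex \<Rightarrow> complex) set" where
  "Gamma_class f t0 =
     {\<rho> \<circ> \<tau> \<circ> inv \<rho> |\<rho> \<tau>. \<rho> \<in> monodromy_group f t0 \<and>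
        (\<exists>\<gamma>. loop_around_critical_values f t0 \<gamma> \<and> induced_perm f t0 \<gamma> \<tau>)}"


section \<open>Balanced and totally unbalanced cycles\<close>

definition primitive_root_of_unity :: "nat \<Rightarrow> complex \<Rightarrow> bool" where
  "primitive_root_of_unity m z \<longleftrightarrow> z ^ m = 1 \<and> (\<forall>k. 0 < k \<and> k < m \<longrightarrow> z ^ k \<noteq> 1)"

text \<open>
  Here \<open>\<epsilon> m\<close> is the chosen primitive \<open>m\<close>-th root of unity, and \<open>ps = [p\<^sub>1, \<dots>, p\<^sub>m]\<close> is a way of
  writing an \<open>m\<close>-cycle \<open>p\<^sub>1 \<mapsto> p\<^sub>2 \<mapsto> \<dots> \<mapsto> p\<^sub>m \<mapsto> p\<^sub>1\<close> (lists are indexed from \<open>0\<close>).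
\<close>

definition balanced ::
    "(nat \<Rightarrow> complex) \<Rightarrow> complex poly \<Rightarrow> complex \<Rightarrow> (complex \<Rightarrow> int) \<Rightarrow> bool" where
  "balanced \<epsilon> f t0 n \<longleftrightarrow>
     (\<forall>ps. distinct ps \<and> set ps = fibre f t0 \<and> cycle_of_list ps \<in> Gamma_class f t0 \<longrightarrow>
        (\<Sum>i=1..degree f. of_int (n (ps ! (i - 1))) * \<epsilon> (degree f) ^ i) = 0)"

definition totally_unbalanced ::
    "(nat \<Rightarrow> complex) \<Rightarrow> complex poly \<Rightarrow> complex \<Rightarrow> (complex \<Rightarrow> int) \<Rightarrow> bool" where
  "totally_unbalanced \<epsilon> f t0 n \<longleftrightarrow>
     (\<forall>f0 h. f = f0 \<circ>\<^sub>p h \<longrightarrow>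
        \<not> balanced \<epsilon> f0 t0 (projected_cycle f t0 h n) \<or>
        trivial_cycle f0 t0 (projected_cycle f t0 h n))"

end

theory Submission
  imports Defs "HOL-Computational_Algebra.Fundamental_Theorem_Algebra"
begin

text \<open>
  Number the roots by residues modulo \<open>m\<close> along a full cycle contained in the monodromy group \<open>G\<close>.
  If the integral vanishes, analytic continuation makes the vector of the \<open>g(z\<^sub>i(t))\<close> orthogonal to the
  span \<open>V\<close> of all images of \<open>n\<close> under \<open>G\<close>. The Fourier multipliers commuting with \<open>G\<close> form a Schur
  ring over the cyclic group of order \<open>m\<close>, and since \<open>n\<close> has integer coefficients, the multiplier
  projecting onto \<open>V\<close> lies in its rational part. By Schur's method the atoms of a rational Schur ring
  are determined by the subgroups they generate. These subgroups correspond to the block systems of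
  \<open>G\<close>, hence to the decompositions \<open>f = f\<^sub>d \<circ> h\<^sub>d\<close>, and each atom spans a \<open>G\<close>-invariant space \<open>U\<^sub>d\<close>
  either contained in \<open>V\<close> or orthogonal to it. A function of the roots that is equivariant under \<open>G\<close> and
  of polynomial growth is a polynomial of the root, so the \<open>U\<^sub>d\<close>-component of \<open>g\<close> is some \<open>g\<^sub>d \<circ> h\<^sub>d\<close>; it
  vanishes if \<open>U\<^sub>d\<close> lies in \<open>V\<close>. Otherwise \<open>U\<^sub>d\<close> is orthogonal to \<open>V\<close>, which says that \<open>h\<^sub>d(C)\<close> is
  balanced and that the integral of \<open>g\<^sub>d\<close> over it vanishes.
\<close>

section \<open>Roots of unity and the discrete Fourier transform\<close>

text \<open>The full cycle is not constructed. \<open>balanced\<close> quantifies over all full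
  cycles in \<open>Gamma_class\<close>, so an unbalanced cycle supplies one, and a cycle that is
  both balanced and totally unbalanced is trivial by the decomposition with \<open>h\<close> the
  identity. Integrality of \<open>n\<close> enters through one fact: the frequencies at which an
  integer combination vanishes are stable under multiplication by units modulo \<open>m\<close>.
  This comes from congruences modulo primes. The obstacle that shapes the rest is balancedness of
  the projected cycles: the cycle of the left factor that tests it is unrelated to the chosen
  numbering of the roots of \<open>f\<close>, and the two kinds of characters can only be compared
  through block systems. What has to be known is that a frequency divisible by the generator
  \<open>d\<close> of an atom, but outside this atom, belongs to a strictly coarser block system;
  this is where atoms must be determined by the subgroups they generate. Continuation is expressed
  by chains of discs that carry all roots at once, so that relabelling the roots visibly commutes
  with it.\<close>

definition ru :: "int \<Rightarrow> int \<Rightarrow> complex" where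
  "ru m k = cis (2 * pi * (of_int k / of_int m))"

lemma ru_0 [simp]: "ru m 0 = 1"
  by (simp add: ru_def)

lemma ru_add: "ru m (a + b) = ru m a * ru m b"
  by (simp add: ru_def cis_mult add_divide_distrib distrib_left)

lemma ru_power: "ru m a ^ k = ru m (int k * a)"
  by (induction k) (auto simp: ru_add ring_distribs)

lemma ru_eq_1_iff: assumes "m > 0" shows "ru m k = 1 \<longleftrightarrow> m dvd k"
proof
  assume "ru m k = 1"
  then have "cos (2 * pi * (of_int k / of_int m)) = 1"
    by (metis cis.simps(1) one_complex.simps(1) ru_def)
  then obtain n :: int where "2 * pi * (of_int k / of_int m) = of_int n * 2 * pi"
    unfolding cos_one_2pi_int by auto
  then have "of_int k = (of_int n * of_int m :: real)"
    using assms by (simp add: field_simps)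
  then have "k = n * m" by (metis of_int_eq_iff of_int_mult)
  then show "m dvd k" by simp
next
  assume "m dvd k"
  then obtain n where "k = m * n" by auto
  then show "ru m k = 1" using assms by (simp add: ru_def)
qed

definition periodic :: "int \<Rightarrow> (int \<Rightarrow> 'a) \<Rightarrow> bool" where
  "periodic m f \<longleftrightarrow> (\<forall>a b. m dvd a - b \<longrightarrow> f a = f b)"

lemma periodicD: "periodic m f \<Longrightarrow> m dvd a - b \<Longrightarrow> f a = f b"
  by (auto simp: periodic_def)

lemma ru_cong: assumes "m > 0" "m dvd a - b" shows "ru m a = ru m b"
proof -
  have "ru m a = ru m (a - b) * ru m b" by (metis diff_add_cancel ru_add)
  then show ?thesis using assms ru_eq_1_iff by auto
qed

lemma sum_ru:
  assumes "m > 0"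
  shows "(\<Sum>k\<in>{0..<m}. ru m (k * x)) = (if m dvd x then of_int m else 0)"
proof -
  have "(\<Sum>k\<in>{0..<m}. ru m (k * x)) = (\<Sum>k<nat m. ru m x ^ k)"
    unfolding ru_power using assms
    by (intro sum.reindex_bij_witness[of _ int nat]) auto
  moreover have "ru m x ^ nat m = 1"
    using assms by (simp add: ru_power ru_eq_1_iff)
  ultimately show ?thesis
    using assms by (auto simp: ru_eq_1_iff sum_gp_strict simp flip: ru_power)
qed

lemma sum_mod_reindex:
  fixes f :: "int \<Rightarrow> 'a::comm_monoid_add"
  assumes "m > 0" "periodic m f"
    and inj: "\<And>i j. i \<in> {0..<m} \<Longrightarrow> j \<in> {0..<m} \<Longrightarrow> m dvd g i - g j \<Longrightarrow> i = j"
  shows "(\<Sum>i\<in>{0..<m}. f (g i)) = (\<Sum>i\<in>{0..<m}. f i)"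
proof -
  have inj': "inj_on (\<lambda>i. g i mod m) {0..<m}"
    by (rule inj_onI) (use inj in \<open>auto simp: mod_eq_dvd_iff\<close>)
  have "(\<lambda>i. g i mod m) ` {0..<m} \<subseteq> {0..<m}" using assms by auto
  then have "(\<lambda>i. g i mod m) ` {0..<m} = {0..<m}"
    by (intro card_subset_eq) (auto simp: card_image[OF inj'])
  then have "bij_betw (\<lambda>i. g i mod m) {0..<m} {0..<m}" using inj' by (simp add: bij_betw_def)
  then have "(\<Sum>i\<in>{0..<m}. f (g i mod m)) = (\<Sum>i\<in>{0..<m}. f i)"
    by (rule sum.reindex_bij_betw)
  moreover have "f (g i mod m) = f (g i)" for i
    by (rule periodicD[OF assms(2)]) (metis dvd_minus_mod dvd_diff_commute)
  ultimately show ?thesis by simp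
qed

lemma sum_mod_shift:
  fixes f :: "int \<Rightarrow> 'a::comm_monoid_add"
  assumes "m > 0" "periodic m f"
  shows "(\<Sum>i\<in>{0..<m}. f (i + c)) = (\<Sum>i\<in>{0..<m}. f i)"
    and "(\<Sum>i\<in>{0..<m}. f (c - i)) = (\<Sum>i\<in>{0..<m}. f i)"
proof -
  have "i = j" if "i \<in> {0..<m}" "j \<in> {0..<m}" "m dvd i - j" for i j
    using that by (metis atLeastLessThan_iff mod_eq_dvd_iff mod_pos_pos_trivial)
  moreover from this have "i = j" if "i \<in> {0..<m}" "j \<in> {0..<m}" "m dvd j - i" for i j
    using that by blast
  ultimately show "(\<Sum>i\<in>{0..<m}. f (i + c)) = (\<Sum>i\<in>{0..<m}. f i)"
    "(\<Sum>i\<in>{0..<m}. f (c - i)) = (\<Sum>i\<in>{0..<m}. f i)"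
    by (auto intro!: sum_mod_reindex assms)
qed

lemma sum_ru_delta:
  assumes "m > 0" "x \<in> {0..<m}"
  shows "(\<Sum>y\<in>{0..<m}. F y * (\<Sum>k\<in>{0..<m}. ru m (k * (x - y)))) = of_int m * F x"
proof -
  have "m dvd x - y \<longleftrightarrow> y = x" if "y \<in> {0..<m}" for y
    using that assms by (metis atLeastLessThan_iff cancel_comm_monoid_add_class.diff_cancel dvd_0_right mod_eq_dvd_iff mod_pos_pos_trivial)
  then have "(\<Sum>y\<in>{0..<m}. F y * (\<Sum>k\<in>{0..<m}. ru m (k * (x - y)))) =
     (\<Sum>y\<in>{0..<m}. if y = x then F y * of_int m else 0)"
    using assms by (intro sum.cong) (auto simp: sum_ru)
  also have "\<dots> = of_int m * F x" using assms by simp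
  finally show ?thesis .
qed

lemma fourier_inversion:
  assumes "m > 0" "x \<in> {0..<m}"
  shows "(\<Sum>k\<in>{0..<m}. (\<Sum>y\<in>{0..<m}. F y * ru m (-(k * y))) * ru m (k * x)) = of_int m * F x"
proof -
  have "(\<Sum>k\<in>{0..<m}. (\<Sum>y\<in>{0..<m}. F y * ru m (-(k * y))) * ru m (k * x)) =
     (\<Sum>y\<in>{0..<m}. F y * (\<Sum>k\<in>{0..<m}. ru m (k * (x - y))))"
    unfolding sum_distrib_right sum_distrib_left
  proof (subst sum.swap, intro sum.cong refl)
    fix y k show "F y * ru m (- (k * y)) * ru m (k * x) = F y * ru m (k * (x - y))"
      using ru_add[of m "-(k * y)" "k * x"] by (simp add: algebra_simps)
  qed
  then show ?thesis using sum_ru_delta[OF assms] by simp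
qed

section \<open>Integer polynomials at roots of unity\<close>

definition ipoly :: "int poly \<Rightarrow> complex \<Rightarrow> complex" where
  "ipoly P z = poly (map_poly of_int P) z"

lemma ipoly_0 [simp]: "ipoly 0 z = 0"
  by (simp add: ipoly_def)

lemma ipoly_pCons [simp]: "ipoly (pCons a P) z = of_int a + z * ipoly P z"
  by (cases "a = 0 \<and> P = 0") (auto simp: ipoly_def map_poly_pCons)

lemma ipoly_1 [simp]: "ipoly 1 z = 1"
  unfolding one_pCons by (simp del: one_poly_eq_simps)

lemma ipoly_add [simp]: "ipoly (P + Q) z = ipoly P z + ipoly Q z"
  by (induction P Q rule: poly_induct2) (auto simp: algebra_simps)

lemma ipoly_smult [simp]: "ipoly (smult c P) z = of_int c * ipoly P z"
  by (induction P) (auto simp: algebra_simps)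

lemma ipoly_minus [simp]: "ipoly (P - Q) z = ipoly P z - ipoly Q z"
  by (metis add_diff_cancel diff_add_cancel ipoly_add)

lemma ipoly_mult [simp]: "ipoly (P * Q) z = ipoly P z * ipoly Q z"
  by (induction P) (auto simp: algebra_simps)

lemma ipoly_power [simp]: "ipoly (P ^ n) z = ipoly P z ^ n"
  by (induction n) auto

lemma ipoly_sum [simp]: "ipoly (sum F A) z = (\<Sum>i\<in>A. ipoly (F i) z)"
  by (induction A rule: infinite_finite_induct) auto

lemma ipoly_monom [simp]: "ipoly (monom c n) z = of_int c * z ^ n"
  by (induction n) (auto simp: monom_0 monom_Suc algebra_simps)

lemma ipoly_pcompose [simp]: "ipoly (pcompose P Q) z = ipoly P (ipoly Q z)"
  by (induction P) (auto simp: pcompose_pCons)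

text \<open>The coefficients of the reduction of an integer polynomial modulo \<open>X\<^sup>m - 1\<close>, obtained by
  Fourier inversion from its values at the roots of unity.\<close>

definition cyclic_coeff :: "int \<Rightarrow> int poly \<Rightarrow> int \<Rightarrow> complex" where
  "cyclic_coeff m P x = (\<Sum>k\<in>{0..<m}. ipoly P (ru m k) * ru m (-(k * x))) / of_int m"

lemma cyclic_coeff_add: "cyclic_coeff m (P + Q) x = cyclic_coeff m P x + cyclic_coeff m Q x"
  by (simp add: cyclic_coeff_def algebra_simps sum.distrib add_divide_distrib)

lemma cyclic_coeff_smult: "cyclic_coeff m (smult c P) x = of_int c * cyclic_coeff m P x"
  by (simp add: cyclic_coeff_def sum_distrib_left mult.assoc)

lemma cyclic_coeff_diff: "cyclic_coeff m (P - Q) x = cyclic_coeff m P x - cyclic_coeff m Q x"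
  by (metis add_diff_cancel diff_add_cancel cyclic_coeff_add)

lemma cyclic_coeff_sum: "cyclic_coeff m (sum F A) x = (\<Sum>i\<in>A. cyclic_coeff m (F i) x)"
  by (induction A rule: infinite_finite_induct)
     (auto simp: cyclic_coeff_add, auto simp: cyclic_coeff_def)

lemma cyclic_coeff_monom:
  assumes "m > 0"
  shows "cyclic_coeff m (monom c j) x = (if m dvd x - int j then of_int c else 0)"
proof -
  have "(\<Sum>k\<in>{0..<m}. ipoly (monom c j) (ru m k) * ru m (-(k * x))) =
    of_int c * (\<Sum>k\<in>{0..<m}. ru m (k * (int j - x)))"
    unfolding ipoly_monom ru_power sum_distrib_left
    by (intro sum.cong refl) (simp add: algebra_simps flip: ru_add)
  moreover have "m dvd int j - x \<longleftrightarrow> m dvd x - int j" by (rule dvd_diff_commute)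
  ultimately show ?thesis using assms unfolding cyclic_coeff_def by (simp add: sum_ru)
qed

text \<open>By linearity only monomials matter, and their reduction modulo X^m - 1 has a single
  coefficient. Integrality is what gives meaning to divisibility of these coefficients by a
  prime.\<close>

lemma cyclic_coeff_Ints:
  assumes "m > 0" shows "cyclic_coeff m P x \<in> \<int>"
proof -
  have "cyclic_coeff m (\<Sum>i\<le>degree P. monom (coeff P i) i) x \<in> \<int>"
    unfolding cyclic_coeff_sum by (intro Ints_sum) (auto simp: cyclic_coeff_monom[OF assms])
  then show ?thesis by (simp add: poly_as_sum_of_monoms)
qed

lemma cyclic_coeff_floor:
  assumes "m > 0" shows "cyclic_coeff m P x = of_int \<lfloor>Re (cyclic_coeff m P x)\<rfloor>"
  using cyclic_coeff_Ints[OF assms, of P x] by (auto elim!: Ints_cases)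

lemma ipoly_ru_eq:
  assumes "m > 0"
  shows "ipoly P (ru m k) = (\<Sum>x\<in>{0..<m}. cyclic_coeff m P x * ru m (k * x))"
proof -
  have eq: "ipoly P (ru m k) = (\<Sum>x\<in>{0..<m}. cyclic_coeff m P x * ru m (k * x))" if k: "k \<in> {0..<m}" for k
  proof -
    have "of_int m * (\<Sum>x\<in>{0..<m}. cyclic_coeff m P x * ru m (k * x)) =
      (\<Sum>x\<in>{0..<m}. (\<Sum>l\<in>{0..<m}. ipoly P (ru m l) * ru m (-(l * x))) * ru m (k * x))"
      using assms unfolding cyclic_coeff_def sum_distrib_left by (intro sum.cong) auto
    also have "\<dots> = of_int m * ipoly P (ru m k)"
      using fourier_inversion[OF assms k, of "\<lambda>l. ipoly P (ru m l)"] by (simp add: mult.commute)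
    finally show ?thesis using assms by simp
  qed
  have "m dvd k - k mod m" by (rule dvd_minus_mod)
  then have "ru m k = ru m (k mod m)" "\<And>x. ru m (k * x) = ru m (k mod m * x)"
    using ru_cong[OF assms] by (auto simp flip: left_diff_distrib intro!: ru_cong assms)
  then show ?thesis using eq[of "k mod m"] assms by simp
qed

lemma cyclic_coeff_cong:
  assumes "\<And>k. ipoly P (ru m k) = ipoly Q (ru m k)"
  shows "cyclic_coeff m P x = cyclic_coeff m Q x"
  unfolding cyclic_coeff_def assms ..

lemma cyclic_coeff_mult:
  assumes "m > 0"
  shows "cyclic_coeff m (P * Q) x =
    (\<Sum>i\<in>{0..<m}. cyclic_coeff m P i * cyclic_coeff m Q (x - i))"
proof -
  have "(\<Sum>i\<in>{0..<m}. cyclic_coeff m P i * cyclic_coeff m Q (x - i)) =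
    (\<Sum>i\<in>{0..<m}. \<Sum>l\<in>{0..<m}. cyclic_coeff m P i * ru m (l * i) * ipoly Q (ru m l) * ru m (-(l * x))) / of_int m"
    unfolding cyclic_coeff_def[of m Q] sum_distrib_left sum_divide_distrib
    by (intro sum.cong refl) (simp add: algebra_simps diff_conv_add_uminus ru_add del: add_uminus_conv_diff)
  also have "(\<Sum>i\<in>{0..<m}. \<Sum>l\<in>{0..<m}. cyclic_coeff m P i * ru m (l * i) * ipoly Q (ru m l) * ru m (-(l * x))) =
    (\<Sum>l\<in>{0..<m}. ipoly P (ru m l) * ipoly Q (ru m l) * ru m (-(l * x)))"
    unfolding ipoly_ru_eq[OF assms, of P] sum_distrib_right by (rule sum.swap)
  finally show ?thesis by (simp add: cyclic_coeff_def)
qed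

section \<open>Frobenius congruences modulo a prime\<close>

lemma add_power_prime:
  fixes a b :: "'a::comm_ring_1"
  assumes "prime p"
  shows "\<exists>r. (a + b) ^ p = a ^ p + b ^ p + of_nat p * r"
proof -
  have p: "p > 0" "p \<noteq> 0" using assms prime_gt_0_nat by auto
  have "{..p} = insert 0 (insert p {1..<p})" using p by auto
  then have "(a + b) ^ p = a ^ p + b ^ p + (\<Sum>k\<in>{1..<p}. of_nat (p choose k) * a ^ k * b ^ (p - k))"
    using p by (simp add: binomial_ring algebra_simps)
  also have "(\<Sum>k\<in>{1..<p}. of_nat (p choose k) * a ^ k * b ^ (p - k)) =
     (\<Sum>k\<in>{1..<p}. of_nat p * (of_nat ((p choose k) div p) * a ^ k * b ^ (p - k)))"
  proof (intro sum.cong refl)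
    fix k assume "k \<in> {1..<p}"
    then have "p dvd (p choose k)" using assms by (intro dvd_choose_prime) auto
    then have "of_nat (p choose k) = (of_nat p * of_nat ((p choose k) div p) :: 'a)"
      by (metis dvd_mult_div_cancel of_nat_mult)
    then show "of_nat (p choose k) * a ^ k * b ^ (p - k) =
      (of_nat p * (of_nat ((p choose k) div p) * a ^ k * b ^ (p - k)) :: 'a)"
      by (simp add: mult.assoc)
  qed
  finally show ?thesis unfolding sum_distrib_left[symmetric] by blast
qed

lemma int_power_prime: assumes "prime p" shows "int p dvd a ^ p - a"
proof (induction a rule: int_induct[of _ 0])
  case base
  then show ?case using assms prime_gt_0_nat by (simp add: power_0_left)
next
  case (step1 i)
  obtain r where "(i + 1) ^ p = i ^ p + 1 ^ p + of_nat p * r" using add_power_prime[OF assms] by blast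
  then have "(i + 1) ^ p - (i + 1) = (i ^ p - i) + int p * r" by simp
  then show ?case using step1(2) by (metis dvd_add dvd_triv_left)
next
  case (step2 i)
  obtain r where "(i - 1 + 1) ^ p = (i - 1) ^ p + 1 ^ p + of_nat p * r" using add_power_prime[OF assms] by blast
  then have "(i - 1) ^ p - (i - 1) = (i ^ p - i) - int p * r" by simp
  then show ?case using step2(2) by (metis dvd_diff dvd_triv_left)
qed

text \<open>P(X)^p and P(X^p) agree modulo p, with the quotient made explicit: additivity of p-th
  powers modulo p peels off one coefficient at a time, and each coefficient obeys Fermat's
  congruence.\<close>

lemma int_poly_power_prime:
  fixes P :: "int poly"
  assumes "prime p"
  shows "\<exists>Q. P ^ p = pcompose P (monom 1 p) + smult (int p) Q"
proof (induction P)
  case 0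
  then show ?case using assms prime_gt_0_nat by (intro exI[of _ 0]) (simp add: power_0_left)
next
  case (pCons a P)
  then obtain Q where Q: "P ^ p = pcompose P (monom 1 p) + smult (int p) Q" by blast
  obtain r where r: "([:a:] + monom 1 1 * P) ^ p = [:a:] ^ p + (monom 1 1 * P) ^ p + of_nat p * r"
    using add_power_prime[OF assms] by blast
  obtain s where s: "a ^ p - a = int p * s" using int_power_prime[OF assms] by blast
  have "pCons a P = [:a:] + monom 1 1 * P" by (simp add: monom_altdef)
  then have "pCons a P ^ p = [:a ^ p:] + monom 1 p * P ^ p + of_nat p * r"
    using r by (simp add: power_mult_distrib poly_const_pow monom_power)
  also have "[:a ^ p:] = [:a:] + smult (int p) [:s:]" using s by (simp add: algebra_simps)
  also have "of_nat p * r = smult (int p) r" by (simp add: of_nat_poly)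
  finally have "pCons a P ^ p = pcompose (pCons a P) (monom 1 p)
      + smult (int p) ([:s:] + monom 1 p * Q + r)"
    unfolding Q by (simp add: pcompose_pCons algebra_simps smult_add_right)
  then show ?case by blast
qed


section \<open>Zero sets of integer polynomials among the roots of unity\<close>

lemma int_dependence:
  fixes v :: "'i \<Rightarrow> 'x \<Rightarrow> int"
  assumes "finite X" "finite I" "card X < card I"
  shows "\<exists>c. (\<exists>i\<in>I. c i \<noteq> 0) \<and> (\<forall>x\<in>X. (\<Sum>i\<in>I. c i * v i x) = 0)"
  using assms
proof (induction X arbitrary: I v rule: finite_induct)
  case empty
  then have "I \<noteq> {}" by auto
  then show ?case by (intro exI[of _ "\<lambda>_. 1"]) auto
next
  case (insert x X)
  show ?case
  proof (cases "\<forall>i\<in>I. v i x = 0")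
    case True
    obtain c where "\<exists>i\<in>I. c i \<noteq> 0" "\<forall>y\<in>X. (\<Sum>i\<in>I. c i * v i y) = 0"
      using insert.IH[of I v] insert.prems insert.hyps by auto
    then show ?thesis using True by auto
  next
    case False
    then obtain j where j: "j \<in> I" "v j x \<noteq> 0" by blast
    define J where "J = I - {j}"
    have J: "finite J" "j \<notin> J" "I = insert j J" using insert.prems j by (auto simp: J_def)
    \<comment> \<open>Cross-multiplying with the pivot \<open>j\<close> kills the coordinate
      \<open>x\<close> without division, so the dependence of the remaining vectors stays integral;
      \<open>d\<close> below restores the coefficient of the pivot vector.\<close>
    define w where "w i y = v j x * v i y - v i x * v j y" for i y
    have "card X < card J" using insert.prems insert.hyps J by simp
    then obtain c where c: "\<exists>i\<in>J. c i \<noteq> 0" "\<forall>y\<in>X. (\<Sum>i\<in>J. c i * w i y) = 0"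
      using insert.IH[of J w] J by auto
    define d where "d i = (if i = j then - (\<Sum>i\<in>J. c i * v i x) else v j x * c i)" for i
    have "(\<Sum>i\<in>I. d i * v i y) = (\<Sum>i\<in>J. c i * w i y)" for y
    proof -
      have "(\<Sum>i\<in>J. d i * v i y) = (\<Sum>i\<in>J. v j x * c i * v i y)"
        using J by (intro sum.cong) (auto simp: d_def)
      then have "(\<Sum>i\<in>I. d i * v i y) =
          - (\<Sum>i\<in>J. c i * v i x) * v j y + (\<Sum>i\<in>J. v j x * c i * v i y)"
        using J by (simp add: d_def)
      then show ?thesis
        by (simp add: w_def algebra_simps sum_subtractf sum_distrib_left)
    qed
    moreover have "w i x = 0" for i by (simp add: w_def)
    moreover have "\<exists>i\<in>I. d i \<noteq> 0" using c(1) j J by (auto simp: d_def)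
    ultimately show ?thesis using c(2) by (intro exI[of _ d]) auto
  qed
qed

text \<open>\<open>C\<close> is an integer multiple of the idempotent of the zero set of \<open>P\<close> among the roots of
  unity; it is the value at \<open>P\<close> of the part prime to \<open>X\<close> of an annihilating polynomial of \<open>P\<close>.\<close>

lemma zero_set_polynomial:
  assumes "m > 0"
  shows "\<exists>C D. D \<noteq> 0 \<and> (\<forall>k. ipoly C (ru m k) = (if ipoly P (ru m k) = 0 then of_int D else 0))"
proof -
  define N where "N = nat m"
  define v where "v i x = \<lfloor>Re (cyclic_coeff m (P ^ i) x)\<rfloor>" for i x
  have v: "of_int (v i x) = cyclic_coeff m (P ^ i) x" for i x
    unfolding v_def using cyclic_coeff_floor[OF assms] by metis
  \<comment> \<open>The powers of \<open>P\<close> with exponents 0 to \<open>m\<close> are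
    \<open>m + 1\<close> vectors with \<open>m\<close> integer coordinates. Their dependence is a
    polynomial \<open>q\<close> that annihilates every value of \<open>P\<close> at a root of
    unity.\<close>
  have "\<exists>c. (\<exists>i\<in>{..N}. c i \<noteq> 0) \<and> (\<forall>x\<in>{0..<m}. (\<Sum>i\<le>N. c i * v i x) = 0)"
    by (rule int_dependence) (use assms in \<open>auto simp: N_def\<close>)
  then obtain c where c: "\<exists>i\<le>N. c i \<noteq> 0" "\<And>x. x \<in> {0..<m} \<Longrightarrow> (\<Sum>i\<le>N. c i * v i x) = 0"
    by blast
  define q where "q = (\<Sum>i\<le>N. monom (c i) i)"
  have "q \<noteq> 0"
  proof -
    obtain i where "i \<le> N" "c i \<noteq> 0" using c by blast
    then have "coeff q i \<noteq> 0" by (auto simp: q_def coeff_sum)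
    then show ?thesis by auto
  qed
  have q: "ipoly q (ipoly P (ru m k)) = 0" for k
  proof -
    have "ipoly q (ipoly P (ru m k)) = (\<Sum>i\<le>N. of_int (c i) * ipoly (P ^ i) (ru m k))"
      by (simp add: q_def)
    also have "\<dots> = (\<Sum>i\<le>N. \<Sum>x\<in>{0..<m}. of_int (c i * v i x) * ru m (k * x))"
      unfolding ipoly_ru_eq[OF assms, of "P ^ _"] v[symmetric] by (simp add: sum_distrib_left mult.assoc)
    also have "\<dots> = (\<Sum>x\<in>{0..<m}. of_int (\<Sum>i\<le>N. c i * v i x) * ru m (k * x))"
      by (subst sum.swap) (simp add: sum_distrib_right)
    also have "\<dots> = 0" using c by simp
    finally show ?thesis .
  qed
  obtain r where r: "q = [:0, 1:] ^ Polynomial.order 0 q * r" "\<not> [:0, 1:] dvd r"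
    using order_decomp[OF \<open>q \<noteq> 0\<close>, of 0] by auto
  define D where "D = poly r 0"
  have "D \<noteq> 0" using r(2) by (simp add: D_def poly_eq_0_iff_dvd)
  moreover have "ipoly (pcompose r P) (ru m k) = (if ipoly P (ru m k) = 0 then of_int D else 0)" for k
  proof (cases "ipoly P (ru m k) = 0")
    case True
    have "ipoly r 0 = of_int D" by (cases r) (simp add: D_def)
    then show ?thesis using True by simp
  next
    case False
    have "ipoly P (ru m k) ^ Polynomial.order 0 q * ipoly r (ipoly P (ru m k)) = 0"
      using q[of k] by (subst (asm) r(1)) simp
    then show ?thesis using False by simp
  qed
  ultimately show ?thesis by blast
qed

text \<open>Take D of least absolute value and suppose that p divides it. At the roots of unity C
  has only the values 0 and D, so C^p = D^(p-1) C; modulo p the left side is C(X^p) and the right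
  side vanishes. As p is a unit modulo \<open>m\<close>, the coefficients of C(X^p) are those of C
  permuted, so p divides them all, and dividing C and D by p contradicts minimality.\<close>

lemma zero_set_polynomial_coprime:
  assumes "m > 0" and p: "prime p" "\<not> int p dvd m"
  shows "\<exists>C D. \<not> int p dvd D \<and>
    (\<forall>k. ipoly C (ru m k) = (if ipoly P (ru m k) = 0 then of_int D else 0))"
proof -
  define good where "good C D \<longleftrightarrow> D \<noteq> 0 \<and>
    (\<forall>k. ipoly C (ru m k) = (if ipoly P (ru m k) = 0 then of_int D else 0))" for C D
  obtain C0 D0 where "good C0 D0" using zero_set_polynomial[OF assms(1)] by (metis good_def)
  then have "\<exists>n C D. good C D \<and> nat \<bar>D\<bar> = n" by blast
  then obtain n where n: "\<exists>C D. good C D \<and> nat \<bar>D\<bar> = n" "\<And>k. k < n \<Longrightarrow> \<not> (\<exists>C D. good C D \<and> nat \<bar>D\<bar> = k)"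
    using exists_least_iff[of "\<lambda>n. \<exists>C D. good C D \<and> nat \<bar>D\<bar> = n"] by blast
  then obtain C D where CD: "good C D" "nat \<bar>D\<bar> = n" by blast
  have C: "ipoly C (ru m k) = (if ipoly P (ru m k) = 0 then of_int D else 0)" for k
    using CD by (auto simp: good_def)
  have p0: "p > 1" using p prime_gt_1_nat by blast
  have "\<not> int p dvd D"
  proof
    assume dvd: "int p dvd D"
    have small: "\<exists>c. cyclic_coeff m C x = of_int (int p * c)" for x
    proof -
      obtain Q where Q: "C ^ p = pcompose C (monom 1 p) + smult (int p) Q"
        using int_poly_power_prime[OF p(1)] by blast
      have "cyclic_coeff m (C ^ p) y = cyclic_coeff m (smult (D ^ (p - 1)) C) y" for y
        using p0 by (intro cyclic_coeff_cong) (auto simp: C power_0_left simp flip: power_Suc2)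
      moreover have "cyclic_coeff m (pcompose C (monom 1 p)) (int p * x) = cyclic_coeff m C x"
        unfolding cyclic_coeff_def
      proof (rule arg_cong[where f = "\<lambda>x. x / of_int m"])
        have per: "periodic m (\<lambda>k. ipoly C (ru m k) * ru m (-(k * x)))"
          unfolding periodic_def
        proof (intro allI impI)
          fix a b assume ab: "m dvd a - b"
          then have "m dvd -(a * x) - (-(b * x))"
            by (metis dvd_diff_commute dvd_mult2 left_diff_distrib' minus_diff_minus dvd_minus_iff)
          then show "ipoly C (ru m a) * ru m (-(a * x)) = ipoly C (ru m b) * ru m (-(b * x))"
            using ru_cong[OF assms(1)] ab by metis
        qed
        have "coprime m (int p)" using p prime_imp_coprime[of "int p" m] by (simp add: coprime_commute)
        then have "i = j" if "i \<in> {0..<m}" "j \<in> {0..<m}" "m dvd int p * i - int p * j" for i j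
          using that by (metis atLeastLessThan_iff coprime_dvd_mult_right_iff mod_eq_dvd_iff mod_pos_pos_trivial right_diff_distrib')
        then have "(\<Sum>k\<in>{0..<m}. ipoly C (ru m (int p * k)) * ru m (-(int p * k * x))) =
            (\<Sum>k\<in>{0..<m}. ipoly C (ru m k) * ru m (-(k * x)))"
          by (intro sum_mod_reindex[OF assms(1) per])
        then
        show "(\<Sum>k\<in>{0..<m}. ipoly (pcompose C (monom 1 p)) (ru m k) * ru m (-(k * (int p * x)))) =
            (\<Sum>k\<in>{0..<m}. ipoly C (ru m k) * ru m (-(k * x)))"
          by (simp add: ru_power mult_ac)
      qed
      ultimately have "of_int (D ^ (p - 1)) * cyclic_coeff m C (int p * x) =
          cyclic_coeff m C x + of_int (int p) * cyclic_coeff m Q (int p * x)"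
        by (metis Q cyclic_coeff_add cyclic_coeff_smult)
      moreover have "int p dvd D ^ (p - 1)" using dvd p0 by (simp add: dvd_power_iff dvd_trans dvd_power)
      then obtain d where d: "D ^ (p - 1) = int p * d" by blast
      moreover obtain a b where "cyclic_coeff m C (int p * x) = of_int a" "cyclic_coeff m Q (int p * x) = of_int b"
        using cyclic_coeff_floor[OF assms(1)] by blast
      ultimately have "of_int (int p * d) * of_int a = cyclic_coeff m C x + of_int (int p) * of_int b"
        by metis
      then have "cyclic_coeff m C x = of_int (int p * (d * a - b))"
        by (simp add: algebra_simps)
      then show ?thesis by blast
    qed
    then obtain c where c: "\<And>x. cyclic_coeff m C x = of_int (int p * c x)" by metis
    define C' where "C' = (\<Sum>x\<in>{0..<m}. monom (c x) (nat x))"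
    have "of_int (int p) * ipoly C' (ru m k) = ipoly C (ru m k)" for k
      unfolding C'_def ipoly_ru_eq[OF assms(1), of C] c ipoly_sum ipoly_monom sum_distrib_left ru_power
      by (intro sum.cong) (auto simp: mult_ac)
    then have "ipoly C' (ru m k) = ipoly C (ru m k) / of_nat p" for k
      using p0 by (simp add: eq_divide_eq mult.commute)
    moreover obtain D' where D': "D = int p * D'" using dvd by blast
    ultimately have "good C' D'" using CD p0 by (auto simp: good_def)
    moreover have "nat \<bar>D'\<bar> < n"
    proof -
      have "D' \<noteq> 0" "n = p * nat \<bar>D'\<bar>"
        using CD D' by (auto simp: good_def abs_mult nat_mult_distrib)
      then show ?thesis using p0 by simp
    qed
    ultimately show False using n(2) by blast
  qed
  then show ?thesis using C by blast
qed

text \<open>The zero-set polynomial C is compared with C(X^p). Modulo p they agree, since C^p =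
  D^(p-1) C and D^(p-1) is 1, so the difference \<open>E\<close> is p times an integer polynomial
  \<open>B\<close>. The few possible values of \<open>E\<close> are too rigid for that: its powers
  show that the coefficients of \<open>E\<close> are divisible by arbitrarily high powers of p. So
  \<open>E\<close> vanishes and the zero set is stable under p-th powers.\<close>

lemma ipoly_ru_prime_zero:
  assumes "m > 0" and p: "prime p" "\<not> int p dvd m" and P: "ipoly P (ru m k) = 0"
  shows "ipoly P (ru m (int p * k)) = 0"
proof -
  obtain C D where D: "\<not> int p dvd D"
    and C: "\<And>k. ipoly C (ru m k) = (if ipoly P (ru m k) = 0 then of_int D else 0)"
    using zero_set_polynomial_coprime[OF assms(1) p] by metis
  have p0: "p > 1" using p prime_gt_1_nat by blast
  define E where "E = C - pcompose C (monom 1 p)"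
  have E: "ipoly E (ru m k) \<in> {0, of_int D, - of_int D}" for k
    unfolding E_def by (auto simp: C ru_power)
  have coE: "\<exists>b. cyclic_coeff m E x = of_int p * of_int b" for x
  proof -
    obtain Q where Q: "C ^ p = pcompose C (monom 1 p) + smult (int p) Q"
      using int_poly_power_prime[OF p(1)] by blast
    obtain s where s: "D ^ (p - 1) = 1 + int p * s"
    proof -
      have "int p dvd D * (D ^ (p - 1) - 1)"
        using int_power_prime[OF p(1), of D] p0 by (cases p) (auto simp: right_diff_distrib)
      then have "int p dvd D ^ (p - 1) - 1" using D p by (simp add: prime_dvd_mult_iff)
      then show ?thesis using that by (metis add.commute diff_add_cancel dvdE)
    qed
    have "cyclic_coeff m (C ^ p) x = cyclic_coeff m (smult (D ^ (p - 1)) C) x"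
      using p0 by (intro cyclic_coeff_cong) (auto simp: C power_0_left simp flip: power_Suc2)
    then have "cyclic_coeff m E x = of_int (int p) * (cyclic_coeff m Q x - of_int s * cyclic_coeff m C x)"
      unfolding Q E_def cyclic_coeff_add cyclic_coeff_diff cyclic_coeff_smult s
      by (simp add: algebra_simps)
    moreover obtain a b where "cyclic_coeff m C x = of_int a" "cyclic_coeff m Q x = of_int b"
      using cyclic_coeff_floor[OF assms(1)] by blast
    ultimately show ?thesis by (metis of_int_diff of_int_mult of_int_of_nat_eq)
  qed
  then obtain b where b: "\<And>x. cyclic_coeff m E x = of_int p * of_int (b x)" by metis
  define B where "B = (\<Sum>x\<in>{0..<m}. monom (b x) (nat x))"
  have B: "ipoly E (ru m k) = of_nat p * ipoly B (ru m k)" for k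
    unfolding B_def ipoly_ru_eq[OF assms(1), of E] b ipoly_sum ipoly_monom sum_distrib_left ru_power
    by (intro sum.cong) (auto simp: mult_ac)
  have "cyclic_coeff m E x = 0" for x
  proof -
    obtain e where e: "cyclic_coeff m E x = of_int e"
      using cyclic_coeff_floor[OF assms(1)] by blast
    \<comment> \<open>The values 0, D and -D all satisfy z^(2j+1) = D^(2j) z, the sign being
      harmless for odd exponents. Hence D^(2j) times a coefficient of \<open>E\<close> is p^(2j+1)
      times one of a power of \<open>B\<close>, and D is prime to p.\<close>
    have "int p ^ (2 * j + 1) dvd e" for j
    proof -
      have "(z::complex) ^ (2 * j + 1) = of_int D ^ (2 * j) * z" if "z \<in> {0, of_int D, - of_int D}" for z
        using that by auto
      then have "ipoly (E ^ (2 * j + 1)) (ru m k) = ipoly (smult (D ^ (2 * j)) E) (ru m k)" for k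
        using E[of k] by simp
      then have "cyclic_coeff m (smult (D ^ (2 * j)) E) x = cyclic_coeff m (smult (int p ^ (2 * j + 1)) (B ^ (2 * j + 1))) x"
        by (intro cyclic_coeff_cong) (metis B ipoly_power ipoly_smult of_int_of_nat_eq of_int_power power_mult_distrib)
      moreover obtain a where "cyclic_coeff m (B ^ (2 * j + 1)) x = of_int a"
        using cyclic_coeff_floor[OF assms(1)] by blast
      ultimately have "D ^ (2 * j) * e = int p ^ (2 * j + 1) * a"
        unfolding cyclic_coeff_smult e by (metis of_int_eq_iff of_int_mult)
      moreover have "coprime (int p ^ (2 * j + 1)) (D ^ (2 * j))"
        using D p prime_imp_coprime[of "int p" D] by simp
      ultimately show ?thesis by (metis coprime_dvd_mult_right_iff dvd_triv_left)
    qed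
    moreover have "\<not> int p ^ (2 * nat \<bar>e\<bar> + 1) dvd e" if "e \<noteq> 0"
    proof
      assume "int p ^ (2 * nat \<bar>e\<bar> + 1) dvd e"
      then have "int (p ^ (2 * nat \<bar>e\<bar> + 1)) \<le> \<bar>e\<bar>"
        using dvd_imp_le_int[OF that, of "int p ^ (2 * nat \<bar>e\<bar> + 1)"] by simp
      moreover have "2 * nat \<bar>e\<bar> + 1 < p ^ (2 * nat \<bar>e\<bar> + 1)" using p0 by (intro power_gt_expt) auto
      ultimately show False by linarith
    qed
    ultimately show ?thesis using e by force
  qed
  then have "ipoly E (ru m k) = 0" unfolding ipoly_ru_eq[OF assms(1), of E] by simp
  then have "ipoly C (ru m (int p * k)) = of_int D"
    using P by (simp add: E_def C[of k] ru_power)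
  then show ?thesis using D by (auto simp: C split: if_splits)
qed

text \<open>Over all \<open>P\<close> this says that the cyclotomic polynomials are irreducible.\<close>

lemma ipoly_ru_coprime_zero:
  assumes "m > 0" "coprime (int u) m" "ipoly P (ru m k) = 0"
  shows "ipoly P (ru m (int u * k)) = 0"
proof (cases "u = 0")
  case True
  then have "m = 1" using assms by simp
  then have "ru m k = 1" by (simp add: ru_eq_1_iff)
  then show ?thesis using assms True by simp
next
  case False
  then show ?thesis using assms(2,3)
  proof (induction u arbitrary: k rule: prime_divisors_induct)
    case (factor p u)
    then have "\<not> int p dvd m"
      using coprime_common_divisor[of "int (p * u)" m "int p"] prime_gt_1_nat[of p] by auto
    then have "ipoly P (ru m (int p * k)) = 0"
      using ipoly_ru_prime_zero[OF assms(1) factor.hyps] factor.prems by blast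
    then have "ipoly P (ru m (int u * (int p * k))) = 0"
      using factor by simp
    then show ?case by (simp add: mult_ac)
  qed auto
qed

section \<open>Rational Schur rings over a finite cyclic group\<close>

text \<open>The shift is \<open>b\<close> times the product of those primes of \<open>n\<close> that
  do not divide \<open>a\<close>. Each prime of \<open>n\<close> then divides exactly one of the two
  summands.\<close>

lemma coprime_shift:
  fixes a b n :: int
  assumes "coprime a b" "n \<noteq> 0"
  shows "\<exists>j. coprime (a + b * j) n"
proof -
  define F where "F = {p \<in> prime_factors n. \<not> p dvd a}"
  have F: "finite F" by (simp add: F_def)
  have "coprime (a + b * \<Prod>F) n"
  proof (rule coprimeI, rule ccontr)
    fix c assume c: "c dvd a + b * \<Prod>F" "c dvd n" "\<not> is_unit c"
    then obtain p where p: "prime p" "p dvd c"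
      using prime_divisor_exists[of c] assms by fastforce
    then have pp: "p dvd a + b * \<Prod>F" "p dvd n" using c dvd_trans by blast+
    show False
    proof (cases "p dvd a")
      case True
      then have "p dvd b * \<Prod>F" using pp by (simp add: dvd_add_right_iff)
      moreover have "\<not> p dvd b" using True assms p by (meson coprime_common_divisor not_prime_unit)
      moreover have "\<not> p dvd \<Prod>F"
      proof
        assume "p dvd \<Prod>F"
        then obtain r where "r \<in> F" "p dvd r"
          using p F prime_dvd_prod_iff[of F p "\<lambda>x. x"] by auto
        then have "p = r" using p by (auto simp: F_def in_prime_factors_iff intro!: primes_dvd_imp_eq)
        then show False using \<open>r \<in> F\<close> True by (simp add: F_def)
      qed
      ultimately show False using p by (simp add: prime_dvd_mult_iff)
    next
      case False
      then have "p \<in> F" using p pp assms by (auto simp: F_def in_prime_factors_iff)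
      then have "p dvd \<Prod>F" using dvd_prodI[of F p "\<lambda>x. x"] F by simp
      then show False using pp False by (metis dvd_add_left_iff dvd_mult)
    qed
  qed
  then show ?thesis by blast
qed

text \<open>Every class modulo \<open>d\<close> contains an element whose gcd with \<open>m\<close>
  is as small as possible. So a function of the gcd with \<open>m\<close> that has period
  \<open>d\<close> is a function of the gcd with \<open>d\<close>.\<close>

lemma gcd_shift:
  fixes d m x :: int
  assumes "d dvd m" "m > 0" "d > 0"
  shows "\<exists>j. gcd (x + d * j) m = gcd x d"
proof -
  define g where "g = gcd x d"
  have g: "g > 0" using assms by (simp add: g_def)
  obtain x' d' where xd: "x = x' * g" "d = d' * g" "coprime x' d'"
    using gcd_coprime_exists[of x d] g unfolding g_def by auto
  obtain n where n: "m = g * n" using assms xd by (metis dvdE dvd_trans dvd_triv_right)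
  then obtain j where "coprime (x' + d' * j) n" using coprime_shift[OF xd(3), of n] assms by fastforce
  moreover have "x + d * j = g * (x' + d' * j)" using xd by (simp add: algebra_simps)
  ultimately have "gcd (x + d * j) m = g"
    using n g by (simp add: gcd_mult_distrib_int[symmetric] abs_of_pos)
  then show ?thesis unfolding g_def by blast
qed

text \<open>The classes of equal gcd are the orbits of the units. A Bezout coefficient is a unit
  only modulo m / gcd(x, m), and \<open>coprime_shift\<close> lifts it to a unit modulo
  \<open>m\<close>.\<close>

lemma gcd_unit_multiple:
  fixes x m :: int
  assumes "m > 0"
  shows "\<exists>u. coprime u m \<and> m dvd u * x - gcd x m"
proof -
  define g where "g = gcd x m"
  have g: "g > 0" using assms by (simp add: g_def)
  obtain x' m' where xm: "x = x' * g" "m = m' * g" "coprime x' m'"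
    using gcd_coprime_exists[of x m] g unfolding g_def by auto
  obtain u v where uv: "u * x' + v * m' = 1" using bezout_int[of x' m'] xm(3) by auto
  then have "coprime u m'" by (metis coprimeI dvd_add dvd_mult2 dvd_mult)
  then obtain j where j: "coprime (u + m' * j) m" using coprime_shift assms by (metis less_irrefl)
  have "(u + m' * j) * x - g = g * (u * x' - 1) + m' * g * (j * x')" using xm by (simp add: algebra_simps)
  also have "u * x' - 1 = - v * m'" using uv by simp
  finally have "(u + m' * j) * x - g = m * (j * x' - v)" using xm by (simp add: algebra_simps)
  then show ?thesis using j unfolding g_def by (metis dvd_triv_left)
qed

lemma gcd_eq_coprime_factors:
  fixes x y a b :: int
  assumes "coprime a b" "gcd x a = gcd y a" "gcd x b = gcd y b"
  shows "gcd x (a * b) = gcd y (a * b)"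
proof -
  have "gcd x (a * b) dvd gcd y (a * b)" if "gcd x a = gcd y a" "gcd x b = gcd y b" for x y
  proof -
    obtain a' b' where ab: "gcd x (a * b) = a' * b'" "a' dvd a" "b' dvd b"
      using division_decomp[of "gcd x (a * b)" a b] by auto
    then have "a' dvd x" "b' dvd x" by (metis dvd_mult_left dvd_mult_right gcd_dvd1)+
    then have "gcd x (a * b) dvd gcd x a * gcd x b"
      unfolding ab(1) using ab by (intro mult_dvd_mono) auto
    moreover have "coprime (gcd x a) (gcd x b)"
      using assms(1) by (meson coprime_divisors gcd_dvd2)
    then have "gcd x a * gcd x b dvd y"
      by (intro divides_mult) (use that in auto)
    moreover have "gcd x a * gcd x b dvd a * b" by (intro mult_dvd_mono) auto
    ultimately show ?thesis by (meson dvd_trans gcd_greatest)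
  qed
  from this[of x y] this[of y x] show ?thesis using assms by (intro zdvd_antisym_nonneg) auto
qed

lemma gcd_cong_int:
  fixes x y m :: int
  assumes "m dvd x - y" shows "gcd x m = gcd y m"
  using assms by (smt (verit, best) dvd_div_mult_self gcd.commute gcd_add_mult)

lemma sum_periodic_multiple:
  fixes f :: "int \<Rightarrow> complex"
  assumes "d > 0" "periodic d f"
  shows "(\<Sum>i\<in>{0..<d * int q}. f i) = of_nat q * (\<Sum>i\<in>{0..<d}. f i)"
proof (induction q)
  case (Suc q)
  have "{0..<d * int (Suc q)} = {0..<d * int q} \<union> {d * int q..<d * int q + d}"
  proof -
    have "d * int q \<ge> 0" "d * int (Suc q) = d * int q + d" using assms by (auto simp: algebra_simps)
    then show ?thesis using assms(1) ivl_disj_un_two(3)[of 0 "d * int q" "d * int q + d"] by simp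
  qed
  then have "(\<Sum>i\<in>{0..<d * int (Suc q)}. f i) =
      (\<Sum>i\<in>{0..<d * int q}. f i) + (\<Sum>i\<in>{d * int q..<d * int q + d}. f i)"
    by (simp add: sum.union_disjoint)
  also have "(\<Sum>i\<in>{d * int q..<d * int q + d}. f i) = (\<Sum>i\<in>{0..<d}. f (i + d * int q))"
    by (rule sum.reindex_bij_witness[of _ "\<lambda>i. i + d * int q" "\<lambda>i. i - d * int q"]) auto
  also have "\<dots> = (\<Sum>i\<in>{0..<d}. f i)" by (rule sum_mod_shift[OF assms])
  finally show ?case using Suc by (simp add: algebra_simps)
qed simp

text \<open>Rationality is the axiom \<open>A_gcd\<close>, which contains both periodicity modulo
  \<open>m\<close> and invariance under units. The last axiom is the unit of convolution.\<close>

locale rational_schur_ring =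
  fixes m :: int and A :: "(int \<Rightarrow> complex) set"
  assumes m_pos: "m > 0"
    and A_gcd: "a \<in> A \<Longrightarrow> a x = a (gcd x m)"
    and A_const: "(\<lambda>_. c) \<in> A"
    and A_add: "a \<in> A \<Longrightarrow> b \<in> A \<Longrightarrow> (\<lambda>x. a x + b x) \<in> A"
    and A_mult: "a \<in> A \<Longrightarrow> b \<in> A \<Longrightarrow> (\<lambda>x. a x * b x) \<in> A"
    and A_conv: "a \<in> A \<Longrightarrow> b \<in> A \<Longrightarrow> (\<lambda>x. \<Sum>i\<in>{0..<m}. a i * b (x - i)) \<in> A"
    and A_unit: "(\<lambda>x. of_bool (m dvd x)) \<in> A"
begin

lemma A_sum: "(\<And>i. i \<in> I \<Longrightarrow> F i \<in> A) \<Longrightarrow> (\<lambda>x. \<Sum>i\<in>I. F i x) \<in> A"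
  by (induction I rule: infinite_finite_induct) (auto intro: A_const A_add)

lemma A_prod: "(\<And>i. i \<in> I \<Longrightarrow> F i \<in> A) \<Longrightarrow> (\<lambda>x. \<Prod>i\<in>I. F i x) \<in> A"
  by (induction I rule: infinite_finite_induct) (auto intro: A_const A_mult)

text \<open>An element takes finitely many values, so any function of it is a Lagrange interpolation
  polynomial in it. Hence all level sets of elements have their indicators in the ring.\<close>

lemma A_comp:
  assumes "a \<in> A" shows "(\<lambda>x. \<phi> (a x)) \<in> A"
proof -
  define R where "R = a ` {1..m}"
  have R: "finite R" "a x \<in> R" for x
  proof -
    have "gcd x m \<in> {1..m}" using m_pos by (auto simp: gcd_le2_int int_one_le_iff_zero_less)
    then show "a x \<in> R" using A_gcd[OF assms, of x] by (auto simp: R_def)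
  qed (simp add: R_def)
  have "(\<lambda>x. \<Sum>c\<in>R. \<phi> c * (\<Prod>c'\<in>R - {c}. (a x + (- c')) * inverse (c - c'))) \<in> A"
    by (intro A_sum A_mult A_prod A_add A_const assms)
  also have "(\<lambda>x. \<Sum>c\<in>R. \<phi> c * (\<Prod>c'\<in>R - {c}. (a x + (- c')) * inverse (c - c'))) = (\<lambda>x. \<phi> (a x))"
  proof
    fix x
    have "(\<Prod>c'\<in>R - {c}. (a x + (- c')) * inverse (c - c')) = of_bool (c = a x)" if "c \<in> R" for c
    proof (cases "c = a x")
      case True
      then show ?thesis by (auto intro!: prod.neutral right_inverse)
    next
      case False
      then show ?thesis using R by (auto intro!: prod_zero)
    qed
    then have "(\<Sum>c\<in>R. \<phi> c * (\<Prod>c'\<in>R - {c}. (a x + (- c')) * inverse (c - c'))) =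
        (\<Sum>c\<in>R. if c = a x then \<phi> c else 0)"
      by (intro sum.cong) auto
    then show "(\<Sum>c\<in>R. \<phi> c * (\<Prod>c'\<in>R - {c}. (a x + (- c')) * inverse (c - c'))) = \<phi> (a x)"
      using R by simp
  qed
  finally show ?thesis .
qed

section \<open>Sets and subgroups whose indicators lie in the ring\<close>

definition aset :: "int set \<Rightarrow> bool" where
  "aset S \<longleftrightarrow> (\<lambda>x. of_bool (x \<in> S)) \<in> A"

lemma aset_pred: "a \<in> A \<Longrightarrow> aset {x. P (a x)}"
  using A_comp[of a "\<lambda>z. of_bool (P z)"] by (simp add: aset_def)

lemma aset_gcd: assumes "aset S" "gcd x m = gcd y m" shows "x \<in> S \<longleftrightarrow> y \<in> S"
proof -
  have "of_bool (x \<in> S) = (of_bool (y \<in> S) :: complex)"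
    using A_gcd[OF assms(1)[unfolded aset_def], of x] A_gcd[OF assms(1)[unfolded aset_def], of y] assms(2)
    by simp
  then show ?thesis by (simp split: if_splits add: of_bool_def)
qed

lemma aset_periodic: "aset S \<Longrightarrow> m dvd x - y \<Longrightarrow> x \<in> S \<longleftrightarrow> y \<in> S"
  using aset_gcd gcd_cong_int by blast

lemma aset_uminus: "aset S \<Longrightarrow> - x \<in> S \<longleftrightarrow> x \<in> S"
  using aset_gcd[of S "-x" x] by simp

lemma aset_Compl: "aset S \<Longrightarrow> aset (- S)"
  using aset_pred[of "\<lambda>x. of_bool (x \<in> S)" "\<lambda>z. z = 0"] by (simp add: aset_def Compl_eq)

lemma aset_Int: "aset S \<Longrightarrow> aset T \<Longrightarrow> aset (S \<inter> T)"
  using A_mult[of "\<lambda>x. of_bool (x \<in> S)" "\<lambda>x. of_bool (x \<in> T)"] by (simp add: aset_def of_bool_conj)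

lemma aset_UNIV: "aset UNIV"
  using A_const[of 1] by (simp add: aset_def)

lemma finite_asets: "finite {S. aset S}"
proof (rule inj_on_finite)
  show "inj_on (\<lambda>S. S \<inter> {1..m}) {S. aset S}"
  proof (rule inj_onI)
    fix S T assume *: "S \<in> {S. aset S}" "T \<in> {S. aset S}" "S \<inter> {1..m} = T \<inter> {1..m}"
    have "x \<in> S \<longleftrightarrow> x \<in> T" for x
    proof -
      have "gcd x m \<in> {1..m}" using m_pos by (auto simp: gcd_le2_int int_one_le_iff_zero_less)
      moreover have "x \<in> U \<longleftrightarrow> gcd x m \<in> U" if "aset U" for U by (rule aset_gcd[OF that]) simp
      ultimately show ?thesis using * by blast
    qed
    then show "S = T" by blast
  qed
  show "finite (Pow {1..m})" by simp
qed auto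

lemma aset_Inter: assumes "\<And>S. S \<in> F \<Longrightarrow> aset S" shows "aset (\<Inter>F)"
proof -
  have "finite F" using assms finite_subset[OF _ finite_asets] by blast
  then show ?thesis using assms
    by (induction F rule: finite_induct) (auto intro: aset_UNIV aset_Int)
qed

lemma aset_Union: assumes "\<And>S. S \<in> F \<Longrightarrow> aset S" shows "aset (\<Union>F)"
proof -
  have "aset (\<Inter>(uminus ` F))" using assms aset_Compl by (intro aset_Inter) auto
  then have "aset (- \<Inter>(uminus ` F))" by (rule aset_Compl)
  then show ?thesis by (simp add: Compl_INT)
qed

lemma aset_unit: "aset {x. m dvd x}"
  using A_unit by (simp add: aset_def)

text \<open>The convolution of the two indicators counts representations as a sum, and the sumset is
  the set where it is nonzero.\<close>

lemma aset_plus: assumes "aset S" "aset T" shows "aset {x. \<exists>i\<in>S. x - i \<in> T}"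
proof -
  define N where "N x = (\<Sum>i\<in>{0..<m}. of_bool (i \<in> S) * of_bool (x - i \<in> T) :: complex)" for x
  have "N \<in> A" unfolding N_def by (rule A_conv) (use assms in \<open>simp_all only: aset_def\<close>)
  moreover have "N x \<noteq> 0 \<longleftrightarrow> (\<exists>i\<in>S. x - i \<in> T)" for x
  proof -
    have "N x = of_nat (card {i \<in> {0..<m}. i \<in> S \<and> x - i \<in> T})"
      by (simp add: N_def sum.If_cases Int_def flip: of_bool_conj)
    then have "N x \<noteq> 0 \<longleftrightarrow> {i \<in> {0..<m}. i \<in> S \<and> x - i \<in> T} \<noteq> {}"
      by (simp del: atLeastLessThan_iff)
    also have "\<dots> \<longleftrightarrow> (\<exists>i\<in>{0..<m}. i \<in> S \<and> x - i \<in> T)" by blast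
    also have "\<dots> \<longleftrightarrow> (\<exists>i\<in>S. x - i \<in> T)"
    proof
      assume "\<exists>i\<in>S. x - i \<in> T"
      then obtain i where i: "i \<in> S" "x - i \<in> T" by blast
      have "m dvd i mod m - i" "m dvd (x - i mod m) - (x - i)"
        using dvd_minus_mod[of m i] by (auto simp: dvd_diff_commute)
      then have "i mod m \<in> S" "x - i mod m \<in> T" using i aset_periodic assms by blast+
      then show "\<exists>i\<in>{0..<m}. i \<in> S \<and> x - i \<in> T" using m_pos by (intro bexI[of _ "i mod m"]) auto
    qed auto
    finally show ?thesis .
  qed
  ultimately show ?thesis using aset_pred[of N "\<lambda>z. z \<noteq> 0"] by simp
qed

lemma aset_stab: assumes "aset S" shows "aset {x. \<forall>i\<in>S. x + i \<in> S}"
proof -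
  \<comment> \<open>As \<open>S\<close> is symmetric, failing to stabilise it means being the sum of
    an element of \<open>S\<close> and an element of its complement.\<close>
  have "- {x. \<forall>i\<in>S. x + i \<in> S} = {x. \<exists>i\<in>S. x - i \<in> - S}"
  proof (intro set_eqI iffI)
    fix x assume "x \<in> - {x. \<forall>i\<in>S. x + i \<in> S}"
    then obtain i where i: "i \<in> S" "x + i \<notin> S" by auto
    then have "- i \<in> S" "x - (- i) \<in> - S" using aset_uminus[OF assms] by auto
    then show "x \<in> {x. \<exists>i\<in>S. x - i \<in> - S}" by blast
  next
    fix x assume "x \<in> {x. \<exists>i\<in>S. x - i \<in> - S}"
    then obtain i where "i \<in> S" "x - i \<notin> S" by auto
    then have "- i \<in> S" "x + (- i) \<notin> S" using aset_uminus[OF assms] by auto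
    then show "x \<in> - {x. \<forall>i\<in>S. x + i \<in> S}" by blast
  qed
  then have "aset (- {x. \<forall>i\<in>S. x + i \<in> S})" using aset_plus[OF assms aset_Compl[OF assms]] by simp
  then have "aset (- (- {x. \<forall>i\<in>S. x + i \<in> S}))" by (rule aset_Compl)
  then show ?thesis by simp
qed

lemma aset_subgroup:
  assumes "aset H" "0 \<in> H" "\<And>x y. x \<in> H \<Longrightarrow> y \<in> H \<Longrightarrow> x + y \<in> H"
  shows "\<exists>d>0. d dvd m \<and> H = {x. d dvd x}"
proof -
  have mH: "m \<in> H" using aset_periodic[OF assms(1), of m 0] assms(2) by simp
  have neg: "- x \<in> H" if "x \<in> H" for x using aset_uminus[OF assms(1)] that by simp
  define n where "n = (LEAST n. n > 0 \<and> int n \<in> H)"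
  have "\<exists>n>0. int n \<in> H" using mH m_pos by (intro exI[of _ "nat m"]) auto
  then have n: "n > 0" "int n \<in> H" unfolding n_def by (metis (mono_tags, lifting) LeastI_ex)+
  have nmult: "int n * k \<in> H" for k
  proof (induction k rule: int_induct[of _ 0])
    case (step1 i)
    then have "int n * i + int n \<in> H" using assms(3) n(2) by blast
    then show ?case by (simp add: distrib_left)
  next
    case (step2 i)
    then have "int n * i + (- int n) \<in> H" using assms(3) neg n(2) by blast
    then show ?case by (simp add: right_diff_distrib')
  qed (simp add: assms)
  have "int n dvd x" if "x \<in> H" for x
  proof -
    have "x + int n * (- (x div int n)) \<in> H" using nmult that assms(3) by blast
    then have "x mod int n \<in> H" by (simp add: minus_mult_div_eq_mod)
    moreover have "x mod int n \<ge> 0" "x mod int n < int n" using n by auto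
    moreover have "\<not> (k > 0 \<and> int k \<in> H)" if "k < n" for k
      using not_less_Least that unfolding n_def by blast
    ultimately have "x mod int n = 0" by (metis nat_less_iff nat_0_le order_le_less zero_less_nat_eq)
    then show ?thesis by auto
  qed
  moreover have "x \<in> H" if "int n dvd x" for x using that nmult by auto
  ultimately show ?thesis using n mH by (intro exI[of _ "int n"]) auto
qed

lemma Gcd_insert_pos: "Gcd (insert m S) > 0"
  using m_pos by (metis Gcd_0_iff Gcd_int_greater_eq_0 insertI1 less_irrefl order_le_less singletonD subsetD)

definition asub :: "int \<Rightarrow> bool" where
  "asub d \<longleftrightarrow> d > 0 \<and> d dvd m \<and> aset {x. d dvd x}"

text \<open>\<open>U n\<close> collects the sums of at most \<open>n\<close> elements of
  \<open>S\<close> modulo \<open>m\<close>. The union over \<open>n\<close> is the generated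
  subgroup, and it has its indicator in the ring because only finitely many sets do, so that the
  union is a finite one.\<close>

lemma asub_generated:
  assumes "aset S" shows "asub (Gcd (insert m S))"
proof -
  define U where "U n = ((\<lambda>U. {x. \<exists>i\<in>U. x - i \<in> S \<union> {x. m dvd x}}) ^^ n) {x. m dvd x}" for n
  define H where "H = (\<Union>n. U n)"
  define g where "g = Gcd (insert m S)"
  have U_0: "U 0 = {x. m dvd x}" by (simp add: U_def)
  have U_Suc: "U (Suc n) = {x. \<exists>i\<in>U n. x - i \<in> S \<union> {x. m dvd x}}" for n by (simp add: U_def)
  have S': "aset (S \<union> {x. m dvd x})" using aset_Union[of "{S, {x. m dvd x}}"] assms aset_unit by auto
  have aU: "aset (U n)" for n
    by (induction n) (auto simp only: U_0 U_Suc aset_unit intro: aset_plus S')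
  then have "aset H" unfolding H_def by (auto intro: aset_Union)
  moreover have "0 \<in> H" using U_0 unfolding H_def by (metis UN_iff UNIV_I dvd_0_right mem_Collect_eq)
  moreover have "x + y \<in> H" if "x \<in> H" "y \<in> H" for x y
  proof -
    have "x + y \<in> U (i + j)" if "x \<in> U i" "y \<in> U j" for i j
      using that(2)
    proof (induction j arbitrary: y)
      case 0
      then show ?case using that(1) aset_periodic[OF aU, of "x + y" x i] U_0 by simp
    next
      case (Suc j)
      then obtain k where "k \<in> U j" "y - k \<in> S \<union> {x. m dvd x}" unfolding U_Suc by blast
      then show ?case using Suc.IH[of k] by (auto simp: U_Suc intro!: bexI[of _ "x + k"])
    qed
    then show ?thesis using that unfolding H_def by blast
  qed
  ultimately obtain d where d: "d > 0" "d dvd m" "H = {x. d dvd x}" using aset_subgroup by metis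
  have gS: "g dvd x" if "x \<in> insert m S" for x using that by (simp add: g_def Gcd_dvd del: Gcd_insert)
  have "g dvd x" if "x \<in> U n" for x n
    using that
  proof (induction n arbitrary: x)
    case 0 then show ?case using gS[of m] dvd_trans by (auto simp: U_0)
  next
    case (Suc n)
    then obtain i where i: "i \<in> U n" "x - i \<in> S \<union> {x. m dvd x}" unfolding U_Suc by blast
    then have "g dvd i" "g dvd x - i" using Suc.IH gS dvd_trans by auto
    then show ?case by (metis diff_add_cancel dvd_add)
  qed
  then have "g dvd d" using d by (metis H_def UN_iff dvd_refl mem_Collect_eq)
  moreover have "S \<subseteq> U 1" by (auto simp: U_def intro!: bexI[of _ 0])
  then have "d dvd g" unfolding g_def using d by (intro Gcd_greatest) (auto simp: H_def)
  moreover have "g > 0" unfolding g_def by (rule Gcd_insert_pos)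
  ultimately have "g = d" using d by (simp add: zdvd_antisym_nonneg)
  then show ?thesis using d \<open>aset H\<close> by (simp add: asub_def g_def)
qed

lemma asub_lcm: assumes "asub d" "asub e" shows "asub (lcm d e)"
proof -
  have "{x. lcm d e dvd x} = {x. d dvd x} \<inter> {x. e dvd x}" by auto
  then show ?thesis using assms aset_Int by (auto simp: asub_def lcm_pos_int)
qed

lemma asub_gcd: assumes "asub d" "asub e" shows "asub (gcd d e)"
proof -
  have "{x. gcd d e dvd x} = {x. \<exists>i\<in>{x. d dvd x}. x - i \<in> {x. e dvd x}}"
  proof (intro set_eqI iffI)
    fix x assume "x \<in> {x. gcd d e dvd x}"
    then obtain k where "x = gcd d e * k" by auto
    moreover obtain u v where "u * d + v * e = gcd d e" using bezout_int by blast
    ultimately have "x = d * (u * k) + e * (v * k)" by (metis distrib_right mult.assoc mult.commute)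
    then have "d dvd d * (u * k)" "e dvd x - d * (u * k)" by auto
    then show "x \<in> {x. \<exists>i\<in>{x. d dvd x}. x - i \<in> {x. e dvd x}}" by blast
  next
    fix x assume "x \<in> {x. \<exists>i\<in>{x. d dvd x}. x - i \<in> {x. e dvd x}}"
    then obtain i where i: "d dvd i" "e dvd x - i" by auto
    have "gcd d e dvd i + (x - i)" by (intro dvd_add dvd_trans[OF gcd_dvd1 i(1)] dvd_trans[OF gcd_dvd2 i(2)])
    then show "x \<in> {x. gcd d e dvd x}" by simp
  qed
  then have "aset {x. gcd d e dvd x}" using assms aset_plus[of "{x. d dvd x}" "{x. e dvd x}"] by (simp only: asub_def)
  then show ?thesis using assms by (auto simp: asub_def intro: dvd_trans[of "gcd d e" d])
qed

lemma A_periodic_gcd: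
  assumes "a \<in> A" "d dvd m" "d > 0" "periodic d a" shows "a x = a (gcd x d)"
proof -
  obtain j where "gcd (x + d * j) m = gcd x d" using gcd_shift assms m_pos by blast
  moreover have "a x = a (x + d * j)" by (rule periodicD[OF assms(4)]) simp
  ultimately show ?thesis using A_gcd[OF assms(1)] by metis
qed

text \<open>A sum over a full period modulo \<open>m\<close> is m / d times the sum over a period
  modulo \<open>d\<close>, so convolution is preserved up to a constant. This is what allows
  induction on the modulus.\<close>

lemma quotient:
  assumes "asub d" shows "rational_schur_ring d {a \<in> A. \<forall>x. a x = a (gcd x d)}"
proof unfold_locales
  show d: "d > 0" using assms by (simp add: asub_def)
  show "a x = a (gcd x d)" if "a \<in> {a \<in> A. \<forall>x. a x = a (gcd x d)}" for a x
    using that by auto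
  show "(\<lambda>_. c) \<in> {a \<in> A. \<forall>x. a x = a (gcd x d)}" for c using A_const by simp
  show "(\<lambda>x. a x + b x) \<in> {a \<in> A. \<forall>x. a x = a (gcd x d)}" "(\<lambda>x. a x * b x) \<in> {a \<in> A. \<forall>x. a x = a (gcd x d)}"
    if "a \<in> {a \<in> A. \<forall>x. a x = a (gcd x d)}" "b \<in> {a \<in> A. \<forall>x. a x = a (gcd x d)}" for a b
    using that A_add A_mult by auto
  show "(\<lambda>x. of_bool (d dvd x)) \<in> {a \<in> A. \<forall>x. a x = a (gcd x d)}"
    using assms by (auto simp: asub_def aset_def)
  show "(\<lambda>x. \<Sum>i\<in>{0..<d}. a i * b (x - i)) \<in> {a \<in> A. \<forall>x. a x = a (gcd x d)}" (is "?c \<in> _")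
    if ab: "a \<in> {a \<in> A. \<forall>x. a x = a (gcd x d)}" "b \<in> {a \<in> A. \<forall>x. a x = a (gcd x d)}" for a b
  proof -
    have per: "a x = a y" "b x = b y" if "d dvd x - y" for x y
      using ab gcd_cong_int[OF that] by (metis (mono_tags, lifting) mem_Collect_eq)+
    obtain q where q: "m = d * q" using assms by (auto simp: asub_def)
    then have q0: "q > 0" using m_pos d by (simp add: zero_less_mult_iff)
    have "?c = (\<lambda>x. inverse (of_int q) * (\<Sum>i\<in>{0..<m}. a i * b (x - i)))"
    proof
      fix x
      have "periodic d (\<lambda>i. a i * b (x - i))"
        unfolding periodic_def
      proof (intro allI impI)
        fix i j assume "d dvd i - j"
        then have "d dvd (x - i) - (x - j)" by (simp add: dvd_diff_commute)
        then show "a i * b (x - i) = a j * b (x - j)" using per \<open>d dvd i - j\<close> by metis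
      qed
      from sum_periodic_multiple[OF d this, of "nat q"]
      show "?c x = inverse (of_int q) * (\<Sum>i\<in>{0..<m}. a i * b (x - i))" using q q0 by simp
    qed
    then have cA: "?c \<in> A" using ab by (simp add: A_mult A_const A_conv)
    have "periodic d ?c"
      unfolding periodic_def using per by (auto intro!: sum.cong)
    moreover have "d dvd m" using assms by (simp add: asub_def)
    ultimately have "?c x = ?c (gcd x d)" for x
      using A_periodic_gcd[OF cA _ d] by blast
    then show ?thesis using cA by blast
  qed
qed


section \<open>Frobenius images of sets\<close>

lemma pcompose_monom_1: "pcompose (monom 1 k) (p :: int poly) = p ^ k"
proof (induction k)
  case 0
  then show ?case using pcompose_const[of 1 p] by (simp add: monom_0)
qed (simp add: monom_Suc pcompose_pCons)

text \<open>The points at which multiplication by \<open>q\<close> pushes the indicator of \<open>S\<close> to a value not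
  divisible by \<open>q\<close>. Modulo \<open>q\<close> this push-forward is the \<open>q\<close>-th convolution power.\<close>

definition frob :: "nat \<Rightarrow> int set \<Rightarrow> int set" where
  "frob q S = {x. \<not> q dvd card {i \<in> {0..<m}. i \<in> S \<and> m dvd x - int q * i}}"

text \<open>Non-divisibility by \<open>q\<close> may be tested on the \<open>q\<close>-th
  convolution power of the indicator, which is an element of the ring; the set is thus a union of
  level sets.\<close>

lemma aset_frob:
  assumes "aset S" "prime q" shows "aset (frob q S)"
proof -
  define P :: "int poly" where "P = (\<Sum>i\<in>{0..<m} \<inter> S. monom 1 (nat i))"
  have P1: "cyclic_coeff m P x = of_bool (x \<in> S)" for x
  proof -
    have "cyclic_coeff m P x = (\<Sum>i\<in>{0..<m} \<inter> S. of_bool (i = x mod m))"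
      unfolding P_def cyclic_coeff_sum cyclic_coeff_monom[OF m_pos]
    proof (intro sum.cong refl)
      fix i assume "i \<in> {0..<m} \<inter> S"
      then have "m dvd x - int (nat i) \<longleftrightarrow> i = x mod m"
        by (auto simp flip: mod_eq_dvd_iff)
      then show "(if m dvd x - int (nat i) then complex_of_int 1 else 0) = of_bool (i = x mod m)" by simp
    qed
    also have "\<dots> = of_bool (x mod m \<in> S)"
      using m_pos by (auto simp: of_bool_def)
    also have "x mod m \<in> S \<longleftrightarrow> x \<in> S"
      by (rule aset_periodic[OF assms(1)]) (metis dvd_minus_mod dvd_diff_commute)
    finally show ?thesis .
  qed
  have cA: "cyclic_coeff m (P ^ n) \<in> A" for n
  proof (induction n)
    case 0
    have "cyclic_coeff m 1 = (\<lambda>x. of_bool (m dvd x))"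
      using cyclic_coeff_monom[OF m_pos, of 1 0] by (auto simp: of_bool_def)
    then show ?case using A_unit by simp
  next
    case (Suc n)
    then show ?case
      using A_conv[OF assms(1)[unfolded aset_def] Suc] cyclic_coeff_mult[OF m_pos, of P "P ^ n"]
      by (simp add: P1)
  qed
  obtain Q where Q: "P ^ q = pcompose P (monom 1 q) + smult (int q) Q"
    using int_poly_power_prime[OF assms(2)] by blast
  have "q dvd card {i \<in> {0..<m}. i \<in> S \<and> m dvd x - int q * i} \<longleftrightarrow>
      (\<exists>k::int. cyclic_coeff m (P ^ q) x = of_int (int q * k))" for x
  proof -
    have "pcompose P (monom 1 q) = (\<Sum>i\<in>{0..<m} \<inter> S. monom 1 (q * nat i))"
      unfolding P_def pcompose_sum by (simp add: pcompose_monom_1 monom_power mult.commute)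
    then have "cyclic_coeff m (pcompose P (monom 1 q)) x =
        (\<Sum>i\<in>{0..<m} \<inter> S. of_bool (m dvd x - int q * i))"
      using m_pos by (auto simp: cyclic_coeff_sum cyclic_coeff_monom of_bool_def simp del: of_bool_eq_1_iff intro!: sum.cong)
    also have "\<dots> = of_nat (card ({0..<m} \<inter> S \<inter> {i. m dvd x - int q * i}))"
      by (subst sum_of_bool_eq) auto
    also have "{0..<m} \<inter> S \<inter> {i. m dvd x - int q * i} = {i \<in> {0..<m}. i \<in> S \<and> m dvd x - int q * i}"
      by auto
    finally have *: "cyclic_coeff m (P ^ q) x =
        of_int (int (card {i \<in> {0..<m}. i \<in> S \<and> m dvd x - int q * i}) + int q * \<lfloor>Re (cyclic_coeff m Q x)\<rfloor>)"
      (is "_ = of_int (int ?c + int q * ?r)")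
      unfolding Q cyclic_coeff_add cyclic_coeff_smult
      by (subst cyclic_coeff_floor[OF m_pos, of Q]) simp
    have "(\<exists>k. int ?c + int q * ?r = int q * k) \<longleftrightarrow> int q dvd int ?c + int q * ?r" by (simp only: dvd_def)
    also have "\<dots> \<longleftrightarrow> q dvd ?c" by (subst dvd_add_times_triv_right_iff[of "int q" _ ?r, unfolded mult.commute[of ?r]]) simp
    finally show ?thesis unfolding * of_int_eq_iff by simp
  qed
  then have "frob q S = {x. \<not> (\<exists>k::int. cyclic_coeff m (P ^ q) x = of_int (int q * k))}"
    unfolding frob_def by simp
  then show ?thesis using aset_pred[OF cA[of q], of "\<lambda>z. \<not> (\<exists>k::int. z = of_int (int q * k))"] by simp
qed

lemma card_coset:
  assumes "aset S" "m = int q * r" "q > 0"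
  shows "card {i \<in> {0..<m}. i \<in> S \<and> r dvd i - y} = card {j \<in> {0..<int q}. y + r * j \<in> S}"
proof -
  have r: "r > 0" using assms m_pos by (simp add: zero_less_mult_iff)
  define f :: "int \<Rightarrow> nat" where "f i = of_bool (i + y \<in> S \<and> r dvd i)" for i
  have "r dvd a \<longleftrightarrow> r dvd b" if "m dvd a - b" for a b
    using that assms(2) by (metis dvd_mult_right dvd_diff_right_iff dvd_trans zdvd_zdiffD mod_eq_dvd_iff dvd_eq_mod_eq_0)
  moreover have "a + y \<in> S \<longleftrightarrow> b + y \<in> S" if "m dvd a - b" for a b
    by (rule aset_periodic[OF assms(1)]) (use that in simp)
  ultimately have per: "periodic m f"
    unfolding periodic_def f_def by simp
  have "card {i \<in> {0..<m}. i \<in> S \<and> r dvd i - y} = (\<Sum>i\<in>{0..<m}. f (i + (- y)))"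
    by (simp add: f_def Int_def conj_assoc)
  also have "\<dots> = (\<Sum>i\<in>{0..<m}. f i)" by (rule sum_mod_shift[OF m_pos per])
  also have "\<dots> = card {i \<in> {0..<m}. i + y \<in> S \<and> r dvd i}"
    by (simp add: f_def Int_def conj_assoc)
  also have "\<dots> = card ((\<lambda>j. r * j) ` {j \<in> {0..<int q}. y + r * j \<in> S})"
  proof (rule arg_cong[where f = card], intro set_eqI iffI)
    fix i assume i: "i \<in> {i \<in> {0..<m}. i + y \<in> S \<and> r dvd i}"
    then obtain j where j: "i = r * j" by auto
    have "0 \<le> j" using i j r by (simp add: zero_le_mult_iff)
    moreover have "r * j < r * int q" using i j assms by (simp add: mult.commute)
    then have "j < int q" using r by simp
    ultimately show "i \<in> (\<lambda>j. r * j) ` {j \<in> {0..<int q}. y + r * j \<in> S}" using i j by (auto simp: add.commute)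
  next
    fix i assume "i \<in> (\<lambda>j. r * j) ` {j \<in> {0..<int q}. y + r * j \<in> S}"
    then show "i \<in> {i \<in> {0..<m}. i + y \<in> S \<and> r dvd i}"
      using r assms(2) by (auto simp: add.commute mult.commute)
  qed
  also have "\<dots> = card {j \<in> {0..<int q}. y + r * j \<in> S}"
    using r by (intro card_image) (auto simp: inj_on_def)
  finally show ?thesis .
qed

text \<open>The solutions \<open>i\<close> of \<open>q * i = x\<close> modulo \<open>m\<close> form
  a coset of \<open>q\<close> residues with step r = q^a n, and \<open>S\<close> sees them only
  through their gcds with q^(a+1) and with \<open>n\<close>, the latter being constant on the coset.
  If q^a divides these residues, one of them, \<open>y\<close>, is divisible by q^(a+1) and the
  other q - 1 have q-part exactly q^a, so the count is 0, 1, q - 1 or q. Otherwise \<open>S\<close>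
  cannot tell the residues apart, and the count is 0 or q.\<close>

lemma frob_iff:
  assumes S: "aset S" and q: "prime q" and m: "m = int q ^ Suc a * n" and co: "coprime (int q) n"
  shows "x \<in> frob q S \<longleftrightarrow> (\<exists>y. int q ^ Suc a dvd y \<and> m dvd x - int q * y \<and>
    (y \<in> S) \<noteq> (y + int q ^ a * n \<in> S))"
proof (cases "\<exists>i. m dvd x - int q * i")
  case False
  then show ?thesis by (auto simp: frob_def)
next
  case True
  then obtain i0 where i0: "m dvd x - int q * i0" by blast
  define r where "r = int q ^ a * n"
  have qr: "m = int q * r" using m by (simp add: r_def)
  have q0: "q > 1" using q prime_gt_1_nat by blast
  have sol: "m dvd x - int q * i \<longleftrightarrow> r dvd i - i0" for i
  proof -
    have "x - int q * i = (x - int q * i0) - int q * (i - i0)" by (simp add: algebra_simps)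
    then have "m dvd x - int q * i \<longleftrightarrow> m dvd int q * (i - i0)"
      using i0 by (metis diff_diff_eq2 add_diff_cancel_left' dvd_diff)
    then show ?thesis using q0 by (simp add: qr)
  qed
  have card_eq: "card {i \<in> {0..<m}. i \<in> S \<and> m dvd x - int q * i} = card {j \<in> {0..<int q}. y + r * j \<in> S}"
    if "r dvd y - i0" for y
  proof -
    have "r dvd i - i0 \<longleftrightarrow> r dvd i - y" for i
      using that by (metis dvd_diff dvd_diff_commute diff_diff_eq2 add_diff_cancel_left' diff_add_cancel dvd_add)
    then show ?thesis using card_coset[OF S qr, of y] q0 by (simp add: sol)
  qed
  have mem_eq: "u \<in> S \<longleftrightarrow> v \<in> S" if "gcd u (int q ^ Suc a) = gcd v (int q ^ Suc a)" "n dvd u - v" for u v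
    by (rule aset_gcd[OF S], unfold m, rule gcd_eq_coprime_factors)
      (use that co in \<open>auto intro: gcd_cong_int\<close>)
  show ?thesis
  proof (cases "int q ^ a dvd i0")
    case True
    then obtain i1 where i1: "i0 = int q ^ a * i1" by auto
    obtain u v where uv: "u * n + v * int q = 1"
      using bezout_int[of n "int q"] co by (metis coprime_iff_gcd_eq_1 coprime_commute)
    \<comment> \<open>The Bezout coefficient \<open>u\<close> inverts \<open>n\<close> modulo
      \<open>q\<close>, which selects the element of the coset that is divisible by q^(a+1).\<close>
    define y where "y = i0 + r * (- i1 * u)"
    have "y = int q ^ a * (i1 * (1 - u * n))" by (simp add: y_def r_def i1 algebra_simps)
    also have "1 - u * n = v * int q" using uv by simp
    finally have y: "int q ^ Suc a dvd y" by simp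
    have ry: "r dvd y - i0" by (simp add: y_def)
    have mem: "y + r * j \<in> S \<longleftrightarrow> y + r \<in> S" if "\<not> int q dvd j" for j
    proof (rule mem_eq)
      have "gcd (y + r * j) (int q ^ Suc a) = int q ^ a" if "\<not> int q dvd j" for j
      proof -
        have "gcd (y + r * j) (int q ^ Suc a) = gcd (r * j) (int q ^ Suc a)"
          by (rule gcd_cong_int) (use y in simp)
        also have "\<dots> = gcd (int q ^ a * (n * j)) (int q ^ a * int q)"
          by (simp add: r_def mult_ac)
        also have "\<dots> = int q ^ a * gcd (n * j) (int q)"
          by (simp flip: gcd_mult_distrib_int)
        finally have "gcd (y + r * j) (int q ^ Suc a) = int q ^ a * gcd (n * j) (int q)" .
        moreover have "coprime (n * j) (int q)"
          using co that q prime_imp_coprime[of "int q" j] by (simp add: coprime_commute)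
        ultimately show ?thesis by simp
      qed
      from this[OF that] this[of 1] show "gcd (y + r * j) (int q ^ Suc a) = gcd (y + r) (int q ^ Suc a)"
        using q0 by simp
      show "n dvd y + r * j - (y + r)" by (simp add: r_def)
    qed
    have notdvd: "\<not> int q dvd j" if "j \<in> {1..<int q}" for j
      using that zdvd_not_zless by auto
    have "{j \<in> {0..<int q}. y + r * j \<in> S} = (if y \<in> S then {0} else {}) \<union> (if y + r \<in> S then {1..<int q} else {})"
    proof (intro set_eqI)
      fix j
      show "j \<in> {j \<in> {0..<int q}. y + r * j \<in> S} \<longleftrightarrow>
        j \<in> (if y \<in> S then {0} else {}) \<union> (if y + r \<in> S then {1..<int q} else {})"
      proof (cases "j \<in> {1..<int q}")
        case True
        then show ?thesis using mem[OF notdvd[OF True]] by auto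
      next
        case False
        then show ?thesis using q0 by (cases "j = 0") auto
      qed
    qed
    moreover have "card ({0} \<union> {1..<int q}) = q"
      using q0 by (subst card_Un_disjoint) auto
    moreover have "\<not> q dvd q - 1" "\<not> q dvd 1" using q0 by (auto dest: dvd_imp_le)
    ultimately have "q dvd card {j \<in> {0..<int q}. y + r * j \<in> S} \<longleftrightarrow> (y \<in> S) = (y + r \<in> S)"
      using q0 by (auto simp: nat_diff_distrib)
    then have "x \<in> frob q S \<longleftrightarrow> (y \<in> S) \<noteq> (y + r \<in> S)"
      unfolding frob_def mem_Collect_eq card_eq[OF ry] by simp
    also have "\<dots> \<longleftrightarrow> (\<exists>y. int q ^ Suc a dvd y \<and> m dvd x - int q * y \<and> (y \<in> S) \<noteq> (y + r \<in> S))"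
    proof
      assume "(y \<in> S) \<noteq> (y + r \<in> S)"
      then show "\<exists>y. int q ^ Suc a dvd y \<and> m dvd x - int q * y \<and> (y \<in> S) \<noteq> (y + r \<in> S)"
        using y ry sol by blast
    next
      assume "\<exists>y. int q ^ Suc a dvd y \<and> m dvd x - int q * y \<and> (y \<in> S) \<noteq> (y + r \<in> S)"
      then obtain z where z: "int q ^ Suc a dvd z" "m dvd x - int q * z" "(z \<in> S) \<noteq> (z + r \<in> S)" by blast
      have "r dvd z - i0" using z(2) sol by blast
      then have "r dvd (z - i0) - (y - i0)" using ry by (rule dvd_diff)
      then have "n dvd z - y" unfolding r_def by (simp add: dvd_mult_right)
      moreover have "int q ^ Suc a dvd z - y" using y z by (intro dvd_diff) auto
      ultimately have "m dvd z - y" unfolding m using co by (intro divides_mult) auto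
      then have "z \<in> S \<longleftrightarrow> y \<in> S" "z + r \<in> S \<longleftrightarrow> y + r \<in> S"
        using aset_periodic[OF S] by auto
      then show "(y \<in> S) \<noteq> (y + r \<in> S)" using z by blast
    qed
    finally show ?thesis by (simp add: r_def)
  next
    case False
    have "i0 + r * j \<in> S \<longleftrightarrow> i0 \<in> S" for j
    proof (rule mem_eq)
      have *: "gcd z (int q ^ Suc a) dvd int q ^ a" if nd: "\<not> int q ^ a dvd z" for z
      proof -
        obtain b where b: "b \<le> Suc a" "gcd z (int q ^ Suc a) = int q ^ b"
          using divides_primepow[of "int q" "gcd z (int q ^ Suc a)" "Suc a"] q by auto
        have "b \<le> a"
        proof (rule ccontr)
          assume "\<not> b \<le> a"
          then have "int q ^ a dvd int q ^ b" by (intro le_imp_power_dvd) simp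
          also have "\<dots> dvd z" unfolding b(2)[symmetric] by simp
          finally show False using nd by blast
        qed
        then show ?thesis using b by (simp add: le_imp_power_dvd)
      qed
      have ra: "int q ^ a dvd r" by (simp add: r_def)
      have gg: "gcd z (int q ^ Suc a) = gcd z (int q ^ a)" if "\<not> int q ^ a dvd z" for z
      proof (rule zdvd_antisym_nonneg)
        show "gcd z (int q ^ Suc a) dvd gcd z (int q ^ a)" using *[OF that] by simp
        show "gcd z (int q ^ a) dvd gcd z (int q ^ Suc a)" by (intro gcd_mono) auto
      qed auto
      have "\<not> int q ^ a dvd i0 + r * j" using False ra by (simp add: dvd_add_left_iff)
      then show "gcd (i0 + r * j) (int q ^ Suc a) = gcd i0 (int q ^ Suc a)"
        unfolding gg[OF False] using ra by (subst gg) (auto intro: gcd_cong_int)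
      show "n dvd i0 + r * j - i0" by (simp add: r_def)
    qed
    then have "{j \<in> {0..<int q}. i0 + r * j \<in> S} = (if i0 \<in> S then {0..<int q} else {})" by auto
    then have "card {j \<in> {0..<int q}. i0 + r * j \<in> S} = (if i0 \<in> S then q else 0)" by simp
    moreover have "r dvd i0 - i0" by simp
    note card_eq[OF this]
    ultimately have "x \<notin> frob q S" unfolding frob_def mem_Collect_eq by simp
    moreover have "\<not> int q ^ Suc a dvd y" if "m dvd x - int q * y" for y
    proof
      assume "int q ^ Suc a dvd y"
      then have "int q ^ a dvd y" by (metis dvd_mult_right power_Suc)
      moreover have "int q ^ a dvd y - i0" using that sol by (metis r_def dvd_mult_left)
      ultimately have "int q ^ a dvd i0" by (metis dvd_diff_right_iff dvd_diff_commute diff_diff_eq2 add_diff_cancel_left' dvd_diff)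
      then show False using False by blast
    qed
    ultimately show ?thesis by blast
  qed
qed


section \<open>Atoms and the subgroups they generate\<close>

definition atom :: "int set \<Rightarrow> bool" where
  "atom S \<longleftrightarrow> aset S \<and> S \<noteq> {} \<and> (\<forall>W. aset W \<longrightarrow> W \<inter> S \<noteq> {} \<longrightarrow> S \<subseteq> W)"

lemma atom_aset: "atom S \<Longrightarrow> aset S" and atom_nonempty: "atom S \<Longrightarrow> S \<noteq> {}"
  and atom_subset: "atom S \<Longrightarrow> aset W \<Longrightarrow> x \<in> W \<Longrightarrow> x \<in> S \<Longrightarrow> S \<subseteq> W"
  by (auto simp: atom_def)

lemma atom_disjoint: "atom S \<Longrightarrow> atom T \<Longrightarrow> S \<noteq> T \<Longrightarrow> S \<inter> T = {}"
  using atom_subset atom_aset by (metis disjoint_iff subset_antisym)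

lemma atom_exists: "\<exists>S. atom S \<and> x \<in> S"
proof -
  define S where "S = \<Inter>{W. aset W \<and> x \<in> W}"
  have S: "aset S" "x \<in> S" unfolding S_def by (auto intro: aset_Inter)
  have "S \<subseteq> W" if "aset W" "W \<inter> S \<noteq> {}" for W
  proof (cases "x \<in> W")
    case True
    then show ?thesis using that by (auto simp: S_def)
  next
    case False
    then have "S \<subseteq> - W" using aset_Compl[OF that(1)] by (auto simp: S_def)
    then show ?thesis using that by blast
  qed
  then show ?thesis using S by (auto simp: atom_def)
qed

text \<open>In terms of subgroups, the multiples of \<open>e\<close> form a minimal nonzero one
  inside the subgroup generated by \<open>S\<close>, and the multiples of \<open>k\<close> turn out
  to be its complement there. All of \<open>frob q S\<close> is divisible by the full power of
  \<open>q\<close> in \<open>m\<close>, while \<open>r\<close>, hence \<open>e\<close>, is not; so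
  \<open>lcm k e\<close> is different from \<open>e\<close> and must be \<open>m\<close>. No element
  of \<open>S\<close> is divisible by \<open>k\<close>, since otherwise the whole atom would be and
  \<open>k\<close> would divide \<open>e\<close>; this decides the alternative in
  \<open>frob_iff\<close>.\<close>

lemma frob_structure:
  assumes S: "atom S" and u: "u = Gcd (insert m S)"
    and e: "asub e" "u dvd e" and emax: "\<And>e'. asub e' \<Longrightarrow> e dvd e' \<Longrightarrow> e' = e \<or> e' = m"
    and q: "prime q" "m = int q * r" "e dvd r"
    and s: "s \<in> S" "s + r \<notin> S"
    and k: "k = Gcd (insert m (frob q S))"
  shows "asub k" "lcm k e = m" "gcd k e = u" "frob q S \<noteq> {}"
    "x \<in> frob q S \<longleftrightarrow> k dvd x \<and> x + r \<in> S"
proof -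
  have q0: "q > 1" using q prime_gt_1_nat by blast
  obtain b n where bn: "m = int q ^ b * n" "\<not> int q dvd n"
  proof -
    have "prime (int q)" using q by simp
    then have "m \<noteq> 0 \<and> \<not> is_unit (int q)" using m_pos not_prime_unit by auto
    then show ?thesis using multiplicity_decompose'[of m "int q"] that by metis
  qed
  have "b \<noteq> 0" using bn q by (metis dvd_triv_left mult.left_neutral power_0)
  then obtain a where "b = Suc a" using not0_implies_Suc by blast
  then have m: "m = int q ^ Suc a * n" using bn by simp
  have co: "coprime (int q) n" using bn(2) q prime_imp_coprime[of "int q" n] by simp
  have r: "r = int q ^ a * n" using m q q0 by simp
  note aS = atom_aset[OF S]
  note F = frob_iff[OF aS q(1) m co, folded r]
  note aF = aset_frob[OF aS q(1)]
  show ak: "asub k" unfolding k by (rule asub_generated[OF aF])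
  have um: "u dvd m" unfolding u by (auto intro: Gcd_dvd)
  have uS: "u dvd x" if "x \<in> S" for x unfolding u by (rule Gcd_dvd) (use that in auto)
  have kF: "k dvd x" if "x \<in> frob q S" for x unfolding k by (rule Gcd_dvd) (use that in auto)
  have km: "k dvd m" using ak by (simp add: asub_def)
  have qF: "int q ^ Suc a dvd x" if x: "x \<in> frob q S" for x
  proof -
    obtain y where "int q ^ Suc a dvd y" "m dvd x - int q * y" using F[of x] x by blast
    then have "int q ^ Suc a dvd x - int q * y" "int q ^ Suc a dvd int q * y" using m by (auto intro: dvd_trans)
    then show ?thesis by (metis diff_add_cancel dvd_add)
  qed
  then have qk: "int q ^ Suc a dvd k" unfolding k using m by (intro Gcd_greatest) auto
  have nqr: "\<not> int q ^ Suc a dvd r"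
  proof
    assume "int q ^ Suc a dvd r"
    then have "int q ^ a * int q dvd int q ^ a * n" by (simp add: r mult.commute)
    then have "int q dvd n" using q0 by simp
    then show False using bn by blast
  qed
  then have nqe: "\<not> int q ^ Suc a dvd e" using q dvd_trans by blast
  show lcm: "lcm k e = m"
  proof -
    have "lcm k e \<noteq> e" using nqe qk by (metis dvd_lcm1 dvd_trans)
    then show ?thesis using emax[OF asub_lcm[OF ak e(1)]] by simp
  qed
  have Sk: "\<not> k dvd x" if "x \<in> S" for x
  proof
    assume "k dvd x"
    then have "S \<subseteq> {x. k dvd x}" using atom_subset[OF S _ _ that] ak by (auto simp: asub_def)
    then have "k dvd u" unfolding u using km by (intro Gcd_greatest) auto
    then show False using nqe qk e(2) dvd_trans by blast
  qed
  obtain k' where k': "k = int q ^ Suc a * k'" using qk by blast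
  have "k' dvd n" using km m k' q0 by simp
  then have cok: "coprime k' (int q)" using co by (metis coprime_commute coprime_divisors dvd_refl)
  have ky: "k dvd y" if "k dvd x" "m dvd x - int q * y" "int q ^ Suc a dvd y" for x y
  proof -
    have "k dvd x - int q * y" using km that dvd_trans by blast
    with that(1) have "k dvd x - (x - int q * y)" by (rule dvd_diff)
    then have "k dvd int q * y" by simp
    then have "k' dvd int q * y" unfolding k' by (rule dvd_mult_right)
    then have "k' dvd y" using cok by (simp add: coprime_dvd_mult_right_iff)
    then show ?thesis unfolding k' using that(3) cok by (intro divides_mult) (auto simp: coprime_commute)
  qed
  have mem: "y + r \<in> S \<longleftrightarrow> x + r \<in> S" if "int q ^ Suc a dvd y" "m dvd x - int q * y" for x y
  proof (rule aset_gcd[OF aS], unfold m, rule gcd_eq_coprime_factors)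
    have xd: "int q ^ Suc a dvd x"
    proof -
      have "int q ^ Suc a dvd x - int q * y" using that m dvd_trans by (metis dvd_triv_left)
      then show ?thesis using that(1) by (metis diff_add_cancel dvd_add dvd_mult)
    qed
    show "coprime (int q ^ Suc a) n" using co by simp
    have "int q ^ Suc a dvd (y + r) - (x + r)" using xd that(1) by (simp add: dvd_diff)
    then show "gcd (y + r) (int q ^ Suc a) = gcd (x + r) (int q ^ Suc a)" by (rule gcd_cong_int)
    have "n dvd m" "n dvd r" by (auto simp: m r)
    then have "n dvd x - int q * y" using that dvd_trans by blast
    have "gcd (y + r) n = gcd y n" using \<open>n dvd r\<close> by (intro gcd_cong_int) simp
    also have "\<dots> = gcd (int q * y) n" using co gcd_mult_left_left_cancel[of n "int q" y] by (metis coprime_commute)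
    also have "\<dots> = gcd x n" using \<open>n dvd x - int q * y\<close> by (metis gcd_cong_int)
    also have "\<dots> = gcd (x + r) n" using \<open>n dvd r\<close> by (intro gcd_cong_int) simp
    finally show "gcd (y + r) n = gcd (x + r) n" .
  qed
  have fwd: "k dvd x \<and> x + r \<in> S" if x: "x \<in> frob q S" for x
  proof -
    obtain y where y: "int q ^ Suc a dvd y" "m dvd x - int q * y" "(y \<in> S) \<noteq> (y + r \<in> S)"
      using F[of x] x by blast
    then have "k dvd y" using ky kF[OF x] by blast
    then have "y + r \<in> S" using Sk y by blast
    then show ?thesis using mem[OF y(1,2)] kF[OF x] by blast
  qed
  show "x \<in> frob q S \<longleftrightarrow> k dvd x \<and> x + r \<in> S"
  proof
    assume x: "k dvd x \<and> x + r \<in> S"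
    obtain v w where vw: "v * int q + w * n = 1"
      using bezout_int[of "int q" n] co by (metis coprime_iff_gcd_eq_1)
    \<comment> \<open>\<open>v\<close> inverts \<open>q\<close> modulo \<open>n\<close>, and
      \<open>x\<close> is already divisible by the full power of \<open>q\<close>, so
      \<open>q * y\<close> is congruent to \<open>x\<close> modulo \<open>m\<close>.\<close>
    define y where "y = x * v"
    have xd: "int q ^ Suc a dvd x" using x qk dvd_trans by blast
    then have y1: "int q ^ Suc a dvd y" by (simp add: y_def)
    have "x - int q * y = x * (1 - v * int q)" by (simp add: y_def algebra_simps)
    also have "1 - v * int q = w * n" using vw by simp
    finally have y2: "m dvd x - int q * y" using xd by (auto simp: m intro!: mult_dvd_mono)
    have "k dvd y" using x by (simp add: y_def)
    then have "y \<notin> S" using Sk by blast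
    then show "x \<in> frob q S" using F[of x] mem[OF y1 y2] y1 y2 x by blast
  qed (rule fwd)
  show ne: "frob q S \<noteq> {}"
  proof -
    \<comment> \<open>The coset of solutions through \<open>s\<close> meets \<open>S\<close> in
      \<open>s\<close> and misses it in \<open>s + r\<close>, so the count lies strictly between 0
      and \<open>q\<close>.\<close>
    have "int q * s \<in> frob q S"
    proof -
      have "m dvd int q * s - int q * i \<longleftrightarrow> r dvd i - s" for i
        using q0 by (simp add: q(2) dvd_diff_commute flip: right_diff_distrib)
      then have "card {i \<in> {0..<m}. i \<in> S \<and> m dvd int q * s - int q * i} = card {j \<in> {0..<int q}. s + r * j \<in> S}"
        using card_coset[OF aS q(2), of s] q0 by simp
      moreover have "0 < card {j \<in> {0..<int q}. s + r * j \<in> S}"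
      proof -
        have "finite {j \<in> {0..<int q}. s + r * j \<in> S}"
          by (rule finite_subset[of _ "{0..<int q}"]) auto
        moreover have "0 \<in> {j \<in> {0..<int q}. s + r * j \<in> S}" using q0 s by simp
        ultimately show ?thesis by (metis card_gt_0_iff empty_iff)
      qed
      moreover have "card {j \<in> {0..<int q}. s + r * j \<in> S} < q"
      proof -
        have "1 \<in> {0..<int q}" "1 \<notin> {j \<in> {0..<int q}. s + r * j \<in> S}" using q0 s by auto
        then have "{j \<in> {0..<int q}. s + r * j \<in> S} \<subset> {0..<int q}" by blast
        then have "card {j \<in> {0..<int q}. s + r * j \<in> S} < card {0..<int q}"
          by (intro psubset_card_mono) auto
        then show ?thesis by (simp only: card_atLeastLessThan_int diff_zero nat_int)
      qed
      ultimately show ?thesis unfolding frob_def mem_Collect_eq using dvd_imp_le by fastforce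
    qed
    then show ?thesis by blast
  qed
  show "gcd k e = u"
  proof -
    obtain x where x: "x \<in> frob q S" using ne by blast
    then obtain y where y: "int q ^ Suc a dvd y" "m dvd x - int q * y" "(y \<in> S) \<noteq> (y + r \<in> S)"
      using F by blast
    have "k dvd y" using ky kF[OF x] y by blast
    then have yS: "y + r \<in> S" using Sk y by blast
    have "gcd k e dvd y + r" using \<open>k dvd y\<close> q(3) by (meson dvd_add dvd_trans gcd_dvd1 gcd_dvd2)
    then have "S \<subseteq> {x. gcd k e dvd x}"
      using atom_subset[OF S _ _ yS] asub_gcd[OF ak e(1)] by (auto simp: asub_def)
    moreover have "gcd k e dvd m" using km dvd_trans gcd_dvd1 by blast
    ultimately have "gcd k e dvd u" unfolding u by (intro Gcd_greatest) auto
    moreover have "u dvd k" unfolding k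
    proof (rule Gcd_greatest)
      fix x assume "x \<in> insert m (frob q S)"
      then show "u dvd x"
      proof
        assume "x \<in> frob q S"
        then have "x + r \<in> S" using fwd by blast
        then have "u dvd x + r" using uS by blast
        moreover have "u dvd r" using e(2) q(3) dvd_trans by blast
        ultimately show ?thesis by (simp add: dvd_add_left_iff)
      qed (simp add: um)
    qed
    moreover have "u > 0" unfolding u by (rule Gcd_insert_pos)
    ultimately show ?thesis using e(2) by (intro zdvd_antisym_nonneg) auto
  qed
qed

end

text \<open>By induction on the modulus: two atoms which generate the same subgroup either stay distinct
  in some proper quotient, or their Frobenius images coincide.\<close>

theorem atom_eq_of_Gcd_eq:
  assumes "rational_schur_ring m A" "rational_schur_ring.atom A S" "rational_schur_ring.atom A T"
    "Gcd (insert m S) = Gcd (insert m T)"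
  shows "S = T"
  using assms
proof (induction "nat m" arbitrary: m A S T rule: less_induct)
  case less
  interpret rational_schur_ring m A by fact
  note S = \<open>atom S\<close> and T = \<open>atom T\<close>
  note aS = atom_aset[OF S] and aT = atom_aset[OF T]
  define u where "u = Gcd (insert m S)"
  have uT: "u = Gcd (insert m T)" using less.prems u_def by simp
  show ?case
  proof (rule ccontr)
    assume "S \<noteq> T"
    then have disj: "S \<inter> T = {}" using atom_disjoint S T by blast
    define plus where "plus W e = {x. \<exists>i\<in>W. x - i \<in> {z. e dvd z}}" for W and e :: int
    have sub_plus: "W \<subseteq> plus W e" for W e
    proof
      fix x assume "x \<in> W"
      moreover have "e dvd x - x" by simp
      ultimately show "x \<in> plus W e" unfolding plus_def by blast
    qed
    have aplus: "aset (plus W e)" if "aset W" "asub e" for W e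
      using aset_plus[OF that(1)] that(2) unfolding plus_def asub_def by blast
    \<comment> \<open>The saturations of the two atoms by multiples of \<open>e\<close> are atoms of
      the quotient ring and generate the same subgroup there, so the induction hypothesis identifies
      them.\<close>
    have plus_eq: "plus S e = plus T e" if e: "asub e" "e \<noteq> m" for e
    proof -
      define B where "B = {a \<in> A. \<forall>x. a x = a (gcd x e)}"
      interpret Q: rational_schur_ring e B unfolding B_def by (rule quotient[OF e(1)])
      have e0: "e > 0" "e dvd m" using e by (auto simp: asub_def)
      have Qaset: "Q.aset W \<longleftrightarrow> aset W \<and> (\<forall>x y. e dvd x - y \<longrightarrow> x \<in> W \<longrightarrow> y \<in> W)" for W
      proof
        assume W: "Q.aset W"
        then have "aset W" unfolding Q.aset_def aset_def by (simp add: B_def)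
        then show "aset W \<and> (\<forall>x y. e dvd x - y \<longrightarrow> x \<in> W \<longrightarrow> y \<in> W)" using Q.aset_periodic[OF W] by blast
      next
        assume W: "aset W \<and> (\<forall>x y. e dvd x - y \<longrightarrow> x \<in> W \<longrightarrow> y \<in> W)"
        have "periodic e (\<lambda>x. of_bool (x \<in> W) :: complex)"
          unfolding periodic_def
        proof (intro allI impI)
          fix a b assume "e dvd a - b"
          moreover from this have "e dvd b - a" by (simp add: dvd_diff_commute)
          ultimately have "a \<in> W \<longleftrightarrow> b \<in> W" using W by blast
          then show "of_bool (a \<in> W) = (of_bool (b \<in> W) :: complex)" by simp
        qed
        moreover have *: "(\<lambda>x. of_bool (x \<in> W)) \<in> A" using W unfolding aset_def by blast
        ultimately have "\<forall>x. of_bool (x \<in> W) = (of_bool (gcd x e \<in> W) :: complex)"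
          using A_periodic_gcd[OF * e0(2,1)] by blast
        then show "Q.aset W" using * unfolding Q.aset_def by (simp add: B_def)
      qed
      have Qplus: "Q.aset (plus W e)" if "aset W" for W
        unfolding Qaset
      proof (intro conjI allI impI)
        fix x y assume "e dvd x - y" "x \<in> plus W e"
        then obtain i where i: "i \<in> W" "e dvd x - i" by (auto simp: plus_def)
        have "e dvd (x - i) - (x - y)" using i(2) \<open>e dvd x - y\<close> by (rule dvd_diff)
        moreover have "(x - i) - (x - y) = y - i" by simp
        ultimately have "e dvd y - i" by metis
        then show "y \<in> plus W e" using i unfolding plus_def by blast
      qed (rule aplus[OF that e(1)])
      have Qatom: "Q.atom (plus W e)" if W: "atom W" for W
        unfolding Q.atom_def
      proof (intro conjI allI impI)
        show "Q.aset (plus W e)" using Qplus atom_aset[OF W] by blast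
        show "plus W e \<noteq> {}" using atom_nonempty[OF W] sub_plus[of W e] by blast
        fix V assume V: "Q.aset V" "V \<inter> plus W e \<noteq> {}"
        then obtain x i where x: "x \<in> V" "i \<in> W" "e dvd x - i" by (auto simp: plus_def)
        then have "i \<in> V" using V(1) Qaset by blast
        then have "W \<subseteq> V" using atom_subset[OF W _ _ x(2)] V(1) Qaset by blast
        then show "plus W e \<subseteq> V"
          unfolding plus_def using V(1) Q.aset_periodic by blast
      qed
      have Gcd_plus: "Gcd (insert e (plus W e)) = gcd (Gcd (insert m W)) e" for W
      proof (rule zdvd_antisym_nonneg)
        show "Gcd (insert e (plus W e)) dvd gcd (Gcd (insert m W)) e"
        proof (rule gcd_greatest)
          have *: "Gcd (insert e (plus W e)) dvd e" by (intro Gcd_dvd) simp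
          then show "Gcd (insert e (plus W e)) dvd e" .
          show "Gcd (insert e (plus W e)) dvd Gcd (insert m W)"
          proof (rule Gcd_greatest)
            fix x assume "x \<in> insert m W"
            then show "Gcd (insert e (plus W e)) dvd x"
            proof
              assume "x = m" then show ?thesis using * e0 dvd_trans by blast
            next
              assume "x \<in> W"
              then have "x \<in> plus W e" using sub_plus by blast
              then show ?thesis by (intro Gcd_dvd) simp
            qed
          qed
        qed
        show "gcd (Gcd (insert m W)) e dvd Gcd (insert e (plus W e))"
        proof (rule Gcd_greatest)
          fix x assume "x \<in> insert e (plus W e)"
          then show "gcd (Gcd (insert m W)) e dvd x"
          proof
            assume "x \<in> plus W e"
            then obtain i where i: "i \<in> W" "e dvd x - i" by (auto simp: plus_def)
            have "Gcd (insert m W) dvd i" by (intro Gcd_dvd) (simp add: i)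
            then have "gcd (Gcd (insert m W)) e dvd i + (x - i)"
              using i(2) by (meson dvd_add dvd_trans gcd_dvd1 gcd_dvd2)
            then show ?thesis by simp
          qed simp
        qed
      qed auto
      have "nat e < nat m" using e e0 m_pos zdvd_imp_le by fastforce
      moreover have "Gcd (insert e (plus S e)) = Gcd (insert e (plus T e))"
        unfolding Gcd_plus using less.prems by simp
      ultimately show ?thesis
        using less.hyps[OF _ Q.rational_schur_ring_axioms Qatom[OF S] Qatom[OF T]] by blast
    qed
    have um: "u dvd m" "u > 0" unfolding u_def using Gcd_insert_pos by (auto intro: Gcd_dvd)
    have uS: "u dvd x" if "x \<in> S" for x unfolding u_def by (rule Gcd_dvd) (use that in auto)
    have uT': "u dvd x" if "x \<in> T" for x unfolding uT by (rule Gcd_dvd) (use that in auto)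
    have "u \<noteq> m"
    proof
      assume "u = m"
      obtain x y where "x \<in> S" "y \<in> T" using atom_nonempty S T by blast
      moreover have "m dvd x - y" using \<open>u = m\<close> uS uT' calculation by (intro dvd_diff) auto
      ultimately show False using aset_periodic[OF aS] disj by blast
    qed
    define E where "E = {e. asub e \<and> u dvd e \<and> e \<noteq> m}"
    have E: "finite E" "E \<noteq> {}"
    proof -
      have "E \<subseteq> {0..m}" using m_pos zdvd_imp_le by (auto simp: E_def asub_def)
      then show "finite E" using finite_subset by blast
      have "u \<in> E" using asub_generated[OF aS, folded u_def] \<open>u \<noteq> m\<close> unfolding E_def by simp
      then show "E \<noteq> {}" by blast
    qed
    \<comment> \<open>The largest modulus different from \<open>m\<close> belongs to a minimal
      nonzero subgroup inside the common one. The prime \<open>q\<close> below is taken from m / e,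
      so that translation by r = m / q stays in that subgroup.\<close>
    define e where "e = Max E"
    have e: "asub e" "u dvd e" "e \<noteq> m" using Max_in[OF E] by (auto simp: e_def E_def)
    have e0: "e > 0" "e dvd m" using e by (auto simp: asub_def)
    have emax: "e' = e \<or> e' = m" if "asub e'" "e dvd e'" for e'
    proof (rule ccontr)
      assume *: "\<not> (e' = e \<or> e' = m)"
      then have "e' \<in> E" using that e by (auto simp: E_def intro: dvd_trans)
      then have "e' \<le> e" using E by (simp add: e_def)
      moreover have "e \<le> e'" using that by (auto simp: asub_def intro: zdvd_imp_le)
      ultimately show False using * by simp
    qed
    obtain c where c: "m = e * c" using e0 by auto
    have "c > 1"
    proof -
      have "c > 0" using c e0 m_pos by (simp add: zero_less_mult_iff)
      moreover have "c \<noteq> 1" using c e by auto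
      ultimately show ?thesis by simp
    qed
    then obtain q where q: "prime q" "int q dvd c"
      using prime_factor_int[of c] by (metis abs_of_pos less_irrefl less_trans prime_int_nat_transfer zero_less_one int_nat_eq prime_ge_0_int)
    then obtain c' where c': "c = int q * c'" by auto
    define r where "r = e * c'"
    have qr: "m = int q * r" "e dvd r" using c c' by (auto simp: r_def)
    have r: "r > 0" "r < m"
    proof -
      have "int q > 1" using q prime_gt_1_nat by simp
      show "r > 0" using qr m_pos \<open>int q > 1\<close> by (simp add: zero_less_mult_iff)
      then show "r < m" using qr(1) \<open>int q > 1\<close> by simp
    qed
    \<comment> \<open>If an atom were stable under \<open>r\<close>, its stabiliser would be a
      nonzero subgroup from the ring and the atom would equal its own saturation, which by
      \<open>plus_eq\<close> contains the other atom.\<close>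
    have moved: "\<exists>s\<in>W. s + r \<notin> W" if W: "atom W" and eq: "\<And>e. asub e \<Longrightarrow> e \<noteq> m \<Longrightarrow> plus W e = plus W' e"
      and W': "atom W'" "W \<inter> W' = {}" for W W'
    proof (rule ccontr)
      assume "\<not> (\<exists>s\<in>W. s + r \<notin> W)"
      then have st: "r \<in> {x. \<forall>i\<in>W. x + i \<in> W}" by (auto simp: add.commute)
      obtain d where d: "d > 0" "d dvd m" "{x. \<forall>i\<in>W. x + i \<in> W} = {x. d dvd x}"
        using aset_subgroup[OF aset_stab[OF atom_aset[OF W]]] by (force simp: add.assoc)
      then have "d dvd r" using st by blast
      then have "d \<noteq> m" using r zdvd_imp_le by fastforce
      moreover have "asub d" using d aset_stab[OF atom_aset[OF W]] by (simp add: asub_def)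
      ultimately have "plus W d = plus W' d" using eq by blast
      moreover have "plus W d \<subseteq> W"
      proof
        fix x assume "x \<in> plus W d"
        then obtain i where "i \<in> W" "d dvd x - i" by (auto simp: plus_def)
        then have "x - i + i \<in> W" using d(3) by blast
        then show "x \<in> W" by simp
      qed
      moreover have "W' \<subseteq> plus W' d" by (rule sub_plus)
      ultimately show False using W' atom_nonempty[of W'] by blast
    qed
    obtain s where s: "s \<in> S" "s + r \<notin> S" using moved[OF S plus_eq T disj] by blast
    obtain t where t: "t \<in> T" "t + r \<notin> T" using moved[OF T _ S] plus_eq disj by blast
    define k where "k = Gcd (insert m (frob q S))"
    note FS = frob_structure[OF S u_def e(1,2) emax q(1) qr s k_def]
    note FT = frob_structure[OF T uT e(1,2) emax q(1) qr t refl]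
    define l where "l = Gcd (insert m (frob q T))"
    note FT = FT[folded l_def]
    \<comment> \<open>For complements k e = u m, which determines the modulus from data shared by
      \<open>S\<close> and \<open>T\<close>.\<close>
    have "k = l"
    proof -
      have "k * e = \<bar>u\<bar> * \<bar>m\<bar>" "l * e = \<bar>u\<bar> * \<bar>m\<bar>"
        using FS(1-3) FT(1-3) e0 prod_gcd_lcm_int[of k e] prod_gcd_lcm_int[of l e]
        by (auto simp: asub_def)
      then have "k * e = l * e" by metis
      then show ?thesis using e0(1) by simp
    qed
    obtain x where x: "x \<in> frob q S" using FS(4) by blast
    have "S \<subseteq> plus (frob q S) e"
    proof (rule atom_subset[OF S])
      show "aset (plus (frob q S) e)" by (rule aplus[OF aset_frob[OF aS q(1)] e(1)])
      have "e dvd x + r - x" using qr(2) by simp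
      then show "x + r \<in> plus (frob q S) e" using x unfolding plus_def by blast
      show "x + r \<in> S" using FS(5) x by blast
    qed
    then have "plus S e \<subseteq> plus (frob q S) e"
    proof -
      assume sub: "S \<subseteq> plus (frob q S) e"
      show ?thesis
      proof
        fix z assume "z \<in> plus S e"
        then obtain i where i: "i \<in> S" "e dvd z - i" by (auto simp: plus_def)
        then obtain j where j: "j \<in> frob q S" "e dvd i - j" using sub by (auto simp: plus_def)
        have "e dvd (z - i) + (i - j)" using i j by (intro dvd_add)
        then show "z \<in> plus (frob q S) e" using j by (auto simp: plus_def)
      qed
    qed
    moreover have "T \<subseteq> plus T e" by (rule sub_plus)
    ultimately have sub: "T \<subseteq> plus (frob q S) e" using plus_eq[OF e(1,3)] by blast
    \<comment> \<open>A point \<open>y\<close> of \<open>frob q T\<close> differs from some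
      \<open>z\<close> in \<open>frob q S\<close> by a multiple of both \<open>k\<close> and
      \<open>e\<close>, hence of \<open>m\<close>. Translation by \<open>r\<close> then produces an
      element common to both atoms.\<close>
    obtain y where y: "y \<in> frob q T" using FT(4) by blast
    then have yT: "l dvd y" "y + r \<in> T" using FT(5) by blast+
    then obtain z where z: "z \<in> frob q S" "e dvd y + r - z" using sub by (auto simp: plus_def)
    then have zS: "k dvd z" "z + r \<in> S" using FS(5) by blast+
    have "k dvd y - z" using yT zS \<open>k = l\<close> by (intro dvd_diff) auto
    moreover from z(2) qr(2) have "e dvd y + r - z - r" by (rule dvd_diff)
    then have "e dvd y - z" by simp
    ultimately have "m dvd y - z" using FS(2) by (metis lcm_least)
    then have "y + r \<in> S" using aset_periodic[OF aS, of "y + r" "z + r"] zS by simp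
    then show False using yT disj by blast
  qed
qed

section \<open>Holomorphic sections of a polynomial map\<close>

lemma holomorphic_eq_zero_on:
  assumes "h holomorphic_on U" "open U" "connected U" "a \<in> U" "\<forall>\<^sub>F t in nhds a. h t = 0" "t \<in> U"
  shows "h t = (0::complex)"
proof -
  obtain V where V: "open V" "a \<in> V" "\<And>t. t \<in> V \<Longrightarrow> h t = 0"
    using assms(5) unfolding eventually_nhds by blast
  show ?thesis
  proof (rule analytic_continuation[OF assms(1-3), of "U \<inter> V" a])
    show "a islimpt U \<inter> V" using V assms by (intro interior_limit_point) (auto simp: interior_open open_Int)
  qed (use V assms in auto)
qed

lemma finite_fibre: "degree f > 0 \<Longrightarrow> finite (fibre f t)"
  using poly_roots_finite[of "f - [:t:]"] by (cases "f = [:t:]") (auto simp: fibre_def)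

lemma finite_critical_values: assumes "degree f > 0" shows "finite (critical_values f)"
proof -
  have "pderiv f \<noteq> 0" using assms by (simp add: pderiv_eq_0_iff)
  then have "finite {z. poly (pderiv f) z = 0}" by (rule poly_roots_finite)
  moreover have "critical_values f = poly f ` {z. poly (pderiv f) z = 0}"
    by (auto simp: critical_values_def)
  ultimately show ?thesis by simp
qed

lemma open_regular_values: "degree f > 0 \<Longrightarrow> open (- critical_values f)"
  using finite_imp_closed[OF finite_critical_values] by (simp add: open_Compl)

lemma connected_regular_values: "degree f > 0 \<Longrightarrow> connected (- critical_values f)"
  using finite_critical_values countable_finite
  by (intro path_connected_imp_connected path_connected_complement_countable) auto

lemma card_fibre:
  assumes "degree f > 0" "t \<notin> critical_values f" shows "card (fibre f t) = degree f"
proof -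
  define p where "p = f - [:t:]"
  have "pderiv p = pderiv f" by (simp add: p_def pderiv_diff pderiv_pCons)
  then have "rsquarefree p" using assms by (auto simp: rsquarefree_roots p_def critical_values_def)
  have "degree p = degree f"
    unfolding p_def using assms degree_add_eq_left[of "[:-t:]" f] by (simp add: diff_conv_add_uminus del: add_uminus_conv_diff)
  moreover have "degree p = degree (\<Prod>z | poly p z = 0. [:-z, 1:])"
    using complex_poly_decompose_rsquarefree[OF \<open>rsquarefree p\<close>] \<open>rsquarefree p\<close>
    by (metis degree_smult_eq leading_coeff_0_iff rsquarefree_def)
  moreover have "degree (\<Prod>z | poly p z = 0. [:-z, 1:]) = card {z. poly p z = 0}"
    by (subst degree_prod_sum_eq) auto
  moreover have "{z. poly p z = 0} = fibre f t" by (auto simp: p_def fibre_def)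
  ultimately show ?thesis by simp
qed

section \<open>Inverse branches over sets of regular values\<close>

definition section_on :: "complex poly \<Rightarrow> complex set \<Rightarrow> (complex \<Rightarrow> complex) \<Rightarrow> bool" where
  "section_on f U \<psi> \<longleftrightarrow> \<psi> holomorphic_on U \<and> (\<forall>t\<in>U. poly f (\<psi> t) = t)"

lemma section_on_subset: "section_on f U \<psi> \<Longrightarrow> V \<subseteq> U \<Longrightarrow> section_on f V \<psi>"
  by (auto simp: section_on_def intro: holomorphic_on_subset)

lemma poly_holomorphic: "poly f holomorphic_on (S :: complex set)"
  unfolding holomorphic_on_def field_differentiable_def
  using has_field_derivative_at_within[OF poly_DERIV] by blast

lemma eventually_isCont_mem:
  assumes "isCont a t" "open V" "a t \<in> V" shows "\<forall>\<^sub>F s in nhds t. a s \<in> V"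
  using topological_tendstoD[of a "a t" "at t" V] assms
  by (simp add: isCont_def eventually_nhds_conv_at)

lemma regular_locally_injective:
  assumes "poly f z \<notin> critical_values f"
  obtains r where "r > 0" "open (poly f ` ball z r)" "inj_on (poly f) (ball z r)"
proof -
  have "deriv (poly f) z \<noteq> 0"
    using assms DERIV_imp_deriv[OF poly_DERIV[of f z]] by (auto simp: critical_values_def)
  then show ?thesis
    using has_complex_derivative_locally_invertible[of "poly f" UNIV z] that
    by (metis UNIV_I poly_holomorphic open_UNIV)
qed

text \<open>A polynomial is injective near a point over a regular value, so two sections that meet
  agree nearby, and the identity theorem spreads this over the connected set.\<close>

lemma section_unique:
  assumes U: "open U" "connected U" "U \<subseteq> - critical_values f"
    and ab: "section_on f U a" "section_on f U b" and t1: "t1 \<in> U" "a t1 = b t1" and t: "t \<in> U"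
  shows "a t = b t"
proof -
  have ft: "poly f (a s) = s" "poly f (b s) = s" if "s \<in> U" for s using ab that by (auto simp: section_on_def)
  have hol: "a holomorphic_on U" "b holomorphic_on U" using ab by (auto simp: section_on_def)
  obtain r where r: "r > 0" "inj_on (poly f) (ball (a t1) r)"
    using regular_locally_injective[of f "a t1"] ft t1 U by (metis ComplD subsetD)
  have "isCont a t1" "isCont b t1"
    using hol t1 U by (auto simp: continuous_on_eq_continuous_at dest!: holomorphic_on_imp_continuous_on)
  then have "\<forall>\<^sub>F s in nhds t1. a s \<in> ball (a t1) r" "\<forall>\<^sub>F s in nhds t1. b s \<in> ball (a t1) r"
    using r t1 by (auto intro!: eventually_isCont_mem simp del: mem_ball)
  moreover have "\<forall>\<^sub>F s in nhds t1. s \<in> U" using U t1 by (intro eventually_nhds_in_open)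
  ultimately have "\<forall>\<^sub>F s in nhds t1. a s - b s = 0"
  proof eventually_elim
    case (elim s)
    then show ?case using r(2) ft by (auto simp: inj_on_def)
  qed
  then have "a t - b t = 0"
    by (intro holomorphic_eq_zero_on[OF _ U(1,2) t1(1) _ t, of "\<lambda>s. a s - b s"])
       (auto intro: holomorphic_intros hol)
  then show ?thesis by simp
qed

lemma local_section:
  assumes "degree f > 0" "poly f z = t" "t \<notin> critical_values f"
  shows "\<exists>\<psi> r. r > 0 \<and> section_on f (ball t r) \<psi> \<and> \<psi> t = z"
proof -
  obtain r where r: "r > 0" "open (poly f ` ball z r)" "inj_on (poly f) (ball z r)"
    using regular_locally_injective[of f z] assms by metis
  obtain g where
    g: "g holomorphic_on (poly f ` ball z r)" "\<And>x. x \<in> ball z r \<Longrightarrow> g (poly f x) = x"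
    using holomorphic_has_inverse[OF poly_holomorphic open_ball r(3)] by metis
  have "t \<in> poly f ` ball z r" using r assms by force
  then obtain s where s: "s > 0" "ball t s \<subseteq> poly f ` ball z r"
    using r(2) open_contains_ball by blast
  have "section_on f (ball t s) g"
    unfolding section_on_def using g s by (auto intro: holomorphic_on_subset)
  moreover have "g t = z" using g(2)[of z] r assms by simp
  ultimately show ?thesis using s by blast
qed

text \<open>Stated for all small radii, so that finitely many conditions of this kind can be met by
  one common disc.\<close>

lemma eventually_section_on_ball:
  assumes "a analytic_on {t}" "\<forall>\<^sub>F s in nhds t. poly f (a s) = s"
  shows "\<forall>\<^sub>F r in at_right 0. section_on f (ball t r) a"
proof -
  obtain r1 where r1: "r1 > 0" "a holomorphic_on ball t r1" using assms by (auto simp: analytic_at_ball)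
  obtain r2 where r2: "r2 > 0" "\<And>s. dist s t < r2 \<Longrightarrow> poly f (a s) = s"
    using assms(2) unfolding eventually_nhds_metric by blast
  have "\<forall>\<^sub>F r in at_right 0. r < min r1 r2" using r1 r2 by (intro eventually_at_right_less[THEN eventually_mono] eventually_at_rightI[of 0 "min r1 r2"]) auto
  then show ?thesis
  proof eventually_elim
    case (elim r)
    then show ?case
      unfolding section_on_def using r1 r2 by (auto intro!: holomorphic_on_subset[OF r1(2)] simp: dist_commute)
  qed
qed

lemma eventually_ball_subset:
  assumes "open U" "t \<in> U" shows "\<forall>\<^sub>F r in at_right 0. ball t r \<subseteq> (U :: complex set)"
proof -
  obtain e where e: "e > 0" "ball t e \<subseteq> U" using assms open_contains_ball by blast
  then show ?thesis by (intro eventually_at_rightI[of 0 e]) auto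
qed

lemma section_on_analytic: "section_on f (ball t r) a \<Longrightarrow> r > 0 \<Longrightarrow> a analytic_on {t}"
  by (auto simp: section_on_def analytic_at_ball)

lemma section_on_eventually:
  assumes "section_on f (ball t r) a" "r > 0" shows "\<forall>\<^sub>F s in nhds t. poly f (a s) = s"
proof -
  have "\<forall>\<^sub>F s in nhds t. s \<in> ball t r" using assms by (intro eventually_nhds_in_open) auto
  then show ?thesis by eventually_elim (use assms in \<open>auto simp: section_on_def\<close>)
qed

lemma germ_unique:
  assumes "degree f > 0" "t \<notin> critical_values f"
    and a: "a analytic_on {t}" "\<forall>\<^sub>F s in nhds t. poly f (a s) = s"
    and b: "b analytic_on {t}" "\<forall>\<^sub>F s in nhds t. poly f (b s) = s" and "a t = b t"
  shows "\<forall>\<^sub>F s in nhds t. a s = b s"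
proof -
  have "\<forall>\<^sub>F r in at_right 0. section_on f (ball t r) a \<and> section_on f (ball t r) b \<and>
      ball t r \<subseteq> - critical_values f \<and> r > 0"
    using eventually_section_on_ball[OF a] eventually_section_on_ball[OF b]
      eventually_ball_subset[OF open_regular_values[OF assms(1)], of t] assms(2)
    by (auto intro!: eventually_conj simp: eventually_at_right_less)
  then obtain r where r: "section_on f (ball t r) a" "section_on f (ball t r) b"
      "ball t r \<subseteq> - critical_values f" "r > 0"
    using eventually_happens'[OF trivial_limit_at_right_real] by blast
  have "\<forall>\<^sub>F s in nhds t. s \<in> ball t r" using r by (intro eventually_nhds_in_open) auto
  then show ?thesis
  proof eventually_elim
    case (elim s)
    then show ?case using section_unique[OF open_ball connected_ball r(3,1,2) _ assms(7)] r(4) by simp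
  qed
qed

lemma root_branch:
  assumes "degree f > 0" "t0 \<notin> critical_values f" "x \<in> fibre f t0"
  shows "root_branch f t0 x analytic_on {t0}" "root_branch f t0 x t0 = x"
    "\<forall>\<^sub>F t in nhds t0. poly f (root_branch f t0 x t) = t"
proof -
  obtain \<psi> r where "r > 0" "section_on f (ball t0 r) \<psi>" "\<psi> t0 = x"
    using local_section[of f x t0] assms by (auto simp: fibre_def)
  then have "\<exists>\<phi>. \<phi> analytic_on {t0} \<and> \<phi> t0 = x \<and> (\<forall>\<^sub>F t in nhds t0. poly f (\<phi> t) = t)"
    using section_on_analytic section_on_eventually by blast
  from someI_ex[OF this] show "root_branch f t0 x analytic_on {t0}" "root_branch f t0 x t0 = x"
    "\<forall>\<^sub>F t in nhds t0. poly f (root_branch f t0 x t) = t"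
    unfolding root_branch_def by blast+
qed

lemma root_branch_unique:
  assumes "degree f > 0" "t0 \<notin> critical_values f" "x \<in> fibre f t0"
    and "a analytic_on {t0}" "\<forall>\<^sub>F s in nhds t0. poly f (a s) = s" "a t0 = x"
  shows "\<forall>\<^sub>F s in nhds t0. root_branch f t0 x s = a s"
  using germ_unique[OF assms(1,2) root_branch(1)[OF assms(1-3)] root_branch(3)[OF assms(1-3)]]
    root_branch(2)[OF assms(1-3)] assms by auto

section \<open>Continuation of labelled roots\<close>

text \<open>A labelling assigns to every root over the base point a root over another point. Two
  labellings are adjacent if they are values of one family of holomorphic sections over a disc of
  regular values; chains of adjacent labellings replace continuation along paths.\<close>

locale regular_point =
  fixes f :: "complex poly" and t0 :: complex
  assumes degree_pos: "degree f > 0" and regular: "t0 \<notin> critical_values f"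
begin

abbreviation X where "X \<equiv> fibre f t0"

lemma finite_X [simp]: "finite X" using degree_pos finite_fibre by blast
lemma card_X: "card X = degree f" using card_fibre degree_pos regular by blast
lemma X_nonempty: "X \<noteq> {}" using card_X degree_pos by auto
lemma X_iff: "x \<in> X \<longleftrightarrow> poly f x = t0" by (simp add: fibre_def)

text \<open>One disc moves all roots at once. The first alternative makes the values of a labelling
  off the base fibre immaterial.\<close>

definition adjacent :: "(complex \<Rightarrow> complex) \<Rightarrow> (complex \<Rightarrow> complex) \<Rightarrow> bool" where
  "adjacent \<theta> \<theta>' \<longleftrightarrow> (\<forall>x\<in>X. \<theta> x = \<theta>' x) \<or>
     (\<exists>c r \<psi> t1 t2. ball c r \<subseteq> - critical_values f \<and> (\<forall>x\<in>X. section_on f (ball c r) (\<psi> x)) \<and>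
        t1 \<in> ball c r \<and> t2 \<in> ball c r \<and> (\<forall>x\<in>X. \<theta> x = \<psi> x t1 \<and> \<theta>' x = \<psi> x t2))"

lemma adjacentI:
  assumes "ball c r \<subseteq> - critical_values f" "\<And>x. x \<in> X \<Longrightarrow> section_on f (ball c r) (\<psi> x)"
    "t1 \<in> ball c r" "t2 \<in> ball c r" "\<And>x. x \<in> X \<Longrightarrow> \<theta> x = \<psi> x t1" "\<And>x. x \<in> X \<Longrightarrow> \<theta>' x = \<psi> x t2"
  shows "adjacent \<theta> \<theta>'"
  unfolding adjacent_def
  by (rule disjI2, rule exI[of _ c], rule exI[of _ r], rule exI[of _ \<psi>], rule exI[of _ t1], rule exI[of _ t2])
     (use assms in auto)

definition linked where "linked = adjacent\<^sup>*\<^sup>*"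

lemma adjacent_sym: "adjacent \<theta> \<theta>' \<Longrightarrow> adjacent \<theta>' \<theta>"
proof (unfold adjacent_def[of \<theta> \<theta>'], elim disjE exE conjE)
  assume "\<forall>x\<in>X. \<theta> x = \<theta>' x"
  then show "adjacent \<theta>' \<theta>" by (simp add: adjacent_def)
next
  fix c r \<psi> t1 t2
  assume "ball c r \<subseteq> - critical_values f" "\<forall>x\<in>X. section_on f (ball c r) (\<psi> x)"
    "t1 \<in> ball c r" "t2 \<in> ball c r" "\<forall>x\<in>X. \<theta> x = \<psi> x t1 \<and> \<theta>' x = \<psi> x t2"
  then show "adjacent \<theta>' \<theta>" by (intro adjacentI[of c r \<psi> t2 t1]) auto
qed

lemma linked_refl [simp]: "linked \<theta> \<theta>" by (simp add: linked_def)

lemma linked_adjacent: "adjacent \<theta> \<theta>' \<Longrightarrow> linked \<theta> \<theta>'" by (simp add: linked_def)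

lemma linked_eq: "(\<And>x. x \<in> X \<Longrightarrow> \<theta> x = \<theta>' x) \<Longrightarrow> linked \<theta> \<theta>'"
  by (rule linked_adjacent) (simp add: adjacent_def)

lemma linked_trans: "linked \<theta> \<theta>' \<Longrightarrow> linked \<theta>' \<theta>'' \<Longrightarrow> linked \<theta> \<theta>''"
  by (simp add: linked_def)

lemma linked_sym: "linked \<theta> \<theta>' \<Longrightarrow> linked \<theta>' \<theta>"
  using symp_rtranclp[OF sympI[of adjacent], OF adjacent_sym] unfolding linked_def by (rule sympD)

text \<open>A chain keeps its discs and its sections when the labels are permuted.\<close>

lemma linked_compose:
  assumes "\<sigma> permutes X" "linked \<theta> \<theta>'" shows "linked (\<theta> \<circ> \<sigma>) (\<theta>' \<circ> \<sigma>)"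
  using assms(2) unfolding linked_def
proof (induction rule: rtranclp_induct)
  case (step \<theta>1 \<theta>2)
  have "\<sigma> x \<in> X" if "x \<in> X" for x using permutes_in_image[OF assms(1)] that by blast
  then have "adjacent (\<theta>1 \<circ> \<sigma>) (\<theta>2 \<circ> \<sigma>)"
    using step(2) unfolding adjacent_def
  proof (elim disjE exE conjE)
    fix c r \<psi> t1 t2
    assume *: "ball c r \<subseteq> - critical_values f" "\<forall>x\<in>X. section_on f (ball c r) (\<psi> x)"
      "t1 \<in> ball c r" "t2 \<in> ball c r" "\<forall>x\<in>X. \<theta>1 x = \<psi> x t1 \<and> \<theta>2 x = \<psi> x t2"
      "\<And>x. x \<in> X \<Longrightarrow> \<sigma> x \<in> X"
    show "(\<forall>x\<in>X. (\<theta>1 \<circ> \<sigma>) x = (\<theta>2 \<circ> \<sigma>) x) \<or>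
      (\<exists>c r \<psi> t1 t2. ball c r \<subseteq> - critical_values f \<and> (\<forall>x\<in>X. section_on f (ball c r) (\<psi> x)) \<and>
        t1 \<in> ball c r \<and> t2 \<in> ball c r \<and> (\<forall>x\<in>X. (\<theta>1 \<circ> \<sigma>) x = \<psi> x t1 \<and> (\<theta>2 \<circ> \<sigma>) x = \<psi> x t2))"
      by (rule disjI2, rule exI[of _ c], rule exI[of _ r], rule exI[of _ "\<lambda>x. \<psi> (\<sigma> x)"],
          rule exI[of _ t1], rule exI[of _ t2]) (use * in auto)
  qed auto
  then show ?case using step.IH by (rule rtranclp.rtrancl_into_rtrancl[rotated])
qed auto

definition labellings where "labellings = {\<theta>. linked (\<lambda>x. x) \<theta>}"

lemma id_labelling: "(\<lambda>x. x) \<in> labellings" by (simp add: labellings_def)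

lemma labelling_linked: "\<theta> \<in> labellings \<Longrightarrow> linked \<theta> \<theta>' \<Longrightarrow> \<theta>' \<in> labellings"
  unfolding labellings_def using linked_trans by blast

lemma labelling_inj_fibre:
  assumes "\<theta> \<in> labellings"
  shows "inj_on \<theta> X \<and> (\<exists>t. t \<notin> critical_values f \<and> (\<forall>x\<in>X. poly f (\<theta> x) = t))"
  using assms unfolding labellings_def mem_Collect_eq linked_def
proof (induction rule: rtranclp_induct)
  case base
  then show ?case using regular by (auto simp: X_iff inj_on_def)
next
  case (step \<theta>1 \<theta>2)
  from step(2) show ?case unfolding adjacent_def
  proof (elim disjE exE conjE)
    assume "\<forall>x\<in>X. \<theta>1 x = \<theta>2 x"
    then show ?thesis using step.IH by (metis inj_on_cong)
  next
    fix c r \<psi> t1 t2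
    assume *: "ball c r \<subseteq> - critical_values f" "\<forall>x\<in>X. section_on f (ball c r) (\<psi> x)"
      "t1 \<in> ball c r" "t2 \<in> ball c r" "\<forall>x\<in>X. \<theta>1 x = \<psi> x t1 \<and> \<theta>2 x = \<psi> x t2"
    have "inj_on \<theta>2 X"
    proof (rule inj_onI)
      fix x y assume xy: "x \<in> X" "y \<in> X" "\<theta>2 x = \<theta>2 y"
      then have "\<psi> x t1 = \<psi> y t1"
        using section_unique[OF open_ball connected_ball *(1), of "\<psi> x" "\<psi> y" t2 t1] * by simp
      then show "x = y" using step.IH * xy by (auto simp: inj_on_def)
    qed
    moreover have "\<forall>x\<in>X. poly f (\<theta>2 x) = t2" using * by (auto simp: section_on_def)
    moreover have "t2 \<notin> critical_values f" using * by blast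
    ultimately show ?thesis by blast
  qed
qed

lemma labelling_inj: "\<theta> \<in> labellings \<Longrightarrow> inj_on \<theta> X"
  using labelling_inj_fibre by blast

lemma labelling_image:
  assumes "\<theta> \<in> labellings" "x \<in> X" shows "\<theta> ` X = fibre f (poly f (\<theta> x))"
    and "poly f (\<theta> x) \<notin> critical_values f"
proof -
  obtain t where t: "t \<notin> critical_values f" "\<forall>x\<in>X. poly f (\<theta> x) = t"
    using labelling_inj_fibre assms by blast
  have "\<theta> ` X \<subseteq> fibre f t" using t by (auto simp: fibre_def)
  moreover have "card (\<theta> ` X) = card (fibre f t)"
    using card_image[OF labelling_inj] card_X card_fibre degree_pos t assms by simp
  ultimately have "\<theta> ` X = fibre f t" using finite_fibre degree_pos card_subset_eq by blast
  then show "\<theta> ` X = fibre f (poly f (\<theta> x))" "poly f (\<theta> x) \<notin> critical_values f" using t assms by auto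
qed

lemma labelling_same_fibre: "\<theta> \<in> labellings \<Longrightarrow> x \<in> X \<Longrightarrow> y \<in> X \<Longrightarrow> poly f (\<theta> x) = poly f (\<theta> y)"
  using labelling_inj_fibre[of \<theta>] by auto

text \<open>The radius depends on \<open>t\<close> only. Sections through the roots over
  \<open>t\<close> stay distinct over the disc, so by counting they exhaust every fibre there, and
  any labelling over the disc consists of their values.\<close>

lemma local_labellings:
  assumes "t \<notin> critical_values f"
  obtains r where "r > 0" "ball t r \<subseteq> - critical_values f"
    "\<And>\<theta> x. \<theta> \<in> labellings \<Longrightarrow> x \<in> X \<Longrightarrow> poly f (\<theta> x) \<in> ball t r \<Longrightarrow>
      \<exists>\<psi>. (\<forall>y\<in>X. section_on f (ball t r) (\<psi> y) \<and> \<psi> y (poly f (\<theta> x)) = \<theta> y)"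
proof -
  have "\<forall>z\<in>fibre f t. \<exists>\<psi>. \<psi> analytic_on {t} \<and> (\<forall>\<^sub>F s in nhds t. poly f (\<psi> s) = s) \<and> \<psi> t = z"
  proof
    fix z assume "z \<in> fibre f t"
    then obtain \<psi> r where "r > 0" "section_on f (ball t r) \<psi>" "\<psi> t = z"
      using local_section[OF degree_pos _ assms, of z] by (auto simp: fibre_def)
    then show "\<exists>\<psi>. \<psi> analytic_on {t} \<and> (\<forall>\<^sub>F s in nhds t. poly f (\<psi> s) = s) \<and> \<psi> t = z"
      using section_on_analytic section_on_eventually by blast
  qed
  then obtain \<phi> where \<phi>: "\<And>z. z \<in> fibre f t \<Longrightarrow> \<phi> z analytic_on {t}"
      "\<And>z. z \<in> fibre f t \<Longrightarrow> \<forall>\<^sub>F s in nhds t. poly f (\<phi> z s) = s" "\<And>z. z \<in> fibre f t \<Longrightarrow> \<phi> z t = z" by metis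
  have "\<forall>\<^sub>F r in at_right 0. (\<forall>z\<in>fibre f t. section_on f (ball t r) (\<phi> z)) \<and> ball t r \<subseteq> - critical_values f \<and> r > 0"
    using assms open_regular_values[OF degree_pos]
    by (auto intro!: eventually_conj eventually_ball_finite eventually_section_on_ball \<phi>
          eventually_ball_subset finite_fibre degree_pos simp: eventually_at_right_less)
  then obtain r where r: "\<And>z. z\<in>fibre f t \<Longrightarrow> section_on f (ball t r) (\<phi> z)" "ball t r \<subseteq> - critical_values f" "r > 0"
    using eventually_happens'[OF trivial_limit_at_right_real] by blast
  have "\<exists>\<psi>. (\<forall>y\<in>X. section_on f (ball t r) (\<psi> y) \<and> \<psi> y (poly f (\<theta> x)) = \<theta> y)"
    if \<theta>: "\<theta> \<in> labellings" "x \<in> X" "poly f (\<theta> x) \<in> ball t r" for \<theta> x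
  proof -
    define s where "s = poly f (\<theta> x)"
    have s: "s \<in> ball t r" using \<theta> by (simp add: s_def)
    have "inj_on (\<lambda>z. \<phi> z s) (fibre f t)"
    proof (rule inj_onI)
      fix z w assume zw: "z \<in> fibre f t" "w \<in> fibre f t" "\<phi> z s = \<phi> w s"
      then have "\<phi> z t = \<phi> w t"
        using section_unique[OF open_ball connected_ball r(2), of "\<phi> z" "\<phi> w" s t] r s by simp
      then show "z = w" using \<phi> zw by simp
    qed
    moreover have "(\<lambda>z. \<phi> z s) ` fibre f t \<subseteq> fibre f s"
      using r(1) s by (auto simp: section_on_def fibre_def)
    moreover have "card (fibre f t) = card (fibre f s)"
      using card_fibre degree_pos assms s r(2) by (metis ComplD subsetD)
    ultimately have "(\<lambda>z. \<phi> z s) ` fibre f t = fibre f s"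
      using finite_fibre degree_pos by (metis card_image card_subset_eq)
    moreover have "\<theta> y \<in> fibre f s" if "y \<in> X" for y
      using labelling_same_fibre[OF \<theta>(1,2) that] by (simp add: fibre_def s_def)
    ultimately have "\<forall>y\<in>X. \<exists>z\<in>fibre f t. \<phi> z s = \<theta> y" by (metis imageE)
    then obtain c where c: "\<And>y. y \<in> X \<Longrightarrow> c y \<in> fibre f t" "\<And>y. y \<in> X \<Longrightarrow> \<phi> (c y) s = \<theta> y" by metis
    then show ?thesis using r(1) by (intro exI[of _ "\<lambda>y. \<phi> (c y)"]) (auto simp: s_def)
  qed
  then show ?thesis using that r by blast
qed

lemma labelling_move:
  assumes "\<theta> \<in> labellings" "ball t r \<subseteq> - critical_values f" "\<And>y. y \<in> X \<Longrightarrow> section_on f (ball t r) (\<psi> y)"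
    "t1 \<in> ball t r" "\<And>y. y \<in> X \<Longrightarrow> \<psi> y t1 = \<theta> y" "t2 \<in> ball t r"
  shows "(\<lambda>y. \<psi> y t2) \<in> labellings"
  by (rule labelling_linked[OF assms(1)], rule linked_adjacent, rule adjacentI[OF assms(2,3,4,6)])
     (use assms in auto)

lemma labelling_over:
  assumes "t \<notin> critical_values f"
  shows "\<exists>\<theta>\<in>labellings. \<forall>x\<in>X. poly f (\<theta> x) = t"
proof (rule connected_induction_simple[OF connected_regular_values[OF degree_pos],
      of t0 t "\<lambda>t. \<exists>\<theta>\<in>labellings. \<forall>x\<in>X. poly f (\<theta> x) = t"])
  show "t0 \<in> - critical_values f" "t \<in> - critical_values f" using assms regular by auto
  show "\<exists>\<theta>\<in>labellings. \<forall>x\<in>X. poly f (\<theta> x) = t0" using id_labelling by (auto simp: X_iff)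
  fix a assume "a \<in> - critical_values f"
  then obtain r where r: "r > 0" "ball a r \<subseteq> - critical_values f"
    "\<And>\<theta> x. \<theta> \<in> labellings \<Longrightarrow> x \<in> X \<Longrightarrow> poly f (\<theta> x) \<in> ball a r \<Longrightarrow>
      \<exists>\<psi>. (\<forall>y\<in>X. section_on f (ball a r) (\<psi> y) \<and> \<psi> y (poly f (\<theta> x)) = \<theta> y)"
    using local_labellings[of a] by (metis ComplD)
  have move: "\<exists>\<theta>\<in>labellings. \<forall>x\<in>X. poly f (\<theta> x) = v"
    if uv: "u \<in> ball a r" "v \<in> ball a r" "\<exists>\<theta>\<in>labellings. \<forall>x\<in>X. poly f (\<theta> x) = u" for u v
  proof -
    obtain \<theta> where \<theta>: "\<theta> \<in> labellings" "\<forall>x\<in>X. poly f (\<theta> x) = u" using uv by blast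
    obtain x where x: "x \<in> X" using X_nonempty by blast
    then obtain \<psi> where \<psi>: "\<And>y. y \<in> X \<Longrightarrow> section_on f (ball a r) (\<psi> y)" "\<And>y. y \<in> X \<Longrightarrow> \<psi> y u = \<theta> y"
      using r(3)[OF \<theta>(1) x] \<theta> uv by auto
    have "(\<lambda>y. \<psi> y v) \<in> labellings" by (rule labelling_move[OF \<theta>(1) r(2) \<psi>(1) uv(1) \<psi>(2) uv(2)])
    moreover have "\<forall>x\<in>X. poly f (\<psi> x v) = v" using \<psi> uv by (auto simp: section_on_def)
    ultimately show ?thesis by (intro bexI[of _ "\<lambda>y. \<psi> y v"])
  qed
  show "\<exists>T. openin (top_of_set (- critical_values f)) T \<and> a \<in> T \<and>
      (\<forall>x\<in>T. \<forall>y\<in>T. (\<exists>\<theta>\<in>labellings. \<forall>xa\<in>X. poly f (\<theta> xa) = x) \<longrightarrow>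
        (\<exists>\<theta>\<in>labellings. \<forall>x\<in>X. poly f (\<theta> x) = y))"
  proof (intro exI[of _ "ball a r"] conjI ballI impI)
    show "openin (top_of_set (- critical_values f)) (ball a r)" using r(2) by (intro open_subset) auto
    show "a \<in> ball a r" using r(1) by simp
  qed (rule move)
qed

section \<open>The group of chains returning to the base fibre\<close>

definition G where "G = {\<sigma>. \<sigma> permutes X \<and> linked (\<lambda>x. x) \<sigma>}"

lemma G_permutes: "\<sigma> \<in> G \<Longrightarrow> \<sigma> permutes X" by (simp add: G_def)
lemma G_labelling: "\<sigma> \<in> G \<Longrightarrow> \<sigma> \<in> labellings" by (simp add: G_def labellings_def)

lemma labelling_compose_G:
  assumes "\<theta> \<in> labellings" "\<sigma> \<in> G" shows "\<theta> \<circ> \<sigma> \<in> labellings"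
proof -
  have "linked ((\<lambda>x. x) \<circ> \<sigma>) (\<theta> \<circ> \<sigma>)"
    using assms by (intro linked_compose) (auto simp: G_def labellings_def)
  then show ?thesis using labelling_linked[OF G_labelling[OF assms(2)]] by (simp add: comp_def)
qed

lemma G_compose: "\<sigma> \<in> G \<Longrightarrow> \<rho> \<in> G \<Longrightarrow> \<sigma> \<circ> \<rho> \<in> G"
  using labelling_compose_G[OF G_labelling, of \<sigma> \<rho>] permutes_compose[of \<rho> X \<sigma>]
  by (simp add: G_def labellings_def)

text \<open>Comparing the two labellings gives a permutation \<open>\<sigma>\<close> of the base
  roots. Since relabelling commutes with chains, \<open>\<sigma>\<close> is linked to
  \<open>\<theta> \<circ> \<sigma>\<close>, which agrees with \<open>\<theta>'\<close> on the base
  roots and so leads back to the identity.\<close>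

lemma labelling_change:
  assumes "\<theta> \<in> labellings" "\<theta>' \<in> labellings" "x \<in> X" "poly f (\<theta> x) = poly f (\<theta>' x)"
  shows "\<exists>\<sigma>\<in>G. \<forall>y\<in>X. \<theta>' y = \<theta> (\<sigma> y)"
proof -
  have im: "\<theta> ` X = \<theta>' ` X" using labelling_image(1) assms by metis
  define \<sigma> where "\<sigma> y = (if y \<in> X then inv_into X \<theta> (\<theta>' y) else y)" for y
  have \<sigma>X: "\<sigma> y \<in> X \<and> \<theta> (\<sigma> y) = \<theta>' y" if "y \<in> X" for y
  proof -
    have "\<theta>' y \<in> \<theta> ` X" using im that by blast
    then show ?thesis using that by (simp add: \<sigma>_def f_inv_into_f inv_into_into)
  qed
  have "inj_on \<sigma> X"
  proof (rule inj_onI)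
    fix y z assume "y \<in> X" "z \<in> X" "\<sigma> y = \<sigma> z"
    then have "\<theta>' y = \<theta>' z" using \<sigma>X by metis
    then show "y = z" using labelling_inj[OF assms(2)] \<open>y \<in> X\<close> \<open>z \<in> X\<close> by (auto simp: inj_on_def)
  qed
  moreover have "\<sigma> ` X = X"
    using calculation \<sigma>X by (intro card_subset_eq) (auto simp: card_image)
  ultimately have perm: "\<sigma> permutes X"
    by (intro bij_imp_permutes) (auto simp: bij_betw_def \<sigma>_def)
  have "linked (\<sigma>) (\<theta> \<circ> \<sigma>)"
    using linked_compose[OF perm, of "\<lambda>x. x" \<theta>] assms(1) by (simp add: labellings_def comp_def)
  moreover have "linked (\<theta> \<circ> \<sigma>) \<theta>'" by (rule linked_eq) (simp add: \<sigma>X)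
  moreover have "linked \<theta>' (\<lambda>x. x)" using assms(2) by (simp add: labellings_def linked_sym)
  ultimately have "linked \<sigma> (\<lambda>x. x)" using linked_trans by blast
  then have "\<sigma> \<in> G" using perm linked_sym by (simp add: G_def)
  then show ?thesis using \<sigma>X by (intro bexI[of _ \<sigma>]) auto
qed

lemma G_inv: assumes "\<sigma> \<in> G" shows "inv \<sigma> \<in> G"
proof -
  have p: "\<sigma> permutes X" using assms by (rule G_permutes)
  have "linked ((\<lambda>x. x) \<circ> inv \<sigma>) (\<sigma> \<circ> inv \<sigma>)"
    using assms by (intro linked_compose permutes_inv p) (simp add: G_def)
  then have "linked (inv \<sigma>) (\<lambda>x. x)" using permutes_inv_o(1)[OF p] by (simp add: comp_def id_def)
  then show ?thesis using permutes_inv[OF p] linked_sym by (simp add: G_def)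
qed

end

lemma section_onD: "section_on f U \<psi> \<Longrightarrow> t \<in> U \<Longrightarrow> poly f (\<psi> t) = t"
  by (simp add: section_on_def)

context regular_point begin

text \<open>Analytic relations between the branches survive continuation. The inductive claim
  \<open>J\<close> speaks of every family of sections through the labelling, because the next link
  of a chain may use another disc; two families through one labelling agree on the intersection of
  their discs, which is convex.\<close>

lemma permanence:
  assumes hol: "\<And>U \<psi>. open U \<Longrightarrow> (\<And>x. x \<in> X \<Longrightarrow> \<psi> x holomorphic_on U) \<Longrightarrow> (\<lambda>t. \<Phi> (\<lambda>x. \<psi> x t)) holomorphic_on U"
    and cong: "\<And>\<theta> \<theta>'. (\<And>x. x \<in> X \<Longrightarrow> \<theta> x = \<theta>' x) \<Longrightarrow> \<Phi> \<theta> = \<Phi> \<theta>'"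
    and zero: "\<forall>\<^sub>F t in nhds t0. \<Phi> (\<lambda>x. root_branch f t0 x t) = (0 :: complex)"
    and \<theta>: "\<theta> \<in> labellings"
  shows "\<Phi> \<theta> = 0"
proof -
  define J where "J \<theta> \<longleftrightarrow> (\<forall>c r \<psi> t1. ball c r \<subseteq> - critical_values f \<longrightarrow> t1 \<in> ball c r \<longrightarrow>
      (\<forall>x\<in>X. section_on f (ball c r) (\<psi> x) \<and> \<psi> x t1 = \<theta> x) \<longrightarrow> (\<forall>t\<in>ball c r. \<Phi> (\<lambda>x. \<psi> x t) = 0))" for \<theta>
  have hol': "(\<lambda>t. \<Phi> (\<lambda>x. \<psi> x t)) holomorphic_on ball c r" if "\<forall>x\<in>X. section_on f (ball c r) (\<psi> x)" for c r \<psi>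
    using that by (intro hol) (auto simp: section_on_def)
  obtain x0 where x0: "x0 \<in> X" using X_nonempty by blast
  have J\<theta>: "J \<theta>" using \<theta> unfolding labellings_def mem_Collect_eq linked_def
  proof (induction rule: rtranclp_induct)
    case base
    show ?case unfolding J_def
    proof (intro allI impI)
      fix c r \<psi> t1
      assume *: "ball c r \<subseteq> - critical_values f" "t1 \<in> ball c r"
        "\<forall>x\<in>X. section_on f (ball c r) (\<psi> x) \<and> \<psi> x t1 = x"
      have "poly f (\<psi> x0 t1) = t1" using *(2,3) x0 section_onD by blast
      then have t1: "t1 = t0" using *(3) x0 by (auto simp: X_iff)
      have "\<forall>\<^sub>F s in nhds t0. s \<in> ball c r" using *(2) t1 by (intro eventually_nhds_in_open) auto
      moreover have "\<forall>\<^sub>F s in nhds t0. \<forall>x\<in>X. root_branch f t0 x s = \<psi> x s"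
      proof (intro eventually_ball_finite ballI finite_X)
        fix x assume x: "x \<in> X"
        have "\<psi> x analytic_on {t0}" using * t1 x by (auto simp: section_on_def analytic_at)
        moreover have "\<forall>\<^sub>F s in nhds t0. poly f (\<psi> x s) = s"
          using \<open>\<forall>\<^sub>F s in nhds t0. s \<in> ball c r\<close> by eventually_elim (use * x in \<open>auto simp: section_on_def\<close>)
        ultimately show "\<forall>\<^sub>F s in nhds t0. root_branch f t0 x s = \<psi> x s"
          using root_branch_unique[OF degree_pos regular x] * t1 x by blast
      qed
      ultimately have "\<forall>\<^sub>F s in nhds t0. \<Phi> (\<lambda>x. \<psi> x s) = 0"
        using zero
      proof eventually_elim
        case (elim s)
        then show ?case using cong[of "\<lambda>x. \<psi> x s" "\<lambda>x. root_branch f t0 x s"] by simp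
      qed
      then show "\<forall>t\<in>ball c r. \<Phi> (\<lambda>x. \<psi> x t) = 0"
        using holomorphic_eq_zero_on[OF hol' open_ball connected_ball, of c r \<psi> t0] * t1 by blast
    qed
  next
    case (step \<theta>1 \<theta>2)
    from step(2) show ?case unfolding adjacent_def
    proof (elim disjE exE conjE)
      assume eq: "\<forall>x\<in>X. \<theta>1 x = \<theta>2 x"
      have "J \<theta>2 = J \<theta>1" unfolding J_def using eq by simp
      then show ?thesis using step.IH by simp
    next
      fix c r \<psi> t1 t2
      assume *: "ball c r \<subseteq> - critical_values f" "\<forall>x\<in>X. section_on f (ball c r) (\<psi> x)"
        "t1 \<in> ball c r" "t2 \<in> ball c r" "\<forall>x\<in>X. \<theta>1 x = \<psi> x t1 \<and> \<theta>2 x = \<psi> x t2"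
      have zero1: "\<Phi> (\<lambda>x. \<psi> x t) = 0" if "t \<in> ball c r" for t
        using step.IH[unfolded J_def, rule_format, OF *(1,3) _ that, of \<psi>] * by auto
      show ?thesis unfolding J_def
      proof (intro allI impI)
        fix c' r' \<psi>' t'
        assume **: "ball c' r' \<subseteq> - critical_values f" "t' \<in> ball c' r'"
          "\<forall>x\<in>X. section_on f (ball c' r') (\<psi>' x) \<and> \<psi>' x t' = \<theta>2 x"
        have "poly f (\<psi> x0 t2) = t2" "poly f (\<psi>' x0 t') = t'"
          using *(2,4) **(2,3) x0 section_onD by blast+
        then have t': "t' = t2" using *(5) **(3) x0 by simp
        define U where "U = ball c r \<inter> ball c' r'"
        have U: "open U" "connected U" "U \<subseteq> - critical_values f" "t2 \<in> U"
          using * ** t' by (auto simp: U_def intro: convex_connected convex_Int)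
        have "\<psi>' x t = \<psi> x t" if "x \<in> X" "t \<in> U" for x t
        proof (rule section_unique[OF U(1-3) _ _ U(4) _ that(2)])
          show "section_on f U (\<psi>' x)" "section_on f U (\<psi> x)"
            using *(2) **(3) that(1) section_on_subset unfolding U_def by blast+
          show "\<psi>' x t2 = \<psi> x t2" using *(5) **(3) that(1) t' by simp
        qed
        then have "\<Phi> (\<lambda>x. \<psi>' x t) = 0" if "t \<in> U" for t
          using cong[of "\<lambda>x. \<psi>' x t" "\<lambda>x. \<psi> x t"] zero1[of t] that by (simp add: U_def)
        then have "\<forall>\<^sub>F t in nhds t2. \<Phi> (\<lambda>x. \<psi>' x t) = 0"
          using U unfolding eventually_nhds by blast
        then show "\<forall>t\<in>ball c' r'. \<Phi> (\<lambda>x. \<psi>' x t) = 0"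
          using holomorphic_eq_zero_on[OF hol' open_ball connected_ball, of c' r' \<psi>' t2] ** t' by blast
      qed
    qed
  qed
  obtain r where r: "r > 0" "ball (poly f (\<theta> x0)) r \<subseteq> - critical_values f"
    "\<And>\<theta>' x. \<theta>' \<in> labellings \<Longrightarrow> x \<in> X \<Longrightarrow> poly f (\<theta>' x) \<in> ball (poly f (\<theta> x0)) r \<Longrightarrow>
      \<exists>\<psi>. (\<forall>y\<in>X. section_on f (ball (poly f (\<theta> x0)) r) (\<psi> y) \<and> \<psi> y (poly f (\<theta>' x)) = \<theta>' y)"
    using local_labellings[OF labelling_image(2)[OF \<theta> x0]] by metis
  obtain \<psi> where \<psi>: "\<forall>y\<in>X. section_on f (ball (poly f (\<theta> x0)) r) (\<psi> y) \<and> \<psi> y (poly f (\<theta> x0)) = \<theta> y"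
    using r(3)[OF \<theta> x0] r(1) by auto
  have "poly f (\<theta> x0) \<in> ball (poly f (\<theta> x0)) r" using r(1) by simp
  from J\<theta>[unfolded J_def, rule_format, OF r(2) this _ this, of \<psi>] \<psi>
  have "\<Phi> (\<lambda>x. \<psi> x (poly f (\<theta> x0))) = 0" by blast
  then show ?thesis using cong[of \<theta> "\<lambda>x. \<psi> x (poly f (\<theta> x0))"] \<psi> by simp
qed

section \<open>Comparison with germs and with continuation along loops\<close>

lemma root_branch_labelling:
  "\<forall>\<^sub>F t in nhds t0. (\<lambda>x. root_branch f t0 x t) \<in> labellings \<and> (\<forall>x\<in>X. poly f (root_branch f t0 x t) = t)"
proof -
  have "\<forall>\<^sub>F r in at_right 0. (\<forall>x\<in>X. section_on f (ball t0 r) (root_branch f t0 x)) \<and> ball t0 r \<subseteq> - critical_values f \<and> r > 0"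
    using regular open_regular_values[OF degree_pos]
    by (auto intro!: eventually_conj eventually_ball_finite eventually_section_on_ball
          root_branch degree_pos eventually_ball_subset simp: eventually_at_right_less)
  then obtain r where r: "\<And>x. x \<in> X \<Longrightarrow> section_on f (ball t0 r) (root_branch f t0 x)"
      "ball t0 r \<subseteq> - critical_values f" "r > 0"
    using eventually_happens'[OF trivial_limit_at_right_real] by blast
  have "\<forall>\<^sub>F s in nhds t0. s \<in> ball t0 r" using r by (intro eventually_nhds_in_open) auto
  then show ?thesis
  proof eventually_elim
    case (elim s)
    have "(\<lambda>x. root_branch f t0 x s) \<in> labellings"
      by (rule labelling_move[OF id_labelling r(2,1) _ _ elim, where ?t1.0 = t0])
        (use r root_branch(2)[OF degree_pos regular] in auto)
    then show ?case using r(1) elim by (auto simp: section_on_def)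
  qed
qed

text \<open>Solving the equation f = t and being linked are both locally constant conditions along
  the path, so connectedness of the unit interval replaces a subdivision. The chain consists of the
  continued germs evaluated at the moving point.\<close>

lemma induced_perm_in_G:
  assumes \<gamma>: "path \<gamma>" "path_image \<gamma> \<subseteq> - critical_values f" "pathstart \<gamma> = t0" "pathfinish \<gamma> = t0"
    and \<sigma>: "induced_perm f t0 \<gamma> \<sigma>"
  shows "\<sigma> \<in> G"
proof -
  have perm: "\<sigma> permutes X" using \<sigma> by (simp add: induced_perm_def)
  have "\<forall>x\<in>X. \<exists>F. analytic_continuation_along \<gamma> F \<and> (\<forall>\<^sub>F t in nhds t0. F 0 t = root_branch f t0 x t) \<and>
        (\<forall>\<^sub>F t in nhds t0. F 1 t = root_branch f t0 (\<sigma> x) t)"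
    using \<sigma> by (simp add: induced_perm_def)
  then obtain F where F: "\<And>x. x \<in> X \<Longrightarrow> analytic_continuation_along \<gamma> (F x)"
    "\<And>x. x \<in> X \<Longrightarrow> \<forall>\<^sub>F t in nhds t0. F x 0 t = root_branch f t0 x t"
    "\<And>x. x \<in> X \<Longrightarrow> \<forall>\<^sub>F t in nhds t0. F x 1 t = root_branch f t0 (\<sigma> x) t"
    by metis
  define I where "I = {0..1::real}"
  have I: "connected I" "0 \<in> I" "1 \<in> I" by (auto simp: I_def)
  have cont: "continuous_on I \<gamma>" using \<gamma>(1) by (simp add: path_def I_def)
  have reg: "\<gamma> s \<notin> critical_values f" if "s \<in> I" for s
    using \<gamma>(2) that unfolding path_image_def I_def by blast
  have \<gamma>01: "\<gamma> 0 = t0" "\<gamma> 1 = t0" using \<gamma> by (auto simp: pathstart_def pathfinish_def)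
  have an: "F x s analytic_on {\<gamma> s}" if "x \<in> X" "s \<in> I" for x s
    using F(1)[OF that(1)] that(2) by (auto simp: analytic_continuation_along_def I_def)
  have loc: "\<forall>\<^sub>F u in nhds s. u \<in> I \<longrightarrow> (\<forall>\<^sub>F t in nhds (\<gamma> u). F x u t = F x s t)" if "x \<in> X" "s \<in> I" for x s
  proof -
    have "\<exists>e>0. \<forall>u\<in>{0..1}. \<bar>u - s\<bar> < e \<longrightarrow> (\<forall>\<^sub>F t in nhds (\<gamma> u). F x u t = F x s t)"
      using F(1)[OF that(1)] that(2) by (auto simp: analytic_continuation_along_def I_def)
    then show ?thesis unfolding eventually_nhds_metric dist_real_def I_def by blast
  qed
  have near: "\<forall>\<^sub>F u in nhds s. u \<in> I \<longrightarrow> \<gamma> u \<in> V" if "s \<in> I" "open V" "\<gamma> s \<in> V" for s V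
  proof -
    have "(\<gamma> \<longlongrightarrow> \<gamma> s) (at s within I)" using cont that by (auto simp: continuous_on_def)
    then have "\<forall>\<^sub>F u in at s within I. \<gamma> u \<in> V" using that by (auto dest: topological_tendstoD)
    then have "\<forall>\<^sub>F u in nhds s. u \<noteq> s \<longrightarrow> u \<in> I \<longrightarrow> \<gamma> u \<in> V" by (simp add: eventually_at_filter)
    then show ?thesis by eventually_elim (use that in auto)
  qed
  have sec: "\<forall>\<^sub>F t in nhds (\<gamma> s). poly f (F x s t) = t" if x: "x \<in> X" and "s \<in> I" for x s
  proof (rule connected_induction_simple[OF I(1,2) \<open>s \<in> I\<close>, of "\<lambda>s. \<forall>\<^sub>F t in nhds (\<gamma> s). poly f (F x s t) = t"])
    show "\<forall>\<^sub>F t in nhds (\<gamma> 0). poly f (F x 0 t) = t"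
      using F(2)[OF x] root_branch(3)[OF degree_pos regular x] unfolding \<gamma>01
      by eventually_elim simp
    fix a assume a: "a \<in> I"
    obtain \<rho> where \<rho>: "\<rho> > 0" "F x a holomorphic_on ball (\<gamma> a) \<rho>" using an[OF x a] by (auto simp: analytic_at_ball)
    have "\<forall>\<^sub>F u in nhds a. (u \<in> I \<longrightarrow> (\<forall>\<^sub>F t in nhds (\<gamma> u). F x u t = F x a t)) \<and> (u \<in> I \<longrightarrow> \<gamma> u \<in> ball (\<gamma> a) \<rho>)"
      using loc[OF x a] near[OF a open_ball, of "\<gamma> a" \<rho>] \<rho> by (auto intro: eventually_conj)
    then obtain T where T: "open T" "a \<in> T"
      "\<And>u. u \<in> T \<Longrightarrow> u \<in> I \<Longrightarrow> \<forall>\<^sub>F t in nhds (\<gamma> u). F x u t = F x a t"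
      "\<And>u. u \<in> T \<Longrightarrow> u \<in> I \<Longrightarrow> \<gamma> u \<in> ball (\<gamma> a) \<rho>"
      unfolding eventually_nhds by blast
    have move: "\<forall>\<^sub>F t in nhds (\<gamma> v). poly f (F x v t) = t"
      if uv: "u \<in> I \<inter> T" "v \<in> I \<inter> T" "\<forall>\<^sub>F t in nhds (\<gamma> u). poly f (F x u t) = t" for u v
    proof -
      have "\<forall>\<^sub>F t in nhds (\<gamma> u). F x u t = F x a t" using T uv by blast
      then have "\<forall>\<^sub>F t in nhds (\<gamma> u). poly f (F x a t) - t = 0"
        using uv(3) by eventually_elim auto
      moreover have "(\<lambda>t. poly f (F x a t) - t) holomorphic_on ball (\<gamma> a) \<rho>"
        using \<rho> by (intro holomorphic_intros)
      ultimately have zero: "poly f (F x a t) - t = 0" if "t \<in> ball (\<gamma> a) \<rho>" for t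
        using holomorphic_eq_zero_on[of "\<lambda>t. poly f (F x a t) - t" "ball (\<gamma> a) \<rho>" "\<gamma> u" t] T(4)[of u] uv that by auto
      have "\<gamma> v \<in> ball (\<gamma> a) \<rho>" using T uv by blast
      then have "\<forall>\<^sub>F t in nhds (\<gamma> v). t \<in> ball (\<gamma> a) \<rho>" by (intro eventually_nhds_in_open) auto
      moreover have "\<forall>\<^sub>F t in nhds (\<gamma> v). F x v t = F x a t" using T uv by blast
      ultimately show ?thesis by eventually_elim (use zero in auto)
    qed
    show "\<exists>T. openin (top_of_set I) T \<and> a \<in> T \<and> (\<forall>xa\<in>T. \<forall>y\<in>T.
        (\<forall>\<^sub>F t in nhds (\<gamma> xa). poly f (F x xa t) = t) \<longrightarrow> (\<forall>\<^sub>F t in nhds (\<gamma> y). poly f (F x y t) = t))"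
    proof (intro exI[of _ "I \<inter> T"] conjI ballI impI)
      show "openin (top_of_set I) (I \<inter> T)" using T(1) by blast
      show "a \<in> I \<inter> T" using a T(2) by blast
    qed (rule move)
  qed
  define \<theta> where "\<theta> s = (\<lambda>x. F x s (\<gamma> s))" for s
  have "linked (\<theta> 0) (\<theta> 1)"
  proof (rule connected_equivalence_relation[OF I, of "\<lambda>s u. linked (\<theta> s) (\<theta> u)"])
    fix a assume a: "a \<in> I"
    have "\<forall>\<^sub>F r in at_right 0. (\<forall>x\<in>X. section_on f (ball (\<gamma> a) r) (F x a)) \<and> ball (\<gamma> a) r \<subseteq> - critical_values f \<and> r > 0"
      using reg[OF a] open_regular_values[OF degree_pos]
      by (auto intro!: eventually_conj eventually_ball_finite eventually_section_on_ball
            an[OF _ a] sec[OF _ a] eventually_ball_subset simp: eventually_at_right_less)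
    then obtain r where r: "\<And>x. x \<in> X \<Longrightarrow> section_on f (ball (\<gamma> a) r) (F x a)"
        "ball (\<gamma> a) r \<subseteq> - critical_values f" "r > 0"
      using eventually_happens'[OF trivial_limit_at_right_real] by blast
    have "\<forall>\<^sub>F u in nhds a. (\<forall>x\<in>X. u \<in> I \<longrightarrow> (\<forall>\<^sub>F t in nhds (\<gamma> u). F x u t = F x a t)) \<and> (u \<in> I \<longrightarrow> \<gamma> u \<in> ball (\<gamma> a) r)"
      using loc[OF _ a] near[OF a open_ball, of "\<gamma> a" r] r by (intro eventually_conj eventually_ball_finite) auto
    then obtain T where T: "open T" "a \<in> T"
      "\<And>u x. u \<in> T \<Longrightarrow> x \<in> X \<Longrightarrow> u \<in> I \<Longrightarrow> \<forall>\<^sub>F t in nhds (\<gamma> u). F x u t = F x a t"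
      "\<And>u. u \<in> T \<Longrightarrow> u \<in> I \<Longrightarrow> \<gamma> u \<in> ball (\<gamma> a) r"
      unfolding eventually_nhds by blast
    have "linked (\<theta> a) (\<theta> u)" if u: "u \<in> I" "u \<in> T" for u
    proof (rule linked_adjacent, rule adjacentI[OF r(2,1)])
      show "\<gamma> a \<in> ball (\<gamma> a) r" "\<gamma> u \<in> ball (\<gamma> a) r" using T(4) u r by auto
      show "\<theta> a x = F x a (\<gamma> a)" for x by (simp add: \<theta>_def)
      show "\<theta> u x = F x a (\<gamma> u)" if "x \<in> X" for x
        using eventually_nhds_x_imp_x[OF T(3)[OF u(2) that u(1)]] by (simp add: \<theta>_def)
    qed
    then show "\<exists>T. openin (top_of_set I) T \<and> a \<in> T \<and> (\<forall>x\<in>T. linked (\<theta> a) (\<theta> x))"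
      using T a by (intro exI[of _ "I \<inter> T"]) auto
  qed (auto intro: linked_sym linked_trans)
  moreover have "\<theta> 0 x = x" if "x \<in> X" for x
    using eventually_nhds_x_imp_x[OF F(2)[OF that]] root_branch(2)[OF degree_pos regular that] by (simp add: \<theta>_def \<gamma>01)
  then have "linked (\<lambda>x. x) (\<theta> 0)" by (intro linked_eq) simp
  moreover have "\<theta> 1 x = \<sigma> x" if "x \<in> X" for x
    using eventually_nhds_x_imp_x[OF F(3)[OF that]] root_branch(2)[OF degree_pos regular, of "\<sigma> x"]
      permutes_in_image[OF perm] that by (simp add: \<theta>_def \<gamma>01)
  then have "linked (\<theta> 1) \<sigma>" by (intro linked_eq) simp
  ultimately show ?thesis using perm linked_trans by (auto simp: G_def)
qed

lemma Gamma_class_subset_G: assumes "\<sigma> \<in> Gamma_class f t0" shows "\<sigma> \<in> G"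
proof -
  obtain \<rho> \<tau> \<gamma> where \<sigma>: "\<sigma> = \<rho> \<circ> \<tau> \<circ> inv \<rho>" "\<rho> \<in> monodromy_group f t0"
    "loop_around_critical_values f t0 \<gamma>" "induced_perm f t0 \<gamma> \<tau>"
    using assms by (auto simp: Gamma_class_def)
  have "\<rho> \<in> G" using \<sigma>(2) induced_perm_in_G by (auto simp: monodromy_group_def)
  obtain R p where p: "R > 0" "critical_values f \<subseteq> ball 0 R" "path p" "path_image p \<subseteq> - critical_values f"
    "pathstart p = t0" "pathfinish p = complex_of_real R" "\<gamma> = p +++ (circlepath 0 R +++ reversepath p)"
    using \<sigma>(3) by (auto simp: loop_around_critical_values_def)
  have "path_image (circlepath 0 R) \<subseteq> - critical_values f" using p(1,2) by auto
  then have "path_image \<gamma> \<subseteq> - critical_values f"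
    using p by (auto simp: path_image_join dest!: subsetD[OF path_image_join_subset])
  then have "\<tau> \<in> G" using p \<sigma>(4) by (intro induced_perm_in_G) (auto simp: path_image_join)
  then show ?thesis using \<open>\<rho> \<in> G\<close> \<sigma>(1) G_compose G_inv by simp
qed

end

section \<open>Equivariant functions of the roots are polynomials\<close>

lemma removable_singularities:
  assumes "finite K" "K \<subseteq> S" "open S" "h holomorphic_on (S - K)"
    "\<And>a. a \<in> K \<Longrightarrow> \<exists>B. \<forall>\<^sub>F z in at a. norm (h z) \<le> (B::real)"
  shows "\<exists>g. g holomorphic_on S \<and> (\<forall>z\<in>S - K. g z = (h z :: complex))"
  using assms
proof (induction K arbitrary: h rule: finite_induct)
  case (insert a K)
  define S' where "S' = S - K"
  have S': "open S'" "a \<in> interior S'"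
    using insert by (auto simp: S'_def open_Diff finite_imp_closed interior_open)
  have eq: "S' - {a} = S - insert a K" by (auto simp: S'_def)
  obtain g where g: "g holomorphic_on S'" "\<forall>z\<in>S' - {a}. g z = h z"
    using holomorphic_on_extend_bounded[of h S' a] S'(2) insert.prems(3,4) eq by auto
  have "\<exists>B. \<forall>\<^sub>F z in at b. norm (g z) \<le> B" if b: "b \<in> K" for b
  proof -
    obtain B where B: "\<forall>\<^sub>F z in at b. norm (h z) \<le> B" using insert.prems(4)[of b] b by blast
    have "open (S - (insert a K - {b}))" using insert by (intro open_Diff finite_imp_closed) auto
    moreover have "b \<in> S - (insert a K - {b})" using insert.prems b by auto
    ultimately have "\<forall>\<^sub>F z in at b. z \<in> S - (insert a K - {b})" by (intro eventually_at_in_open')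
    moreover have "\<forall>\<^sub>F z in at b. z \<noteq> b" by (simp add: eventually_at_filter)
    ultimately have "\<forall>\<^sub>F z in at b. norm (g z) \<le> B" using B
      by eventually_elim (use g in \<open>auto simp: S'_def\<close>)
    then show ?thesis by blast
  qed
  then obtain k where "k holomorphic_on S" "\<forall>z\<in>S - K. k z = g z"
    using insert.IH[of g] g insert.prems by (auto simp: S'_def)
  then show ?case using g by (intro exI[of _ k]) (auto simp: S'_def)
qed auto

text \<open>The bound is used twice: near the finite set it makes the singularities removable, and
  at infinity it feeds Liouville's theorem.\<close>

lemma polynomial_growth_imp_poly:
  assumes K: "finite K" and h: "h holomorphic_on (- K)"
    and growth: "\<And>z. z \<notin> K \<Longrightarrow> norm (h z) \<le> C * (1 + norm z) ^ N"
  shows "\<exists>p. degree p \<le> N \<and> (\<forall>z. z \<notin> K \<longrightarrow> h z = poly p z)"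
proof -
  have C0: "C \<ge> 0"
  proof -
    obtain z where "z \<notin> K" using ex_new_if_finite[OF infinite_UNIV_char_0 K] by blast
    then have "0 \<le> C * (1 + norm z) ^ N" using growth norm_ge_zero order_trans by blast
    moreover have "(1 + norm z) ^ N > 0" by (intro zero_less_power) (simp add: add_pos_nonneg)
    ultimately show ?thesis by (simp add: zero_le_mult_iff)
  qed
  have "\<exists>B. \<forall>\<^sub>F z in at a. norm (h z) \<le> B" if "a \<in> K" for a
  proof -
    have "open (- (K - {a}))" by (intro open_Compl finite_imp_closed finite_Diff K)
    then have "\<forall>\<^sub>F z in at a. z \<in> - (K - {a})" by (intro eventually_at_in_open') auto
    moreover have "\<forall>\<^sub>F z in at a. z \<noteq> a" by (simp add: eventually_at_filter)
    moreover have "\<forall>\<^sub>F z in at a. z \<in> ball a 1" by (intro eventually_at_in_open') auto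
    ultimately have "\<forall>\<^sub>F z in at a. norm (h z) \<le> C * (1 + (norm a + 1)) ^ N"
    proof eventually_elim
      case (elim z)
      have "norm z \<le> norm a + 1" using elim(3) norm_triangle_sub[of z a] by (auto simp: dist_norm norm_minus_commute)
      then have "C * (1 + norm z) ^ N \<le> C * (1 + (norm a + 1)) ^ N"
        using C0 by (intro mult_left_mono power_mono) auto
      then show ?case using growth[of z] elim by auto
    qed
    then show ?thesis by blast
  qed
  then obtain g where g: "g holomorphic_on UNIV" "\<And>z. z \<notin> K \<Longrightarrow> g z = h z"
    using removable_singularities[OF K subset_UNIV open_UNIV, of h] h by (auto simp: Compl_eq_Diff_UNIV)
  obtain R where R: "\<And>a. a \<in> K \<Longrightarrow> norm a \<le> R" using finite_imp_bounded[OF K] by (auto simp: bounded_iff)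
  have "norm (g z) \<le> (C * 2 ^ N) * norm z ^ N" if "max 1 (R + 1) \<le> norm z" for z
  proof -
    have "z \<notin> K" using R[of z] that by auto
    then have "norm (g z) \<le> C * (1 + norm z) ^ N" using g growth by simp
    also have "\<dots> \<le> C * (2 * norm z) ^ N" using C0 that by (intro mult_left_mono power_mono) auto
    finally show ?thesis by (simp add: power_mult_distrib mult.assoc)
  qed
  from Liouville_polynomial[OF g(1) this]
  have eq: "g \<xi> = (\<Sum>k\<le>N. (deriv ^^ k) g 0 / fact k * \<xi> ^ k)" for \<xi> by blast
  define p where "p = (\<Sum>k\<le>N. monom ((deriv ^^ k) g 0 / fact k) k)"
  have "degree p \<le> N" unfolding p_def by (intro degree_sum_le) (auto intro: order_trans[OF degree_monom_le])
  moreover have "h z = poly p z" if "z \<notin> K" for z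
    using g(2)[OF that] eq[of z] by (simp add: p_def poly_sum poly_monom)
  ultimately show ?thesis by blast
qed

text \<open>For large arguments the modulus of \<open>f\<close> is comparable to the power |x|^d, so
  points of one fibre have comparable size. This turns a bound in terms of all roots into a bound in
  terms of one.\<close>

lemma fibre_growth:
  assumes "degree f > 0"
  shows "\<exists>C\<ge>1. \<forall>z w :: complex. poly f z = poly f w \<longrightarrow> norm w \<le> C * (1 + norm z)"
proof -
  define d where "d = degree f"
  define l where "l = norm (lead_coeff f)"
  have l: "l > 0" using assms by (auto simp: l_def)
  have "((\<lambda>x. norm (poly f x / x ^ d)) \<longlongrightarrow> l) at_infinity"
    unfolding l_def d_def by (intro tendsto_norm poly_divide_tendsto_aux)
  then have "\<forall>\<^sub>F x in at_infinity. dist (norm (poly f x / x ^ d)) l < l / 2"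
    using l by (intro tendstoD) auto
  then obtain b where b: "\<And>x. norm x \<ge> b \<Longrightarrow> dist (norm (poly f x / x ^ d)) l < l / 2"
    by (auto simp: eventually_at_infinity)
  define R where "R = max b 1"
  have lower: "l / 2 * norm x ^ d \<le> norm (poly f x)" and upper: "norm (poly f x) \<le> 2 * l * norm x ^ d"
    if "norm x \<ge> R" for x
  proof -
    have "norm x > 0" using that by (auto simp: R_def)
    moreover have "l / 2 \<le> norm (poly f x) / norm x ^ d" "norm (poly f x) / norm x ^ d \<le> 2 * l"
    proof -
      have "\<bar>norm (poly f x) / norm x ^ d - l\<bar> < l / 2"
        using b[of x] that by (simp add: R_def dist_real_def norm_divide norm_power)
      then show "l / 2 \<le> norm (poly f x) / norm x ^ d" "norm (poly f x) / norm x ^ d \<le> 2 * l"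
        using l unfolding abs_less_iff by linarith+
    qed
    ultimately show "l / 2 * norm x ^ d \<le> norm (poly f x)" "norm (poly f x) \<le> 2 * l * norm x ^ d"
      by (auto simp: field_simps)
  qed
  have "compact (poly f ` cball 0 R)" by (intro compact_continuous_image continuous_intros compact_cball)
  then have "bounded (poly f ` cball 0 R)" by (rule compact_imp_bounded)
  then obtain B where B: "\<And>z. norm z \<le> R \<Longrightarrow> norm (poly f z) \<le> B"
    unfolding bounded_iff by force
  \<comment> \<open>Outside radius \<open>R\<close> the two bounds for |f| differ by the factor 4;
    the quotient \<open>2 * B / l\<close> covers a point \<open>z\<close> inside; and M >= 1 permits
    replacing M by its d-th power before taking roots.\<close>
  define M where "M = max 1 (max (2 * B / l) 4)"
  have "norm w \<le> (M + R) * (1 + norm z)" if eq: "poly f z = poly f w" for z w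
  proof (cases "norm w \<ge> R")
    case False
    have "norm w \<le> (M + R) * 1" using False by (auto simp: M_def)
    also have "\<dots> \<le> (M + R) * (1 + norm z)" by (intro mult_left_mono) (auto simp: M_def R_def)
    finally show ?thesis .
  next
    case True
    have "l / 2 * norm w ^ d \<le> M * l / 2 * (1 + norm z) ^ d"
    proof (cases "norm z \<ge> R")
      case True
      have "l / 2 * norm w ^ d \<le> 2 * l * norm z ^ d" using lower[OF \<open>norm w \<ge> R\<close>] upper[OF True] eq by simp
      also have "\<dots> \<le> 2 * l * (1 + norm z) ^ d" using l by (intro mult_left_mono power_mono) auto
      also have "\<dots> \<le> M * l / 2 * (1 + norm z) ^ d" using l by (intro mult_right_mono) (auto simp: M_def)
      finally show ?thesis .
    next
      case False
      have "l / 2 * norm w ^ d \<le> B" using lower[OF \<open>norm w \<ge> R\<close>] B[of z] False eq by simp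
      also have "B = (2 * B / l) * l / 2" using l by simp
      also have "\<dots> \<le> M * l / 2" using l by (intro divide_right_mono mult_right_mono) (auto simp: M_def)
      also have "\<dots> = M * l / 2 * 1" by simp
      also have "\<dots> \<le> M * l / 2 * (1 + norm z) ^ d"
        using l by (intro mult_left_mono one_le_power) (auto simp: M_def)
      finally show ?thesis .
    qed
    then have "norm w ^ d \<le> M * (1 + norm z) ^ d" using l by (simp add: field_simps)
    also have "\<dots> \<le> M ^ d * (1 + norm z) ^ d"
      using assms by (intro mult_right_mono self_le_power) (auto simp: M_def d_def)
    also have "\<dots> = (M * (1 + norm z)) ^ d" by (simp add: power_mult_distrib)
    finally have "norm w \<le> M * (1 + norm z)"
      using assms by (subst (asm) power_mono_iff) (auto simp: M_def d_def)
    also have "\<dots> \<le> (M + R) * (1 + norm z)" by (intro mult_right_mono) (auto simp: R_def)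
    finally show ?thesis .
  qed
  moreover have "M + R \<ge> 1" by (auto simp: M_def R_def)
  ultimately show ?thesis by blast
qed

context regular_point begin

text \<open>The value at \<open>z\<close> is read off from any labelling that sends
  \<open>x0\<close> to \<open>z\<close>. Two such labellings differ by an element of
  \<open>G\<close> fixing \<open>x0\<close>, so equivariance makes this well defined; the result is
  holomorphic off a finite set and grows with order at most \<open>N\<close>. The degree bound is
  recorded because block polynomials must have an exact degree.\<close>

lemma equivariant_polynomial:
  fixes H :: "complex \<Rightarrow> (complex \<Rightarrow> complex) \<Rightarrow> complex"
  assumes x0: "x0 \<in> X" and trans: "\<And>x. x \<in> X \<Longrightarrow> \<exists>\<sigma>\<in>G. \<sigma> x0 = x"
    and hol: "\<And>U \<psi>. open U \<Longrightarrow> (\<And>x. x \<in> X \<Longrightarrow> \<psi> x holomorphic_on U) \<Longrightarrow> (\<lambda>t. H x0 (\<lambda>x. \<psi> x t)) holomorphic_on U"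
    and cong: "\<And>\<theta> \<theta>'. (\<And>x. x \<in> X \<Longrightarrow> \<theta> x = \<theta>' x) \<Longrightarrow> H x0 \<theta> = H x0 \<theta>'"
    and equiv: "\<And>\<sigma> \<theta>. \<sigma> \<in> G \<Longrightarrow> \<theta> \<in> labellings \<Longrightarrow> H x0 (\<lambda>x. \<theta> (\<sigma> x)) = H (\<sigma> x0) \<theta>"
    and bound: "\<And>\<theta> B. B \<ge> 1 \<Longrightarrow> (\<And>x. x \<in> X \<Longrightarrow> norm (\<theta> x) \<le> B) \<Longrightarrow> norm (H x0 \<theta>) \<le> D * B ^ N"
  obtains p where "degree p \<le> N" "\<And>\<theta> x. \<theta> \<in> labellings \<Longrightarrow> x \<in> X \<Longrightarrow> poly p (\<theta> x) = H x \<theta>"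
proof -
  define K where "K = {z. poly f z \<in> critical_values f}"
  have "finite K"
  proof -
    have "K = (\<Union>t\<in>critical_values f. fibre f t)" by (auto simp: K_def fibre_def)
    then show ?thesis using finite_critical_values finite_fibre degree_pos by simp
  qed
  have ex: "\<exists>\<theta>\<in>labellings. \<theta> x0 = z" if "z \<notin> K" for z
  proof -
    obtain \<theta> where \<theta>: "\<theta> \<in> labellings" "\<forall>x\<in>X. poly f (\<theta> x) = poly f z"
      using labelling_over[of "poly f z"] \<open>z \<notin> K\<close> by (auto simp: K_def)
    then have "z \<in> \<theta> ` X" using labelling_image(1)[OF \<theta>(1) x0] x0 by (simp add: fibre_def)
    then obtain x where x: "x \<in> X" "\<theta> x = z" by blast
    then obtain \<sigma> where \<sigma>: "\<sigma> \<in> G" "\<sigma> x0 = x" using trans by blast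
    then have "\<theta> \<circ> \<sigma> \<in> labellings" "(\<theta> \<circ> \<sigma>) x0 = z" using labelling_compose_G[OF \<theta>(1)] x by auto
    then show ?thesis by blast
  qed
  define \<Psi> where "\<Psi> z = H x0 (SOME \<theta>. \<theta> \<in> labellings \<and> \<theta> x0 = z)" for z
  have \<Psi>: "\<Psi> (\<theta> x0) = H x0 \<theta>" if \<theta>: "\<theta> \<in> labellings" for \<theta>
  proof -
    define \<theta>' where "\<theta>' = (SOME \<theta>'. \<theta>' \<in> labellings \<and> \<theta>' x0 = \<theta> x0)"
    have "\<theta>' \<in> labellings \<and> \<theta>' x0 = \<theta> x0" unfolding \<theta>'_def by (rule someI[of _ \<theta>]) (simp add: \<theta>)
    then have \<theta>': "\<theta>' \<in> labellings" "\<theta>' x0 = \<theta> x0" by auto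
    obtain \<sigma> where \<sigma>: "\<sigma> \<in> G" "\<forall>y\<in>X. \<theta>' y = \<theta> (\<sigma> y)"
      using labelling_change[OF \<theta> \<theta>'(1) x0] \<theta>'(2) by auto
    then have "\<theta> (\<sigma> x0) = \<theta> x0" using \<theta>'(2) x0 by simp
    moreover have "\<sigma> x0 \<in> X" using G_permutes[OF \<sigma>(1)] x0 permutes_in_image by metis
    ultimately have "\<sigma> x0 = x0" using labelling_inj[OF \<theta>] x0 by (auto simp: inj_on_def)
    have "\<Psi> (\<theta> x0) = H x0 \<theta>'" by (simp add: \<Psi>_def \<theta>'_def)
    also have "\<dots> = H x0 (\<lambda>y. \<theta> (\<sigma> y))" using \<sigma> by (intro cong) auto
    also have "\<dots> = H x0 \<theta>" using equiv[OF \<sigma>(1) \<theta>] \<open>\<sigma> x0 = x0\<close> by simp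
    finally show ?thesis .
  qed
  have "\<Psi> holomorphic_on (- K)"
    unfolding holomorphic_on_def
  proof
    fix z assume z: "z \<in> - K"
    then have regz: "poly f z \<notin> critical_values f" by (auto simp: K_def)
    obtain r where r: "r > 0" "ball (poly f z) r \<subseteq> - critical_values f"
      "\<And>\<theta> x. \<theta> \<in> labellings \<Longrightarrow> x \<in> X \<Longrightarrow> poly f (\<theta> x) \<in> ball (poly f z) r \<Longrightarrow>
        \<exists>\<psi>. (\<forall>y\<in>X. section_on f (ball (poly f z) r) (\<psi> y) \<and> \<psi> y (poly f (\<theta> x)) = \<theta> y)"
      using local_labellings[OF regz] by metis
    obtain \<theta> where \<theta>: "\<theta> \<in> labellings" "\<theta> x0 = z" using ex z by blast
    obtain \<psi> where \<psi>: "\<And>y. y \<in> X \<Longrightarrow> section_on f (ball (poly f z) r) (\<psi> y)"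
        "\<And>y. y \<in> X \<Longrightarrow> \<psi> y (poly f z) = \<theta> y"
      using r(3)[OF \<theta>(1) x0] r(1) \<theta>(2) by auto
    define L where "L = (\<lambda>t. H x0 (\<lambda>y. \<psi> y t))"
    have L: "L holomorphic_on ball (poly f z) r"
      unfolding L_def using \<psi>(1) by (intro hol) (auto simp: section_on_def)
    have mv: "(\<lambda>y. \<psi> y t) \<in> labellings" if "t \<in> ball (poly f z) r" for t
      by (rule labelling_move[OF \<theta>(1) r(2) \<psi>(1) _ _ that, of _ "poly f z"]) (use r(1) \<psi>(2) in auto)
    obtain s where s: "s > 0" "inj_on (poly f) (ball z s)"
      using regular_locally_injective[OF regz] by blast
    have "isCont (poly f) z" by (rule poly_isCont)
    then have near: "\<forall>\<^sub>F w in nhds z. poly f w \<in> ball (poly f z) r"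
      using r(1) by (intro eventually_isCont_mem) auto
    have "isCont (\<psi> x0) (poly f z)"
      using \<psi>(1)[OF x0] r(1) by (auto simp: section_on_def continuous_on_eq_continuous_at dest!: holomorphic_on_imp_continuous_on)
    then have "isCont (\<lambda>w. \<psi> x0 (poly f w)) z" by (intro isCont_o2[OF poly_isCont]) 
    moreover have "\<psi> x0 (poly f z) = z" using \<psi>(2) \<theta> x0 by simp
    ultimately have "\<forall>\<^sub>F w in nhds z. \<psi> x0 (poly f w) \<in> ball z s"
      using s(1) by (intro eventually_isCont_mem) auto
    moreover have "\<forall>\<^sub>F w in nhds z. w \<in> ball z s" using s(1) by (intro eventually_nhds_in_open) auto
    ultimately have ev: "\<forall>\<^sub>F w in nhds z. L (poly f w) = \<Psi> w"
      using near
    proof eventually_elim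
      case (elim w)
      have "poly f (\<psi> x0 (poly f w)) = poly f w" using section_onD[OF \<psi>(1)[OF x0] elim(3)] .
      then have "\<psi> x0 (poly f w) = w" using s(2) elim(1,2) by (auto simp: inj_on_def)
      then show ?case using \<Psi>[OF mv[OF elim(3)]] by (simp add: L_def)
    qed
    have "L field_differentiable at (poly f z)"
      using L r(1) by (intro holomorphic_on_imp_differentiable_at[of _ "ball (poly f z) r"]) auto
    then have "(L \<circ> poly f) field_differentiable at z"
      by (intro field_differentiable_compose) (auto simp: field_differentiable_def intro: poly_DERIV)
    then obtain D where "(L \<circ> poly f has_field_derivative D) (at z)" by (auto simp: field_differentiable_def)
    then have "(\<Psi> has_field_derivative D) (at z)"
      using ev by (subst (asm) DERIV_cong_ev[OF refl _ refl, of _ \<Psi>]) auto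
    then have "\<Psi> field_differentiable at z" by (auto simp: field_differentiable_def)
    then show "\<Psi> field_differentiable at z within - K" by (rule field_differentiable_at_within)
  qed
  moreover obtain C where C: "C \<ge> 1" "\<And>z w. poly f z = poly f w \<Longrightarrow> norm w \<le> C * (1 + norm z)"
    using fibre_growth[OF degree_pos] by blast
  have "norm (\<Psi> z) \<le> (D * C ^ N) * (1 + norm z) ^ N" if "z \<notin> K" for z
  proof -
    obtain \<theta> where \<theta>: "\<theta> \<in> labellings" "\<theta> x0 = z" using ex \<open>z \<notin> K\<close> by blast
    have "norm (\<theta> x) \<le> C * (1 + norm z)" if "x \<in> X" for x
      using C(2)[of z "\<theta> x"] labelling_same_fibre[OF \<theta>(1) x0 that] \<theta>(2) by simp
    moreover have "1 * 1 \<le> C * (1 + norm z)" using C(1) by (intro mult_mono) auto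
    ultimately have "norm (H x0 \<theta>) \<le> D * (C * (1 + norm z)) ^ N" by (intro bound) auto
    then show ?thesis using \<Psi>[OF \<theta>(1)] \<theta>(2) by (simp add: power_mult_distrib mult.assoc)
  qed
  ultimately obtain p where p: "degree p \<le> N" "\<And>z. z \<notin> K \<Longrightarrow> \<Psi> z = poly p z"
    using polynomial_growth_imp_poly[OF \<open>finite K\<close>, of \<Psi> "D * C ^ N" N] by blast
  have "poly p (\<theta> x) = H x \<theta>" if \<theta>: "\<theta> \<in> labellings" "x \<in> X" for \<theta> x
  proof -
    obtain \<sigma> where \<sigma>: "\<sigma> \<in> G" "\<sigma> x0 = x" using trans \<theta> by blast
    have lab: "(\<lambda>y. \<theta> (\<sigma> y)) \<in> labellings" using labelling_compose_G[OF \<theta>(1) \<sigma>(1)] by (simp add: comp_def)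
    have "\<theta> x \<notin> K" using labelling_image(2)[OF \<theta>] by (simp add: K_def)
    then have "poly p (\<theta> x) = \<Psi> (\<theta> x)" using p by simp
    also have "\<dots> = H x0 (\<lambda>y. \<theta> (\<sigma> y))" using \<Psi>[OF lab] \<sigma> by simp
    also have "\<dots> = H x \<theta>" using equiv[OF \<sigma>(1) \<theta>(1)] \<sigma> by simp
    finally show ?thesis .
  qed
  then show thesis using that p(1) by blast
qed

end

section \<open>Kernels invariant under the monodromy group\<close>

lemma gcd_invariant:
  fixes c :: "int \<Rightarrow> 'a"
  assumes "m > 0" "periodic m c" "\<And>u x. coprime u m \<Longrightarrow> c (u * x) = c x"
  shows "c x = c (gcd x m)"
proof -
  obtain u where u: "coprime u m" "m dvd u * x - gcd x m" using gcd_unit_multiple assms(1) by blast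
  then have "c (u * x) = c (gcd x m)" by (intro periodicD[OF assms(2)])
  then show ?thesis using assms(3)[OF u(1)] by simp
qed

lemma gcd_coprime_mult: "coprime u m \<Longrightarrow> gcd (u * x) m = gcd x (m :: int)"
  using gcd_mult_left_left_cancel[of m u x] by (metis coprime_commute)

locale cyclic_point = regular_point +
  fixes ps :: "complex list"
  assumes ps: "distinct ps" "set ps = X" "cycle_of_list ps \<in> G"
begin

definition m :: int where "m = int (degree f)"
definition pt :: "int \<Rightarrow> complex" where "pt i = ps ! nat (i mod m)"
definition ix :: "complex \<Rightarrow> int" where "ix y = (SOME i. i \<in> {0..<m} \<and> pt i = y)"
text \<open>The character of frequency \<open>k\<close> on the residues modulo \<open>m\<close>,
  read through the numbering of the roots.\<close>

definition e :: "int \<Rightarrow> complex \<Rightarrow> complex" where "e k y = ru m (k * ix y)"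
definition rot :: "complex \<Rightarrow> complex" where "rot = cycle_of_list ps"

lemma m_pos: "m > 0" using degree_pos by (simp add: m_def)

lemma length_ps: "int (length ps) = m"
  using distinct_card[OF ps(1)] ps(2) card_X by (simp add: m_def)

lemma pt_bij: "bij_betw pt {0..<m} X"
proof -
  have "bij_betw nat {0..<m} {..<length ps}"
    by (rule bij_betw_byWitness[of _ int]) (use length_ps in auto)
  moreover have "bij_betw ((!) ps) {..<length ps} X"
    using bij_betw_nth[OF ps(1) refl] ps(2) by simp
  ultimately have "bij_betw ((!) ps \<circ> nat) {0..<m} X" by (rule bij_betw_trans)
  then show ?thesis by (rule bij_betw_cong[THEN iffD1, rotated]) (auto simp: pt_def)
qed

lemma ix: assumes "y \<in> X" shows "ix y \<in> {0..<m}" "pt (ix y) = y"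
proof -
  have "\<exists>i. i \<in> {0..<m} \<and> pt i = y" using pt_bij assms by (metis bij_betw_imp_surj_on imageE)
  from someI_ex[OF this] show "ix y \<in> {0..<m}" "pt (ix y) = y" by (auto simp: ix_def)
qed

lemma pt_in_X: "pt i \<in> X"
proof -
  have "pt i = pt (i mod m)" by (simp add: pt_def)
  then show ?thesis using pt_bij m_pos by (auto simp: bij_betw_def)
qed

lemma ix_pt: "m dvd ix (pt i) - i"
proof -
  have "pt (ix (pt i)) = pt (i mod m)" using ix(2)[OF pt_in_X] by (simp add: pt_def)
  then have "ix (pt i) = i mod m"
    using pt_bij ix(1)[OF pt_in_X, of i] m_pos by (auto simp: bij_betw_def inj_on_def)
  then show ?thesis by (metis dvd_minus_mod dvd_diff_commute)
qed

lemma ix_inj: "y \<in> X \<Longrightarrow> z \<in> X \<Longrightarrow> m dvd ix y - ix z \<Longrightarrow> y = z"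
  using ix by (metis atLeastLessThan_iff mod_eq_dvd_iff mod_pos_pos_trivial)

lemma sum_X: "(\<Sum>y\<in>X. F (ix y)) = (\<Sum>i\<in>{0..<m}. F i)"
proof -
  have "bij_betw ix X {0..<m}"
    by (rule bij_betw_byWitness[of _ pt])
      (use ix pt_in_X in auto, metis atLeastLessThan_iff ix_pt mod_eq_dvd_iff mod_pos_pos_trivial ix(1))
  then show ?thesis by (rule sum.reindex_bij_betw)
qed

lemma rot_G: "rot \<in> G" using ps(3) by (simp add: rot_def)

lemma rot_pt: "rot (pt i) = pt (i + 1)"
proof -
  have rm: "pt (i mod m) = pt i" "pt (i + 1) = pt ((i mod m + 1) mod m)" by (simp_all add: pt_def mod_add_left_eq)
  have "map rot ps = rotate1 ps" using cyclic_rotation[OF ps(1), of 1] by (simp add: rot_def)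
  define j where "j = nat (i mod m)"
  have j: "j < length ps" "int j = i mod m" using m_pos length_ps by (auto simp: j_def nat_less_iff)
  have "rot (pt i) = map rot ps ! j" using j by (simp add: pt_def j_def)
  also have "\<dots> = ps ! (Suc j mod length ps)" using \<open>map rot ps = rotate1 ps\<close> j by (simp add: nth_rotate1)
  also have "int (Suc j mod length ps) = (i + 1) mod m"
    using j(2) length_ps by (simp add: zmod_int mod_simps add.commute)
  then have "Suc j mod length ps = nat ((i + 1) mod m)" by linarith
  finally show ?thesis by (simp add: pt_def)
qed

lemma G_funpow: "(rot ^^ j) \<in> G"
proof (induction j)
  case 0
  show ?case using id_labelling by (simp add: G_def labellings_def permutes_id[unfolded id_def] id_def)
next
  case (Suc j)
  then show ?case using G_compose[OF rot_G Suc] by (simp only: funpow.simps)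
qed

lemma rot_funpow: "(rot ^^ j) (pt i) = pt (i + int j)"
  by (induction j) (auto simp: rot_pt algebra_simps)

lemma ix_rot_funpow: "y \<in> X \<Longrightarrow> m dvd ix ((rot ^^ j) y) - (ix y + int j)"
  using rot_funpow[of j "ix y"] ix_pt[of "ix y + int j"] ix(2) by simp

lemma G_transitive: assumes "x \<in> X" "y \<in> X" shows "\<exists>\<sigma>\<in>G. \<sigma> x = y"
proof -
  define j where "j = nat ((ix y - ix x) mod m)"
  have "pt (ix x + int j) = pt (ix y)"
    using m_pos by (simp add: j_def pt_def mod_add_right_eq)
  then have "(rot ^^ j) x = y" using rot_funpow[of j "ix x"] ix(2) assms by simp
  then show ?thesis using G_funpow by blast
qed

lemma G_in_X: "\<sigma> \<in> G \<Longrightarrow> x \<in> X \<Longrightarrow> \<sigma> x \<in> X"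
  using G_permutes permutes_in_image by metis

lemma sum_G: "\<sigma> \<in> G \<Longrightarrow> (\<Sum>y\<in>X. F (\<sigma> y)) = (\<Sum>y\<in>X. F y)"
  using sum.permute[OF G_permutes, of \<sigma> F] by (simp add: comp_def)

lemma G_inv_apply: "\<sigma> \<in> G \<Longrightarrow> \<sigma> (inv \<sigma> y) = y" "\<sigma> \<in> G \<Longrightarrow> inv \<sigma> (\<sigma> y) = y"
  using permutes_inverses[OF G_permutes] by auto

lemma e_periodic: "m dvd k - l \<Longrightarrow> e k y = e l y"
  unfolding e_def by (rule ru_cong[OF m_pos]) (simp flip: left_diff_distrib)

lemma e_add: "e (k + l) y = e k y * e l y" by (simp add: e_def ru_add distrib_right)

lemma e_rot: assumes "y \<in> X" shows "e k ((rot ^^ j) y) = ru m (k * int j) * e k y"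
proof -
  have "m dvd k * ix ((rot ^^ j) y) - k * (ix y + int j)"
    using ix_rot_funpow[OF assms] by (simp flip: right_diff_distrib)
  then have "e k ((rot ^^ j) y) = ru m (k * (ix y + int j))" unfolding e_def by (rule ru_cong[OF m_pos])
  then show ?thesis by (simp add: e_def distrib_left ru_add)
qed

lemma e_orthogonal: "(\<Sum>y\<in>X. e k y * e (- l) y) = (if m dvd k - l then of_int m else 0)"
proof -
  have "(\<Sum>y\<in>X. e k y * e (- l) y) = (\<Sum>y\<in>X. ru m (ix y * (k - l)))"
    by (intro sum.cong refl) (simp add: e_def algebra_simps flip: ru_add)
  also have "\<dots> = (\<Sum>i\<in>{0..<m}. ru m (i * (k - l)))" by (rule sum_X)
  finally show ?thesis using sum_ru[OF m_pos] by simp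
qed

lemma e_complete:
  assumes "y \<in> X" "z \<in> X"
  shows "(\<Sum>k\<in>{0..<m}. e k y * e (- k) z) = (if y = z then of_int m else 0)"
proof -
  have "(\<Sum>k\<in>{0..<m}. e k y * e (- k) z) = (\<Sum>k\<in>{0..<m}. ru m (k * (ix y - ix z)))"
    by (intro sum.cong refl) (simp add: e_def algebra_simps flip: ru_add)
  then show ?thesis using sum_ru[OF m_pos, of "ix y - ix z"] ix_inj assms by auto
qed

lemma e_inversion:
  assumes "y \<in> X"
  shows "(\<Sum>k\<in>{0..<m}. (\<Sum>z\<in>X. F z * e k z) * e (- k) y) = of_int m * F y"
proof -
  have "(\<Sum>k\<in>{0..<m}. (\<Sum>z\<in>X. F z * e k z) * e (- k) y) = (\<Sum>z\<in>X. F z * (\<Sum>k\<in>{0..<m}. e k z * e (- k) y))"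
    unfolding sum_distrib_right sum_distrib_left by (subst sum.swap) (simp add: mult.assoc)
  also have "\<dots> = (\<Sum>z\<in>X. if z = y then of_int m * F y else 0)"
    by (intro sum.cong refl) (auto simp: e_complete assms)
  finally show ?thesis using assms by simp
qed

lemma e_parseval:
  "of_int m * (\<Sum>z\<in>X. F z * H z) = (\<Sum>k\<in>{0..<m}. (\<Sum>z\<in>X. F z * e k z) * (\<Sum>z\<in>X. H z * e (- k) z))"
proof -
  define E where "E k = (\<Sum>z\<in>X. F z * e k z)" for k
  have "(\<Sum>k\<in>{0..<m}. E k * (\<Sum>z\<in>X. H z * e (- k) z)) = (\<Sum>z\<in>X. H z * (\<Sum>k\<in>{0..<m}. E k * e (- k) z))"
    unfolding sum_distrib_left by (subst sum.swap) (simp add: mult_ac)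
  then have "(\<Sum>k\<in>{0..<m}. (\<Sum>z\<in>X. F z * e k z) * (\<Sum>z\<in>X. H z * e (- k) z)) =
      (\<Sum>z\<in>X. H z * (\<Sum>k\<in>{0..<m}. (\<Sum>w\<in>X. F w * e k w) * e (- k) z))"
    unfolding E_def .
  also have "\<dots> = (\<Sum>z\<in>X. H z * (of_int m * F z))"
    by (intro sum.cong refl) (simp only: e_inversion)
  also have "\<dots> = of_int m * (\<Sum>z\<in>X. F z * H z)"
    by (simp add: sum_distrib_left mult_ac)
  finally show ?thesis ..
qed

text \<open>The matrix of the Fourier multiplier \<open>a\<close>. Matrix products correspond to pointwise products of
  multipliers and entrywise products to convolutions, so the multipliers with invariant matrix form
  a Schur ring.\<close>

definition K :: "(int \<Rightarrow> complex) \<Rightarrow> complex \<Rightarrow> complex \<Rightarrow> complex" where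
  "K a y z = (\<Sum>k\<in>{0..<m}. a k * (e k y * e (- k) z))"

definition invariant :: "(complex \<Rightarrow> complex \<Rightarrow> complex) \<Rightarrow> bool" where
  "invariant M \<longleftrightarrow> (\<forall>\<sigma>\<in>G. \<forall>y\<in>X. \<forall>z\<in>X. M (\<sigma> y) (\<sigma> z) = M y z)"

definition A :: "(int \<Rightarrow> complex) set" where
  "A = {a. (\<forall>k. a k = a (gcd k m)) \<and> invariant (K a)}"

lemma K_mult:
  "(\<Sum>w\<in>X. K a y w * K b w z) = of_int m * K (\<lambda>k. a k * b k) y z"
proof -
  have "(\<Sum>w\<in>X. K a y w * K b w z) =
    (\<Sum>w\<in>X. \<Sum>k\<in>{0..<m}. \<Sum>l\<in>{0..<m}. a k * b l * e k y * e (- l) z * (e l w * e (- k) w))"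
    unfolding K_def sum_product by (intro sum.cong refl) (simp add: mult_ac)
  also have "\<dots> = (\<Sum>k\<in>{0..<m}. \<Sum>l\<in>{0..<m}. a k * b l * e k y * e (- l) z * (\<Sum>w\<in>X. e l w * e (- k) w))"
    unfolding sum_distrib_left by (subst sum.swap, intro sum.cong refl, subst sum.swap, rule refl)
  also have "\<dots> = (\<Sum>k\<in>{0..<m}. \<Sum>l\<in>{0..<m}. if l = k then of_int m * (a k * b k * (e k y * e (- k) z)) else 0)"
  proof (intro sum.cong refl)
    fix k l assume kl: "k \<in> {0..<m}" "l \<in> {0..<m}"
    then have "m dvd l - k \<longleftrightarrow> l = k" by (metis atLeastLessThan_iff dvd_0_right mod_eq_dvd_iff mod_pos_pos_trivial)
    then show "a k * b l * e k y * e (- l) z * (\<Sum>w\<in>X. e l w * e (- k) w) =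
        (if l = k then of_int m * (a k * b k * (e k y * e (- k) z)) else 0)"
      by (auto simp: e_orthogonal)
  qed
  also have "\<dots> = of_int m * K (\<lambda>k. a k * b k) y z"
    by (simp add: K_def sum_distrib_left)
  finally show ?thesis .
qed

lemma K_conv:
  assumes "periodic m b"
  shows "K (\<lambda>k. \<Sum>i\<in>{0..<m}. a i * b (k - i)) y z = K a y z * K b y z"
proof -
  have "K a y z * K b y z = (\<Sum>i\<in>{0..<m}. \<Sum>l\<in>{0..<m}. a i * b l * (e (l + i) y * e (- (l + i)) z))"
    unfolding K_def sum_product
  proof (intro sum.cong refl)
    fix i l
    have "e (- (l + i)) z = e (- l) z * e (- i) z" using e_add[of "-l" "-i" z] by simp
    then show "a i * (e i y * e (- i) z) * (b l * (e l y * e (- l) z)) =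
        a i * b l * (e (l + i) y * e (- (l + i)) z)" by (simp add: e_add mult_ac)
  qed
  also have "\<dots> = (\<Sum>i\<in>{0..<m}. \<Sum>k\<in>{0..<m}. a i * b (k - i) * (e k y * e (- k) z))"
  proof (rule sum.cong[OF refl])
    fix i
    have "periodic m (\<lambda>l. a i * b l * (e (l + i) y * e (- (l + i)) z))"
      unfolding periodic_def
    proof (intro allI impI)
      fix k l assume kl: "m dvd k - l"
      have "m dvd (k + i) - (l + i)" "m dvd - (k + i) - (- (l + i))"
        using kl by (auto simp: dvd_diff_commute)
      then show "a i * b k * (e (k + i) y * e (- (k + i)) z) = a i * b l * (e (l + i) y * e (- (l + i)) z)"
        using periodicD[OF assms kl] e_periodic by metis
    qed
    from sum_mod_shift(1)[OF m_pos this, of "-i"]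
    show "(\<Sum>l\<in>{0..<m}. a i * b l * (e (l + i) y * e (- (l + i)) z)) =
        (\<Sum>k\<in>{0..<m}. a i * b (k - i) * (e k y * e (- k) z))" by simp
  qed
  also have "\<dots> = K (\<lambda>k. \<Sum>i\<in>{0..<m}. a i * b (k - i)) y z"
    unfolding K_def sum_distrib_right by (subst sum.swap) (simp add: mult.assoc)
  finally show ?thesis ..
qed

lemma A_periodic': "a \<in> A \<Longrightarrow> periodic m a"
  unfolding A_def periodic_def using gcd_cong_int by (metis (mono_tags, lifting) mem_Collect_eq)

lemma invariantD: "invariant M \<Longrightarrow> \<sigma> \<in> G \<Longrightarrow> y \<in> X \<Longrightarrow> z \<in> X \<Longrightarrow> M (\<sigma> y) (\<sigma> z) = M y z"
  by (simp add: invariant_def)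

lemma K_const: "y \<in> X \<Longrightarrow> z \<in> X \<Longrightarrow> K (\<lambda>_. c) y z = (if y = z then c * of_int m else 0)"
  using e_complete by (simp add: K_def flip: sum_distrib_left)

lemma G_inj: "\<sigma> \<in> G \<Longrightarrow> \<sigma> y = \<sigma> z \<longleftrightarrow> y = z"
  using permutes_inj[OF G_permutes] by (simp add: inj_eq)

sublocale rational_schur_ring m A
proof unfold_locales
  show "m > 0" by (rule m_pos)
  show "a k = a (gcd k m)" if "a \<in> A" for a k using that by (auto simp: A_def)
  show "(\<lambda>_. c) \<in> A" for c
    by (auto simp: A_def invariant_def K_const G_in_X G_inj)
  fix a b assume a: "a \<in> A" and b: "b \<in> A"
  have ag: "a k = a (gcd k m)" "b k = b (gcd k m)" for k using a b by (auto simp: A_def)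
  have inv: "invariant (K a)" "invariant (K b)" using a b by (auto simp: A_def)
  have "K (\<lambda>x. a x + b x) y z = K a y z + K b y z" for y z
    by (simp add: K_def ring_distribs sum.distrib)
  then show "(\<lambda>x. a x + b x) \<in> A" using ag inv by (auto simp: A_def invariant_def)
  have "K (\<lambda>x. a x * b x) (\<sigma> y) (\<sigma> z) = K (\<lambda>x. a x * b x) y z"
    if "\<sigma> \<in> G" "y \<in> X" "z \<in> X" for \<sigma> y z
  proof -
    have "of_int m * K (\<lambda>x. a x * b x) (\<sigma> y) (\<sigma> z) = (\<Sum>w\<in>X. K a (\<sigma> y) w * K b w (\<sigma> z))"
      by (rule K_mult[symmetric])
    also have "\<dots> = (\<Sum>w\<in>X. K a (\<sigma> y) (\<sigma> w) * K b (\<sigma> w) (\<sigma> z))"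
      using sum_G[OF that(1), of "\<lambda>w. K a (\<sigma> y) w * K b w (\<sigma> z)"] by simp
    also have "\<dots> = (\<Sum>w\<in>X. K a y w * K b w z)"
      using that inv by (intro sum.cong) (auto simp: invariantD)
    also have "\<dots> = of_int m * K (\<lambda>x. a x * b x) y z" by (rule K_mult)
    finally show ?thesis using m_pos by simp
  qed
  moreover have "a k * b k = a (gcd k m) * b (gcd k m)" for k using ag[of k] by simp
  ultimately show "(\<lambda>x. a x * b x) \<in> A" by (auto simp: A_def invariant_def)
  define c where "c k = (\<Sum>i\<in>{0..<m}. a i * b (k - i))" for k
  have "c k = c (gcd k m)" for k
  proof (rule gcd_invariant[OF m_pos])
    have bper: "b (k - i) = b (l - i)" if "m dvd k - l" for k l i
      using periodicD[OF A_periodic'[OF b], of "k - i" "l - i"] that by simp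
    then show "periodic m c" unfolding periodic_def c_def by simp
    fix u k assume u: "coprime u m"
    have "periodic m (\<lambda>i. a i * b (u * k - i))"
      unfolding periodic_def
    proof (intro allI impI)
      fix i j assume ij: "m dvd i - j"
      then have "m dvd (u * k - i) - (u * k - j)" by (simp add: dvd_diff_commute)
      then show "a i * b (u * k - i) = a j * b (u * k - j)"
        using periodicD[OF A_periodic'[OF b]] periodicD[OF A_periodic'[OF a] ij] by metis
    qed
    moreover have "i = j" if "i \<in> {0..<m}" "j \<in> {0..<m}" "m dvd u * i - u * j" for i j
    proof -
      have "m dvd i - j" using that(3) u
        by (metis coprime_commute coprime_dvd_mult_right_iff right_diff_distrib')
      then show ?thesis using that(1,2) by (metis atLeastLessThan_iff mod_eq_dvd_iff mod_pos_pos_trivial)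
    qed
    \<comment> \<open>Multiplying the summation index by the unit \<open>u\<close> permutes the
      residues, and both factors are invariant under units, so the convolution is as well.\<close>
    ultimately have "c (u * k) = (\<Sum>i\<in>{0..<m}. a (u * i) * b (u * k - u * i))"
      unfolding c_def by (rule sum_mod_reindex[OF m_pos, symmetric])
    also have "\<dots> = c k" unfolding c_def
    proof (intro sum.cong refl)
      fix i
      have "a (u * i) = a i" "b (u * (k - i)) = b (k - i)"
        using ag(1)[of "u * i"] ag(1)[of i] ag(2)[of "u * (k - i)"] ag(2)[of "k - i"]
          gcd_coprime_mult[OF u] by simp_all
      moreover have "u * (k - i) = u * k - u * i" by (rule right_diff_distrib)
      ultimately show "a (u * i) * b (u * k - u * i) = a i * b (k - i)" by simp
    qed
    finally show "c (u * k) = c k" .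
  qed
  moreover have "invariant (K c)"
    unfolding c_def using inv by (auto simp: invariant_def K_conv[OF A_periodic'[OF b]])
  ultimately show "(\<lambda>k. \<Sum>i\<in>{0..<m}. a i * b (k - i)) \<in> A"
    unfolding A_def c_def by blast
next
  have "K (\<lambda>k. of_bool (m dvd k)) y z = 1" for y z
  proof -
    have "K (\<lambda>k. of_bool (m dvd k)) y z = (\<Sum>k\<in>{0..<m}. if k = 0 then 1 else 0)"
      unfolding K_def
    proof (intro sum.cong refl)
      fix k assume "k \<in> {0..<m}"
      then have "m dvd k \<longleftrightarrow> k = 0" using zdvd_not_zless[of k m] by (cases "k = 0") auto
      then show "of_bool (m dvd k) * (e k y * e (- k) z) = (if k = 0 then 1 else 0)" by (simp add: e_def)
    qed
    then show ?thesis using m_pos by simp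
  qed
  moreover have "m dvd gcd k m \<longleftrightarrow> m dvd k" for k by simp
  ultimately show "(\<lambda>k. of_bool (m dvd k)) \<in> A" by (simp add: A_def invariant_def)
qed

end

context cyclic_point begin

section \<open>The spectrum of a cycle\<close>

text \<open>The frequencies occurring in the span of the images of \<open>n\<close> under the monodromy group.\<close>

definition spectrum :: "(complex \<Rightarrow> int) \<Rightarrow> int set" where
  "spectrum n = {k. \<exists>\<sigma>\<in>G. (\<Sum>y\<in>X. of_int (n (\<sigma> y)) * e k y) \<noteq> 0}"

text \<open>Integrality of \<open>n\<close> enters here: for each \<open>\<sigma>\<close> the sums
  in question are values of one integer polynomial at roots of unity, so their zeros are stable
  under unit multiples, and the orbits of the units are the gcd classes.\<close>

lemma spectrum_gcd: "k \<in> spectrum n \<longleftrightarrow> gcd k m \<in> spectrum n"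
proof -
  have unit: "u * k \<notin> spectrum n" if u: "coprime u m" and k: "k \<notin> spectrum n" for u k
  proof -
    define v where "v = nat (u mod m)"
    have v: "int v = u mod m" using m_pos by (simp add: v_def)
    have "gcd (int v) m = gcd u m" unfolding v by (simp add: gcd.commute gcd_red_int[symmetric])
    then have cv: "coprime (int v) m" using u by (simp add: coprime_iff_gcd_eq_1)
    have "(\<Sum>y\<in>X. of_int (n (\<sigma> y)) * e (u * k) y) = 0" if \<sigma>: "\<sigma> \<in> G" for \<sigma>
    proof -
      define P :: "int poly" where "P = (\<Sum>y\<in>X. monom (n (\<sigma> y)) (nat (ix y)))"
      have P: "ipoly P (ru m l) = (\<Sum>y\<in>X. of_int (n (\<sigma> y)) * e l y)" for l
        unfolding P_def ipoly_sum ipoly_monom ru_power e_def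
        using ix by (intro sum.cong) (auto simp: mult.commute)
      have "ipoly P (ru m k) = 0" using k \<sigma> by (simp add: P spectrum_def)
      then have "ipoly P (ru m (int v * k)) = 0" by (rule ipoly_ru_coprime_zero[OF m_pos cv])
      moreover have "m dvd u * k - int v * k"
        unfolding v by (metis dvd_minus_mod dvd_mult2 left_diff_distrib')
      then have "e (u * k) y = e (int v * k) y" for y by (rule e_periodic)
      ultimately show ?thesis by (simp add: P)
    qed
    then show ?thesis by (simp add: spectrum_def)
  qed
  have per: "periodic m (\<lambda>k. k \<in> spectrum n)"
    unfolding periodic_def spectrum_def using e_periodic by auto
  have "(u * k \<in> spectrum n) = (k \<in> spectrum n)" if u: "coprime u m" for u k
  proof -
    obtain v where v: "m dvd u * v - 1" "coprime v m"
    proof -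
      obtain v w where "v * u + w * m = 1" using bezout_int[of u m] u by (metis coprime_iff_gcd_eq_1)
      then have "coprime v m" "u * v - 1 = m * (- w)"
        by (metis coprimeI dvd_add dvd_mult2 dvd_mult, simp add: algebra_simps)
      then show ?thesis using that by (metis dvd_triv_left)
    qed
    have "m dvd (u * v - 1) * k" using v(1) by (rule dvd_mult2)
    then have "m dvd v * (u * k) - k" by (simp add: algebra_simps)
    then have "v * (u * k) \<in> spectrum n \<longleftrightarrow> k \<in> spectrum n" using periodicD[OF per] by blast
    then show ?thesis using unit[OF u, of k] unit[OF v(2), of "u * k"] by blast
  qed
  then show ?thesis using gcd_invariant[OF m_pos per] by blast
qed

lemma spectrum_uminus: "- k \<in> spectrum n \<longleftrightarrow> k \<in> spectrum n"
  using spectrum_gcd[of k] spectrum_gcd[of "-k"] by simp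

text \<open>Summing the rotations of \<open>n \<circ> \<sigma>\<close> against a character isolates
  its component along \<open>e k\<close>. The factor \<open>N\<close> is the pairing with
  \<open>e (- k)\<close>, which can be made nonzero because the spectrum is symmetric.\<close>

lemma character_in_span:
  assumes "k \<in> spectrum n"
  obtains \<pi> c where "\<And>j. \<pi> j \<in> G" "\<And>y. y \<in> X \<Longrightarrow> e k y = (\<Sum>j\<in>{0..<m}. c j * of_int (n (\<pi> j y)))"
proof -
  obtain \<sigma> where \<sigma>: "\<sigma> \<in> G" "(\<Sum>y\<in>X. of_int (n (\<sigma> y)) * e (- k) y) \<noteq> 0"
    using assms spectrum_uminus[of k n] by (auto simp: spectrum_def)
  define N where "N = (\<Sum>y\<in>X. of_int (n (\<sigma> y)) * e (- k) y)"
  define \<pi> where "\<pi> j = \<sigma> \<circ> (rot ^^ nat j)" for j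
  have "N * e k y = (\<Sum>j\<in>{0..<m}. ru m (- k * j) * of_int (n (\<pi> j y)))" if y: "y \<in> X" for y
  proof -
    define F where "F i = of_int (n (\<sigma> (pt i))) * ru m (- k * i)" for i
    have per: "periodic m F"
      unfolding periodic_def
    proof (intro allI impI)
      fix a b assume ab: "m dvd a - b"
      then have "m dvd - k * a - - k * b" by (metis dvd_mult right_diff_distrib')
      moreover have "a mod m = b mod m" using ab by (simp add: mod_eq_dvd_iff)
      ultimately show "F a = F b" using ru_cong[OF m_pos] by (metis F_def pt_def)
    qed
    have "N = (\<Sum>y\<in>X. F (ix y))" unfolding N_def F_def e_def by (intro sum.cong) (auto simp: ix)
    also have "\<dots> = (\<Sum>j\<in>{0..<m}. F j)" by (rule sum_X)
    also have "\<dots> = (\<Sum>j\<in>{0..<m}. F (j + ix y))" by (rule sum_mod_shift(1)[OF m_pos per, symmetric])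
    finally have "N * e k y = (\<Sum>j\<in>{0..<m}. F (j + ix y) * e k y)" by (simp add: sum_distrib_right)
    also have "\<dots> = (\<Sum>j\<in>{0..<m}. ru m (- k * j) * of_int (n (\<pi> j y)))"
    proof (intro sum.cong refl)
      fix j assume j: "j \<in> {0..<m}"
      then have "\<pi> j y = \<sigma> (pt (j + ix y))"
        using rot_funpow[of "nat j" "ix y"] ix(2)[OF y] by (simp add: \<pi>_def add.commute)
      moreover have "ru m (- k * (j + ix y)) * e k y = ru m (- k * j)"
        by (simp add: e_def flip: ru_add) (simp add: algebra_simps)
      ultimately show "F (j + ix y) * e k y = ru m (- k * j) * of_int (n (\<pi> j y))"
        by (simp add: F_def mult_ac)
    qed
    finally show ?thesis .
  qed
  then have "e k y = (\<Sum>j\<in>{0..<m}. ru m (- k * j) / N * of_int (n (\<pi> j y)))" if "y \<in> X" for y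
    using \<sigma>(2) that by (simp add: N_def[symmetric] field_simps flip: sum_divide_distrib)
  moreover have "\<pi> j \<in> G" for j unfolding \<pi>_def using \<sigma>(1) G_funpow by (rule G_compose)
  ultimately show thesis using that[of \<pi> "\<lambda>j. ru m (- k * j) / N"] by blast
qed

text \<open>\<open>P\<close> is \<open>m\<close> times the projection onto the characters in the
  spectrum. It acts as \<open>m\<close> on every translate of \<open>n\<close>, hence on all
  translates of these characters. So \<open>P\<close> and its conjugate \<open>Q\<close> by a group
  element satisfy P Q = m Q and Q P = m P. Both matrices are symmetric, and transposing the first
  identity gives P = Q.\<close>

lemma aset_spectrum: "aset (spectrum n)"
proof -
  define P where "P = K (\<lambda>k. of_bool (k \<in> spectrum n))"
  have P_fix: "(\<Sum>z\<in>X. P y z * of_int (n (\<sigma> z))) = of_int m * of_int (n (\<sigma> y))" if \<sigma>: "\<sigma> \<in> G" "y \<in> X" for \<sigma> y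
  proof -
    define N where "N k = (\<Sum>z\<in>X. of_int (n (\<sigma> z)) * e k z)" for k
    have Nz: "N k = 0" if "k \<notin> spectrum n" for k using that \<sigma> by (auto simp: spectrum_def N_def)
    define F where "F k = of_bool (k \<in> spectrum n) * e k y * N (- k)" for k
    have "(\<Sum>z\<in>X. P y z * of_int (n (\<sigma> z))) = (\<Sum>k\<in>{0..<m}. F k)"
      unfolding P_def K_def F_def N_def sum_distrib_left sum_distrib_right
      by (subst sum.swap) (simp add: mult_ac)
    also have "\<dots> = (\<Sum>k\<in>{0..<m}. F (0 - k))"
    proof (rule sum_mod_shift(2)[OF m_pos, symmetric])
      show "periodic m F" unfolding periodic_def
      proof (intro allI impI)
        fix a b assume ab: "m dvd a - b"
        then have "gcd a m = gcd b m" by (rule gcd_cong_int)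
        then have "a \<in> spectrum n \<longleftrightarrow> b \<in> spectrum n" using spectrum_gcd[of a n] spectrum_gcd[of b n] by simp
        moreover have "m dvd - a - - b" using ab by (simp add: dvd_diff_commute)
        then have "N (- a) = N (- b)" unfolding N_def by (simp only: e_periodic)
        ultimately show "F a = F b" unfolding F_def using e_periodic[OF ab] by simp
      qed
    qed
    also have "\<dots> = (\<Sum>k\<in>{0..<m}. N k * e (- k) y)"
      by (intro sum.cong refl) (auto simp: F_def spectrum_uminus Nz)
    also have "\<dots> = of_int m * of_int (n (\<sigma> y))" unfolding N_def by (rule e_inversion[OF \<sigma>(2)])
    finally show ?thesis .
  qed
  have P_char: "(\<Sum>z\<in>X. P y z * e k (\<rho> z)) = of_int m * e k (\<rho> y)"
    if k: "k \<in> spectrum n" "\<rho> \<in> G" "y \<in> X" for k \<rho> y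
  proof -
    obtain \<pi> c where c: "\<And>j. \<pi> j \<in> G" "\<And>y. y \<in> X \<Longrightarrow> e k y = (\<Sum>j\<in>{0..<m}. c j * of_int (n (\<pi> j y)))"
      by (rule character_in_span[OF k(1)]) blast
    have "(\<Sum>z\<in>X. P y z * e k (\<rho> z)) = (\<Sum>z\<in>X. \<Sum>j\<in>{0..<m}. c j * (P y z * of_int (n ((\<pi> j \<circ> \<rho>) z))))"
      using c(2)[OF G_in_X[OF k(2)]] by (simp add: sum_distrib_left mult_ac)
    also have "\<dots> = (\<Sum>j\<in>{0..<m}. c j * (\<Sum>z\<in>X. P y z * of_int (n ((\<pi> j \<circ> \<rho>) z))))"
      by (subst sum.swap) (simp add: sum_distrib_left)
    also have "\<dots> = (\<Sum>j\<in>{0..<m}. c j * (of_int m * of_int (n ((\<pi> j \<circ> \<rho>) y))))"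
      using P_fix[OF G_compose[OF c(1) k(2)] k(3)] by simp
    also have "\<dots> = of_int m * e k (\<rho> y)"
      using c(2)[OF G_in_X[OF k(2,3)]] by (simp add: sum_distrib_left mult_ac)
    finally show ?thesis .
  qed
  have P_sum: "P y z = (\<Sum>k\<in>{0..<m} \<inter> spectrum n. e k y * e (- k) z)" for y z
    unfolding P_def K_def by (intro sum.mono_neutral_cong_right) auto
  have P_sym: "P y z = P z y" for y z
  proof -
    define F where "F k = of_bool (k \<in> spectrum n) * (e k y * e (- k) z)" for k
    have "periodic m F" unfolding periodic_def
    proof (intro allI impI)
      fix a b assume ab: "m dvd a - b"
      then have "gcd a m = gcd b m" by (rule gcd_cong_int)
      then have "a \<in> spectrum n \<longleftrightarrow> b \<in> spectrum n" using spectrum_gcd[of a n] spectrum_gcd[of b n] by simp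
      moreover have "m dvd - a - - b" using ab by (simp add: dvd_diff_commute)
      ultimately show "F a = F b" unfolding F_def using e_periodic[OF ab] e_periodic[of "-a" "-b"] by simp
    qed
    from sum_mod_shift(2)[OF m_pos this, of 0]
    show ?thesis by (simp add: P_def K_def F_def spectrum_uminus mult_ac)
  qed
  have "P (\<rho> y) (\<rho> z) = P y z" if \<rho>: "\<rho> \<in> G" "y \<in> X" "z \<in> X" for \<rho> y z
  proof -
    define Q where "Q y z = P (\<rho> y) (\<rho> z)" for y z
    have PQ: "(\<Sum>w\<in>X. P y w * Q w z) = of_int m * Q y z" if "y \<in> X" for y z
    proof -
      have "(\<Sum>w\<in>X. P y w * Q w z) = (\<Sum>k\<in>{0..<m} \<inter> spectrum n. e (- k) (\<rho> z) * (\<Sum>w\<in>X. P y w * e k (\<rho> w)))"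
        unfolding Q_def P_sum[of "\<rho> _"] sum_distrib_left by (subst sum.swap) (simp add: mult_ac)
      also have "\<dots> = (\<Sum>k\<in>{0..<m} \<inter> spectrum n. e (- k) (\<rho> z) * (of_int m * e k (\<rho> y)))"
        using P_char[OF _ \<rho>(1) that] by (intro sum.cong) auto
      finally show ?thesis by (simp add: Q_def P_sum[of "\<rho> _"] sum_distrib_left mult_ac)
    qed
    have QP: "(\<Sum>w\<in>X. Q y w * P w z) = of_int m * P y z" if "y \<in> X" for y z
    proof -
      have "(\<Sum>w\<in>X. Q y w * P w z) = (\<Sum>w\<in>X. P (\<rho> y) w * P (inv \<rho> w) z)"
        using sum_G[OF \<rho>(1), of "\<lambda>w. P (\<rho> y) w * P (inv \<rho> w) z"] by (simp add: Q_def G_inv_apply[OF \<rho>(1)])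
      also have "\<dots> = (\<Sum>k\<in>{0..<m} \<inter> spectrum n. e (- k) z * (\<Sum>w\<in>X. P (\<rho> y) w * e k (inv \<rho> w)))"
        unfolding P_sum[of "inv \<rho> _"] sum_distrib_left by (subst sum.swap) (simp add: mult_ac)
      also have "\<dots> = (\<Sum>k\<in>{0..<m} \<inter> spectrum n. e (- k) z * (of_int m * e k (inv \<rho> (\<rho> y))))"
        using P_char[OF _ G_inv[OF \<rho>(1)] G_in_X[OF \<rho>(1) that]] by (intro sum.cong) auto
      finally show ?thesis by (simp add: G_inv_apply[OF \<rho>(1)] P_sum[of y] sum_distrib_left mult_ac)
    qed
    have Qsym: "Q y z = Q z y" for y z unfolding Q_def by (rule P_sym)
    have "of_int m * Q y z = (\<Sum>w\<in>X. P z w * Q w y)" using PQ[OF \<rho>(3), of y] Qsym[of y z] by simp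
    also have "\<dots> = (\<Sum>w\<in>X. Q y w * P w z)" using P_sym Qsym by (simp add: mult.commute)
    also have "\<dots> = of_int m * P y z" by (rule QP[OF \<rho>(2)])
    finally show ?thesis using m_pos by (simp add: Q_def)
  qed
  then have "invariant P" by (simp add: invariant_def)
  then have "(\<lambda>k. of_bool (k \<in> spectrum n)) \<in> A"
    unfolding A_def P_def using spectrum_gcd[of _ n] by auto
  then show ?thesis unfolding aset_def .
qed

section \<open>Block systems and decompositions\<close>

text \<open>The blocks are the cosets of the annihilator of the frequencies divisible by
  \<open>d\<close>, for a divisor \<open>d\<close> of \<open>m\<close>; this is why
  \<open>m div d\<close> appears and why blocks have \<open>d\<close> points.\<close>

definition same_block :: "int \<Rightarrow> complex \<Rightarrow> complex \<Rightarrow> bool" where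
  "same_block d y z \<longleftrightarrow> m div d dvd ix y - ix z"

lemma same_block_refl [simp]: "same_block d y y" by (simp add: same_block_def)
lemma same_block_sym: "same_block d y z \<longleftrightarrow> same_block d z y" by (simp add: same_block_def dvd_diff_commute)
lemma same_block_trans: "same_block d x y \<Longrightarrow> same_block d y z \<Longrightarrow> same_block d x z"
  unfolding same_block_def using dvd_add[of "m div d" "ix x - ix y" "ix y - ix z"] by simp

lemma character_same_block:
  assumes "d dvd m" "d dvd k" "same_block d y z" shows "e k y = e k z"
proof -
  have "m = d * (m div d)" using assms by simp
  then have "m dvd k * (ix y - ix z)" using assms by (metis mult_dvd_mono same_block_def)
  then have "m dvd k * ix y - k * ix z" by (simp add: right_diff_distrib)
  then show ?thesis unfolding e_def by (rule ru_cong[OF m_pos])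
qed

text \<open>The matrix of the indicator of the multiples of \<open>d\<close> is m / d on pairs in
  one block and 0 elsewhere, so its invariance says that blocks are permuted.\<close>

lemma same_block_G:
  assumes d: "asub d" and \<sigma>: "\<sigma> \<in> G" "y \<in> X" "z \<in> X"
  shows "same_block d (\<sigma> y) (\<sigma> z) \<longleftrightarrow> same_block d y z"
proof -
  have d0: "d > 0" "d dvd m" using d by (auto simp: asub_def)
  define D where "D = m div d"
  have mD: "m = d * D" using d0 by (simp add: D_def)
  have D0: "D > 0" using mD m_pos d0 by (simp add: zero_less_mult_iff)
  have "K (\<lambda>k. of_bool (k \<in> {x. d dvd x})) y z = (if same_block d y z then of_int D else 0)" for y z
  proof -
    have "K (\<lambda>k. of_bool (k \<in> {x. d dvd x})) y z = (\<Sum>k\<in>{0..<m} \<inter> {k. d dvd k}. ru m (k * (ix y - ix z)))"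
      unfolding K_def by (intro sum.mono_neutral_cong_right) (auto simp: e_def algebra_simps simp flip: ru_add)
    also have "\<dots> = (\<Sum>l\<in>{0..<D}. ru D (l * (ix y - ix z)))"
    proof (rule sum.reindex_bij_witness[of _ "\<lambda>l. d * l" "\<lambda>k. k div d"])
      fix k assume "k \<in> {0..<m} \<inter> {k. d dvd k}"
      then obtain l where l: "k = d * l" "0 \<le> d * l" "d * l < d * D" using mD by auto
      then show "d * (k div d) = k" "k div d \<in> {0..<D}" using d0 by (auto simp: zero_le_mult_iff)
      show "ru D (k div d * (ix y - ix z)) = ru m (k * (ix y - ix z))"
        using l d0 by (simp add: ru_def mD)
    qed (use d0 mD in auto)
    finally show ?thesis using sum_ru[OF D0] by (simp add: same_block_def D_def)
  qed
  moreover have "(\<lambda>k. of_bool (k \<in> {x. d dvd x})) \<in> A" using d unfolding asub_def aset_def by blast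
  then have "invariant (K (\<lambda>k. of_bool (k \<in> {x. d dvd x})))" unfolding A_def by blast
  ultimately show ?thesis using invariantD[OF _ \<sigma>] D0 by (metis (no_types, lifting) of_int_0_eq_iff less_irrefl)
qed

lemma card_block:
  assumes d: "asub d" and y: "y \<in> X"
  shows "int (card {z \<in> X. same_block d z y}) = d"
proof -
  have d0: "d > 0" "d dvd m" using d by (auto simp: asub_def)
  define D where "D = m div d"
  have mD: "m = int (nat d) * D" using d0 by (simp add: D_def)
  have "card {z \<in> X. same_block d z y} = (\<Sum>z\<in>X. of_bool (D dvd ix z - ix y))"
    by (simp add: same_block_def D_def Int_def)
  also have "\<dots> = (\<Sum>i\<in>{0..<m}. of_bool (D dvd i - ix y))" by (rule sum_X)
  also have "\<dots> = card {i \<in> {0..<m}. i \<in> UNIV \<and> D dvd i - ix y}" by (simp add: Int_def)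
  also have "\<dots> = card {j \<in> {0..<int (nat d)}. ix y + D * j \<in> UNIV}"
    by (rule card_coset[OF aset_UNIV mD]) (use d0 in simp)
  also have "{j \<in> {0..<int (nat d)}. ix y + D * j \<in> UNIV} = {0..<int (nat d)}" by auto
  finally show ?thesis using d0 by (simp only: card_atLeastLessThan_int)
qed

definition block_constant :: "int \<Rightarrow> complex poly \<Rightarrow> bool" where
  "block_constant d g \<longleftrightarrow> (\<forall>\<theta>\<in>labellings. \<forall>y\<in>X. \<forall>z\<in>X. same_block d y z \<longrightarrow> poly g (\<theta> y) = poly g (\<theta> z))"

lemma labelling_off_base: "\<exists>\<theta>\<in>labellings. \<forall>y\<in>X. poly f (\<theta> y) \<noteq> t0" and
  poly_eq_on_labellings: "(\<And>\<theta> y. \<theta> \<in> labellings \<Longrightarrow> y \<in> X \<Longrightarrow> poly f (\<theta> y) \<noteq> t0 \<Longrightarrow> poly p (\<theta> y) = poly q (\<theta> y)) \<Longrightarrow> p = q"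
proof -
  have inf: "infinite (- insert t0 (critical_values f))"
    unfolding Compl_eq_Diff_UNIV
    by (rule Diff_infinite_finite) (simp_all add: finite_critical_values[OF degree_pos] infinite_UNIV_char_0)
  then obtain t where "t \<notin> critical_values f" "t \<noteq> t0" by (metis ComplD finite.emptyI insertCI ex_in_conv)
  then show "\<exists>\<theta>\<in>labellings. \<forall>y\<in>X. poly f (\<theta> y) \<noteq> t0" using labelling_over[of t] by metis
  assume eq: "\<And>\<theta> y. \<theta> \<in> labellings \<Longrightarrow> y \<in> X \<Longrightarrow> poly f (\<theta> y) \<noteq> t0 \<Longrightarrow> poly p (\<theta> y) = poly q (\<theta> y)"
  obtain y where y: "y \<in> X" using X_nonempty by blast
  have "- insert t0 (critical_values f) \<subseteq> poly f ` {z. poly (p - q) z = 0}"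
  proof
    fix t assume t: "t \<in> - insert t0 (critical_values f)"
    then obtain \<theta> where \<theta>: "\<theta> \<in> labellings" "\<forall>x\<in>X. poly f (\<theta> x) = t" using labelling_over[of t] by blast
    then have "poly (p - q) (\<theta> y) = 0" using eq[of \<theta> y] y t by simp
    then show "t \<in> poly f ` {z. poly (p - q) z = 0}" using \<theta>(2) y by (intro image_eqI[of _ _ "\<theta> y"]) auto
  qed
  then have "infinite {z. poly (p - q) z = 0}" using inf finite_subset by blast
  then have "p - q = 0" using poly_roots_finite by blast
  then show "p = q" by simp
qed

text \<open>Symmetric polynomials in the members of a block are equivariant. The product of the
  differences \<open>x0 - \<theta> z\<close> is chosen for its zeros: at the base labelling it
  vanishes on the block of \<open>x0\<close>, and over any other value it never vanishes because
  \<open>x0\<close> lies over \<open>t0\<close>. The \<open>d\<close> known zeros force the exact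
  degree, and counting zeros again shows that different blocks receive different values.\<close>

lemma block_polynomial:
  assumes d: "asub d"
  obtains h where "int (degree h) = d" "block_constant d h"
    "\<And>y z. y \<in> X \<Longrightarrow> z \<in> X \<Longrightarrow> poly h y = poly h z \<longleftrightarrow> same_block d y z"
    "\<And>y. same_block d y (pt 0) \<Longrightarrow> y \<in> X \<Longrightarrow> poly h y = 0"
    "\<And>\<theta> y. \<theta> \<in> labellings \<Longrightarrow> y \<in> X \<Longrightarrow> poly f (\<theta> y) \<noteq> t0 \<Longrightarrow> poly h (\<theta> y) \<noteq> 0"
proof -
  have d0: "d > 0" using d by (simp add: asub_def)
  define x0 where "x0 = pt 0"
  have x0: "x0 \<in> X" by (simp add: x0_def pt_in_X)
  define B where "B y = {z \<in> X. same_block d z y}" for y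
  have cB: "card (B y) = nat d" if "y \<in> X" for y using card_block[OF d that] by (simp add: B_def)
  define H where "H y \<theta> = (\<Prod>z\<in>B y. x0 - \<theta> z)" for y and \<theta> :: "complex \<Rightarrow> complex"
  obtain h where h: "degree h \<le> nat d" "\<And>\<theta> x. \<theta> \<in> labellings \<Longrightarrow> x \<in> X \<Longrightarrow> poly h (\<theta> x) = H x \<theta>"
  proof (rule equivariant_polynomial[of x0 H "(norm x0 + 1) ^ nat d" "nat d"])
    show "\<exists>\<sigma>\<in>G. \<sigma> x0 = x" if "x \<in> X" for x using G_transitive x0 that by blast
    show "(\<lambda>t. H x0 (\<lambda>x. \<psi> x t)) holomorphic_on U" if "open U" "\<And>x. x \<in> X \<Longrightarrow> \<psi> x holomorphic_on U" for U \<psi>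
      unfolding H_def using that by (intro holomorphic_intros) (auto simp: B_def)
    show "H x0 \<theta> = H x0 \<theta>'" if "\<And>x. x \<in> X \<Longrightarrow> \<theta> x = \<theta>' x" for \<theta> \<theta>'
      unfolding H_def using that by (intro prod.cong) (auto simp: B_def)
    show "H x0 (\<lambda>x. \<theta> (\<sigma> x)) = H (\<sigma> x0) \<theta>" if \<sigma>: "\<sigma> \<in> G" "\<theta> \<in> labellings" for \<sigma> \<theta>
      unfolding H_def
      by (rule prod.reindex_bij_witness[of _ "inv \<sigma>" \<sigma>])
        (use \<sigma> x0 same_block_G[OF d \<sigma>(1) _ x0] same_block_G[OF d G_inv[OF \<sigma>(1)] _ G_in_X[OF \<sigma>(1) x0]]
          G_inv_apply[OF \<sigma>(1)] G_in_X G_inv in \<open>auto simp: B_def\<close>)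
    show "norm (H x0 \<theta>) \<le> (norm x0 + 1) ^ nat d * Q ^ nat d" if Q: "Q \<ge> 1" "\<And>x. x \<in> X \<Longrightarrow> norm (\<theta> x) \<le> Q" for \<theta> Q
    proof -
      have "norm (H x0 \<theta>) = (\<Prod>z\<in>B x0. norm (x0 - \<theta> z))" by (simp add: H_def prod_norm)
      also have "\<dots> \<le> (\<Prod>z\<in>B x0. (norm x0 + 1) * Q)"
      proof (intro prod_mono conjI norm_ge_zero)
        fix z assume "z \<in> B x0"
        then have "norm (x0 - \<theta> z) \<le> norm x0 + Q" using Q(2) norm_triangle_ineq4[of x0 "\<theta> z"] by (force simp: B_def)
        also have "norm x0 * 1 \<le> norm x0 * Q" using Q(1) by (intro mult_left_mono) auto
        then have "norm x0 + Q \<le> (norm x0 + 1) * Q" by (simp add: distrib_right)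
        finally show "norm (x0 - \<theta> z) \<le> (norm x0 + 1) * Q" .
      qed
      finally show ?thesis using cB[OF x0] by (simp add: power_mult_distrib)
    qed
  qed (use x0 in blast)+
  have nz: "poly h (\<theta> y) \<noteq> 0" if \<theta>: "\<theta> \<in> labellings" "y \<in> X" "poly f (\<theta> y) \<noteq> t0" for \<theta> y
  proof -
    have "x0 \<noteq> \<theta> z" if "z \<in> X" for z
      using labelling_same_fibre[OF \<theta>(1,2) that] \<theta>(3) x0 by (auto simp: X_iff)
    then show ?thesis using h(2)[OF \<theta>(1,2)] by (auto simp: H_def B_def)
  qed
  have const: "poly h (\<theta> y) = poly h (\<theta> z)" if "\<theta> \<in> labellings" "y \<in> X" "z \<in> X" "same_block d y z" for \<theta> y z
  proof -
    have "B y = B z" using that(4) same_block_trans same_block_sym unfolding B_def by blast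
    then show ?thesis using h(2) that by (simp add: H_def)
  qed
  have root: "poly h y = 0" if "same_block d y x0" "y \<in> X" for y
  proof -
    have "x0 \<in> B y" using that x0 same_block_sym by (simp add: B_def)
    then have "H y (\<lambda>x. x) = 0" unfolding H_def by (intro prod_zero) (auto simp: B_def)
    then show ?thesis using h(2)[OF id_labelling that(2)] by simp
  qed
  have "h \<noteq> 0"
  proof -
    obtain \<theta> where "\<theta> \<in> labellings" "\<forall>y\<in>X. poly f (\<theta> y) \<noteq> t0" using labelling_off_base by blast
    then show ?thesis using nz[of \<theta> x0] x0 by auto
  qed
  have fin: "finite {x. poly h x = 0}" by (rule poly_roots_finite[OF \<open>h \<noteq> 0\<close>])
  have "nat d \<le> degree h"
  proof -
    have "B x0 \<subseteq> {x. poly h x = 0}" using root by (auto simp: B_def)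
    then have "card (B x0) \<le> card {x. poly h x = 0}" using fin card_mono by blast
    also have "\<dots> \<le> degree h" by (rule card_poly_roots_bound[OF \<open>h \<noteq> 0\<close>])
    finally show ?thesis using cB[OF x0] by simp
  qed
  then have deg: "degree h = nat d" using h(1) by simp
  have sep: "same_block d y z" if yz: "y \<in> X" "z \<in> X" "poly h y = poly h z" for y z
  proof (rule ccontr)
    assume nb: "\<not> same_block d y z"
    define q where "q = h - [:poly h y:]"
    have "degree q = nat d"
      unfolding q_def using deg d0 degree_add_eq_left[of "[:- poly h y:]" h]
      by (simp add: diff_conv_add_uminus del: add_uminus_conv_diff)
    then have "q \<noteq> 0" using d0 by auto
    have "insert z (B y) \<subseteq> {x. poly q x = 0}"
      using const[OF id_labelling _ yz(1)] yz by (auto simp: B_def q_def)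
    then have "card (insert z (B y)) \<le> card {x. poly q x = 0}"
      using poly_roots_finite[OF \<open>q \<noteq> 0\<close>] card_mono by blast
    also have "\<dots> \<le> nat d" using card_poly_roots_bound[OF \<open>q \<noteq> 0\<close>] \<open>degree q = nat d\<close> by simp
    finally have "card (insert z (B y)) \<le> nat d" .
    moreover have "z \<notin> B y" using nb same_block_sym by (simp add: B_def)
    moreover have "finite (B y)" by (simp add: B_def)
    ultimately show False using cB[OF yz(1)] by simp
  qed
  show thesis
  proof (rule that[of h])
    show "int (degree h) = d" using deg d0 by simp
    show "block_constant d h" unfolding block_constant_def using const by blast
    show "poly h y = poly h z \<longleftrightarrow> same_block d y z" if "y \<in> X" "z \<in> X" for y z
      using const[OF id_labelling that] sep[OF that] by auto
  qed (use root nz in \<open>auto simp: x0_def\<close>)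
qed

end

section \<open>Left factors and projected cycles\<close>

lemma poly_surj: assumes "degree h > 0" shows "\<exists>z::complex. poly h z = w"
proof -
  have "degree (h - [:w:]) = degree h" using degree_add_eq_left[of "[:-w:]" h] assms
    by (simp add: diff_conv_add_uminus del: add_uminus_conv_diff)
  then have "\<not> constant (poly (h - [:w:]))" using constant_degree[of "h - [:w:]"] assms by simp
  then have "\<exists>z. poly (h - [:w:]) z = 0" by (rule fundamental_theorem_of_algebra)
  then show ?thesis by auto
qed

lemma poly_analytic: assumes "a analytic_on {t}" shows "(\<lambda>s. poly h (a s)) analytic_on {t}"
proof -
  obtain r where "r > 0" "a holomorphic_on ball t r" using assms by (auto simp: analytic_at_ball)
  then have "(\<lambda>s. poly h (a s)) holomorphic_on ball t r" by (intro holomorphic_intros)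
  then show ?thesis using \<open>r > 0\<close> by (auto simp: analytic_at_ball)
qed

text \<open>The chain rule at a preimage under \<open>h\<close>. So \<open>t0\<close> remains a
  regular value of every left factor.\<close>

lemma crit_left_factor:
  assumes "degree (f0 \<circ>\<^sub>p h) > 0" shows "critical_values f0 \<subseteq> critical_values (f0 \<circ>\<^sub>p h)"
proof
  fix t assume "t \<in> critical_values f0"
  then obtain w where w: "t = poly f0 w" "poly (pderiv f0) w = 0" by (auto simp: critical_values_def)
  have "degree h > 0" using assms by (simp add: degree_pcompose)
  then obtain z where "poly h z = w" using poly_surj by blast
  then have "t = poly (f0 \<circ>\<^sub>p h) z" "poly (pderiv (f0 \<circ>\<^sub>p h)) z = 0"
    using w by (simp_all add: poly_pcompose pderiv_pcompose)
  then show "t \<in> critical_values (f0 \<circ>\<^sub>p h)" by (auto simp: critical_values_def)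
qed

context regular_point begin

lemma left_factor_regular:
  assumes "f = f0 \<circ>\<^sub>p h"
  shows "regular_point f0 t0" "degree h > 0" "poly h ` X = fibre f0 t0"
proof -
  have dh: "degree f0 > 0" "degree h > 0" using degree_pos assms by (auto simp: degree_pcompose)
  then show "regular_point f0 t0" "degree h > 0"
    using regular crit_left_factor[of f0 h] degree_pos assms by (auto simp: regular_point_def)
  show "poly h ` X = fibre f0 t0"
  proof (intro equalityI subsetI)
    fix w assume w: "w \<in> fibre f0 t0"
    obtain z where "poly h z = w" using poly_surj dh(2) by blast
    moreover from this have "z \<in> X" using w assms by (simp add: X_iff poly_pcompose fibre_def)
    ultimately show "w \<in> poly h ` X" by blast
  qed (use assms in \<open>auto simp: X_iff poly_pcompose fibre_def\<close>)
qed

lemma projected_cycle_sum: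
  assumes "f = f0 \<circ>\<^sub>p h"
  shows "(\<Sum>y\<in>fibre f0 t0. of_int (projected_cycle f t0 h n y) * F y) = (\<Sum>x\<in>X. of_int (n x) * (F (poly h x) :: complex))"
proof -
  have "(\<Sum>x\<in>X. of_int (n x) * F (poly h x)) =
      (\<Sum>y\<in>fibre f0 t0. \<Sum>x\<in>{x \<in> X. poly h x = y}. of_int (n x) * F (poly h x))"
    using left_factor_regular[OF assms] finite_fibre[of f0]
    by (intro sum.group[symmetric]) (auto simp: regular_point_def)
  also have "\<dots> = (\<Sum>y\<in>fibre f0 t0. of_int (projected_cycle f t0 h n y) * F y)"
    unfolding projected_cycle_def of_int_sum sum_distrib_right by (intro sum.cong) auto
  finally show ?thesis ..
qed

text \<open>By uniqueness of germs, \<open>h\<close> carries the branch of \<open>f\<close> at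
  \<open>x\<close> to the branch of \<open>f0\<close> at \<open>poly h x\<close>.\<close>

lemma cycle_integral_projected:
  assumes "f = f0 \<circ>\<^sub>p h"
  shows "\<forall>\<^sub>F t in nhds t0. cycle_integral f0 t0 (projected_cycle f t0 h n) g t = cycle_integral f t0 n (g \<circ>\<^sub>p h) t"
proof -
  interpret F: regular_point f0 t0 by (rule left_factor_regular[OF assms])
  have "\<forall>\<^sub>F t in nhds t0. \<forall>x\<in>X. root_branch f0 t0 (poly h x) t = poly h (root_branch f t0 x t)"
  proof (intro eventually_ball_finite ballI finite_X)
    fix x assume x: "x \<in> X"
    note rb = root_branch[OF degree_pos regular x]
    have "poly h x \<in> fibre f0 t0" using x left_factor_regular(3)[OF assms] by blast
    then show "\<forall>\<^sub>F t in nhds t0. root_branch f0 t0 (poly h x) t = poly h (root_branch f t0 x t)"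
    proof (rule root_branch_unique[OF F.degree_pos F.regular])
      show "(\<lambda>t. poly h (root_branch f t0 x t)) analytic_on {t0}"
        by (rule poly_analytic[OF rb(1)])
      show "\<forall>\<^sub>F t in nhds t0. poly f0 (poly h (root_branch f t0 x t)) = t"
        using rb(3) by eventually_elim (simp add: assms poly_pcompose)
    qed (simp add: rb)
  qed
  then show ?thesis
  proof eventually_elim
    case (elim t)
    show ?case
      unfolding cycle_integral_def projected_cycle_sum[OF assms, of n "\<lambda>y. poly g (root_branch f0 t0 y t)"]
      using elim by (intro sum.cong) (auto simp: poly_pcompose)
  qed
qed

lemma integral_vanishes_projected:
  assumes "f = f0 \<circ>\<^sub>p h"
  shows "integral_vanishes f0 t0 (projected_cycle f t0 h n) g \<longleftrightarrow> integral_vanishes f t0 n (g \<circ>\<^sub>p h)"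
  unfolding integral_vanishes_def
proof
  assume "\<forall>\<^sub>F t in nhds t0. cycle_integral f0 t0 (projected_cycle f t0 h n) g t = 0"
  with cycle_integral_projected[OF assms, of n g]
  show "\<forall>\<^sub>F t in nhds t0. cycle_integral f t0 n (g \<circ>\<^sub>p h) t = 0" by eventually_elim simp
next
  assume "\<forall>\<^sub>F t in nhds t0. cycle_integral f t0 n (g \<circ>\<^sub>p h) t = 0"
  with cycle_integral_projected[OF assms, of n g]
  show "\<forall>\<^sub>F t in nhds t0. cycle_integral f0 t0 (projected_cycle f t0 h n) g t = 0" by eventually_elim simp
qed

text \<open>This trades germs for labellings, on which \<open>G\<close> acts: the identity continues
  along every chain, and conversely the branches near \<open>t0\<close> form labellings.\<close>

lemma integral_vanishes_iff:
  "integral_vanishes f t0 n g \<longleftrightarrow> (\<forall>\<theta>\<in>labellings. (\<Sum>x\<in>X. of_int (n x) * poly g (\<theta> x)) = 0)"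
proof
  assume "integral_vanishes f t0 n g"
  then have "\<forall>\<^sub>F t in nhds t0. (\<Sum>x\<in>X. of_int (n x) * poly g (root_branch f t0 x t)) = 0"
    by (simp add: integral_vanishes_def cycle_integral_def)
  then show "\<forall>\<theta>\<in>labellings. (\<Sum>x\<in>X. of_int (n x) * poly g (\<theta> x)) = 0"
    by (intro ballI permanence[of "\<lambda>\<theta>. \<Sum>x\<in>X. of_int (n x) * poly g (\<theta> x)"])
      (auto intro!: holomorphic_intros)
next
  assume *: "\<forall>\<theta>\<in>labellings. (\<Sum>x\<in>X. of_int (n x) * poly g (\<theta> x)) = 0"
  show "integral_vanishes f t0 n g"
    unfolding integral_vanishes_def cycle_integral_def
    using root_branch_labelling
  proof eventually_elim
    case (elim t)
    then have "(\<lambda>x. root_branch f t0 x t) \<in> labellings" by blast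
    from bspec[OF * this] show ?case .
  qed
qed

text \<open>The images under \<open>q\<close> of the two branches are roots of the left factor with
  the same value at \<open>t0\<close>, hence equal germs, and this identity is continued.\<close>

lemma poly_relation_permanent:
  assumes "f = f1 \<circ>\<^sub>p q" "x \<in> X" "y \<in> X" "poly q x = poly q y" "\<theta> \<in> labellings"
  shows "poly q (\<theta> x) = poly q (\<theta> y)"
proof -
  interpret F: regular_point f1 t0 by (rule left_factor_regular[OF assms(1)])
  have an: "(\<lambda>t. poly q (root_branch f t0 z t)) analytic_on {t0}"
    "\<forall>\<^sub>F t in nhds t0. poly f1 (poly q (root_branch f t0 z t)) = t" if "z \<in> X" for z
  proof -
    note rb = root_branch[OF degree_pos regular that]
    show "(\<lambda>t. poly q (root_branch f t0 z t)) analytic_on {t0}" by (rule poly_analytic[OF rb(1)])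
    show "\<forall>\<^sub>F t in nhds t0. poly f1 (poly q (root_branch f t0 z t)) = t"
      using rb(3) by eventually_elim (simp add: assms(1) poly_pcompose)
  qed
  have "\<forall>\<^sub>F t in nhds t0. poly q (root_branch f t0 x t) = poly q (root_branch f t0 y t)"
    by (rule germ_unique[OF F.degree_pos F.regular an[OF assms(2)] an[OF assms(3)]])
      (simp add: root_branch(2)[OF degree_pos regular] assms(2-4))
  then have "\<forall>\<^sub>F t in nhds t0. poly q (root_branch f t0 x t) - poly q (root_branch f t0 y t) = 0"
    by eventually_elim simp
  then have "poly q (\<theta> x) - poly q (\<theta> y) = 0"
    using assms by (intro permanence[of "\<lambda>\<theta>. poly q (\<theta> x) - poly q (\<theta> y)"]) (auto intro!: holomorphic_intros)
  then show ?thesis by simp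
qed

end

section \<open>Right factors attached to block systems\<close>

context cyclic_point begin

definition block_poly :: "int \<Rightarrow> complex poly" where
  "block_poly d = (SOME h. int (degree h) = d \<and> block_constant d h \<and>
    (\<forall>y\<in>X. \<forall>z\<in>X. poly h y = poly h z \<longleftrightarrow> same_block d y z) \<and>
    (\<forall>y\<in>X. same_block d y (pt 0) \<longrightarrow> poly h y = 0) \<and>
    (\<forall>\<theta>\<in>labellings. \<forall>y\<in>X. poly f (\<theta> y) \<noteq> t0 \<longrightarrow> poly h (\<theta> y) \<noteq> 0))"

lemma block_poly:
  assumes "asub d"
  shows "int (degree (block_poly d)) = d" "block_constant d (block_poly d)"
    "y \<in> X \<Longrightarrow> z \<in> X \<Longrightarrow> poly (block_poly d) y = poly (block_poly d) z \<longleftrightarrow> same_block d y z"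
    "y \<in> X \<Longrightarrow> same_block d y (pt 0) \<Longrightarrow> poly (block_poly d) y = 0"
    "\<theta> \<in> labellings \<Longrightarrow> y \<in> X \<Longrightarrow> poly f (\<theta> y) \<noteq> t0 \<Longrightarrow> poly (block_poly d) (\<theta> y) \<noteq> 0"
proof -
  obtain h where "int (degree h) = d" "block_constant d h"
    "\<And>y z. y \<in> X \<Longrightarrow> z \<in> X \<Longrightarrow> poly h y = poly h z \<longleftrightarrow> same_block d y z"
    "\<And>y. same_block d y (pt 0) \<Longrightarrow> y \<in> X \<Longrightarrow> poly h y = 0"
    "\<And>\<theta> y. \<theta> \<in> labellings \<Longrightarrow> y \<in> X \<Longrightarrow> poly f (\<theta> y) \<noteq> t0 \<Longrightarrow> poly h (\<theta> y) \<noteq> 0"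
    by (rule block_polynomial[OF assms]) blast
  then have "\<exists>h. int (degree h) = d \<and> block_constant d h \<and>
    (\<forall>y\<in>X. \<forall>z\<in>X. poly h y = poly h z \<longleftrightarrow> same_block d y z) \<and>
    (\<forall>y\<in>X. same_block d y (pt 0) \<longrightarrow> poly h y = 0) \<and>
    (\<forall>\<theta>\<in>labellings. \<forall>y\<in>X. poly f (\<theta> y) \<noteq> t0 \<longrightarrow> poly h (\<theta> y) \<noteq> 0)"
    by (intro exI[of _ h]) auto
  from someI_ex[OF this, folded block_poly_def]
  show "int (degree (block_poly d)) = d" "block_constant d (block_poly d)"
    "y \<in> X \<Longrightarrow> z \<in> X \<Longrightarrow> poly (block_poly d) y = poly (block_poly d) z \<longleftrightarrow> same_block d y z"
    "y \<in> X \<Longrightarrow> same_block d y (pt 0) \<Longrightarrow> poly (block_poly d) y = 0"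
    "\<theta> \<in> labellings \<Longrightarrow> y \<in> X \<Longrightarrow> poly f (\<theta> y) \<noteq> t0 \<Longrightarrow> poly (block_poly d) (\<theta> y) \<noteq> 0"
    by blast+
qed

text \<open>Subtracting from \<open>g\<close> its value on one block makes it divisible by the block polynomial, and
  the quotient is again constant on blocks. The base fibre is excluded because the block polynomial
  vanishes on one of its blocks.\<close>

lemma block_constant_factor:
  assumes d: "asub d"
    and g: "\<And>\<theta> y z. \<theta> \<in> labellings \<Longrightarrow> y \<in> X \<Longrightarrow> z \<in> X \<Longrightarrow> poly f (\<theta> y) \<noteq> t0 \<Longrightarrow>
      same_block d y z \<Longrightarrow> poly g (\<theta> y) = poly g (\<theta> z)"
  shows "\<exists>g0. g = g0 \<circ>\<^sub>p block_poly d"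
  using g
proof (induction "degree g" arbitrary: g rule: less_induct)
  case less
  define h where "h = block_poly d"
  note h = block_poly[OF d, folded h_def]
  have d0: "d > 0" using d by (simp add: asub_def)
  \<comment> \<open>The hypothesis leaves out the fibre over \<open>t0\<close>; there the equality
    follows by continuity of the branches.\<close>
  have base: "poly g y = poly g z" if yz: "y \<in> X" "z \<in> X" "same_block d y z" for y z
  proof -
    have "isCont (root_branch f t0 x) t0" if "x \<in> X" for x
      using root_branch(1)[OF degree_pos regular that] by (rule analytic_at_imp_isCont)
    then have "isCont (\<lambda>t. poly g (root_branch f t0 y t) - poly g (root_branch f t0 z t)) t0"
      using yz by (intro continuous_intros) auto
    then have "(\<lambda>t. poly g (root_branch f t0 y t) - poly g (root_branch f t0 z t)) \<midarrow>t0\<rightarrow> poly g y - poly g z"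
      using yz by (simp add: isCont_def root_branch(2)[OF degree_pos regular])
    moreover have "\<forall>\<^sub>F t in at t0. poly g (root_branch f t0 y t) - poly g (root_branch f t0 z t) = 0"
      unfolding eventually_at_filter using root_branch_labelling
    proof eventually_elim
      case (elim t)
      then show ?case using less.prems[of "\<lambda>x. root_branch f t0 x t" y z] yz by auto
    qed
    then have "(\<lambda>t. poly g (root_branch f t0 y t) - poly g (root_branch f t0 z t)) \<midarrow>t0\<rightarrow> 0"
      by (rule tendsto_eventually)
    ultimately show ?thesis using tendsto_unique[OF trivial_limit_at] by fastforce
  qed
  define c where "c = poly g (pt 0)"
  define B where "B = {y \<in> X. same_block d y (pt 0)}"
  have B: "card B = nat d" using card_block[OF d pt_in_X, of 0] by (simp add: B_def)
  \<comment> \<open>The remainder vanishes on the block of \<open>pt 0\<close>, where both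
    \<open>g - [:c:]\<close> and \<open>h\<close> do. These are \<open>d\<close> zeros, but its
    degree is below \<open>d\<close>.\<close>
  define r where "r = (g - [:c:]) mod h"
  have "h \<noteq> 0" using h(1) d0 by auto
  have "r = 0"
  proof (rule ccontr)
    assume "r \<noteq> 0"
    have "poly r y = 0" if "y \<in> B" for y
    proof -
      have "poly h y = 0" "poly (g - [:c:]) y = 0"
        using that h(4) base[OF _ pt_in_X] by (auto simp: B_def c_def)
      moreover have "g - [:c:] = (g - [:c:]) div h * h + r" by (simp add: r_def)
      ultimately show ?thesis by (metis add_0 mult_zero_right poly_add poly_mult)
    qed
    then have "card B \<le> card {y. poly r y = 0}" by (intro card_mono poly_roots_finite \<open>r \<noteq> 0\<close>) auto
    also have "\<dots> \<le> degree r" by (rule card_poly_roots_bound[OF \<open>r \<noteq> 0\<close>])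
    also have "degree r < degree h"
      using degree_mod_less[OF \<open>h \<noteq> 0\<close>, of "g - [:c:]"] \<open>r \<noteq> 0\<close> by (simp add: r_def)
    finally show False using B h(1) by linarith
  qed
  then obtain g1 where g1: "g - [:c:] = h * g1" unfolding r_def by (metis dvd_def mod_eq_0_iff_dvd)
  then have g_eq: "g = [:c:] + h * g1" by (metis add.commute diff_add_cancel)
  show ?case
  proof (cases "g1 = 0")
    case True
    then have "g = [:c:] \<circ>\<^sub>p block_poly d" using g_eq by simp
    then show ?thesis by blast
  next
    case False
    have "degree (g - [:c:]) \<le> degree g" by (intro order_trans[OF degree_diff_le_max]) auto
    then have "degree g1 < degree g"
      using degree_mult_eq[OF \<open>h \<noteq> 0\<close> False] g1 h(1) d0 by simp
    moreover have "poly g1 (\<theta> y) = poly g1 (\<theta> z)"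
      if t: "\<theta> \<in> labellings" "y \<in> X" "z \<in> X" "poly f (\<theta> y) \<noteq> t0" "same_block d y z" for \<theta> y z
    proof -
      have "poly h (\<theta> y) = poly h (\<theta> z)" using h(2) t unfolding block_constant_def by blast
      moreover have "poly h (\<theta> y) \<noteq> 0" using h(5) t by blast
      moreover have "poly g (\<theta> y) = poly g (\<theta> z)" using less.prems t by blast
      ultimately show ?thesis by (simp add: g_eq)
    qed
    ultimately obtain g2 where "g1 = g2 \<circ>\<^sub>p block_poly d" using less.hyps by blast
    then have "g = pCons c g2 \<circ>\<^sub>p block_poly d" using g_eq by (simp add: pcompose_pCons h_def)
    then show ?thesis by blast
  qed
qed

lemma block_decomposition:
  assumes "asub d" obtains f0 where "f = f0 \<circ>\<^sub>p block_poly d"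
proof -
  have "\<exists>f0. f = f0 \<circ>\<^sub>p block_poly d"
    by (rule block_constant_factor[OF assms]) (rule labelling_same_fibre)
  then show thesis using that by blast
qed

section \<open>Splitting a polynomial along atoms\<close>

definition atoms :: "int set set" where "atoms = {T. atom T}"
definition modulus :: "int set \<Rightarrow> int" where "modulus T = Gcd (insert m T)"

lemma finite_atoms: "finite atoms"
  unfolding atoms_def by (rule finite_subset[OF _ finite_asets]) (auto dest: atom_aset)

lemma asub_modulus: "atom T \<Longrightarrow> asub (modulus T)"
  unfolding modulus_def by (intro asub_generated atom_aset)

lemma modulus_dvd: "k \<in> T \<Longrightarrow> modulus T dvd k"
  unfolding modulus_def by (rule Gcd_dvd) simp

lemma modulus_inj: "atom S \<Longrightarrow> atom T \<Longrightarrow> modulus S = modulus T \<Longrightarrow> S = T"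
  unfolding modulus_def by (rule atom_eq_of_Gcd_eq[OF rational_schur_ring_axioms])

text \<open>The part of \<open>g\<close> with frequencies in \<open>T\<close> is equivariant because
  the indicator of \<open>T\<close> lies in \<open>A\<close>, so it is a polynomial in the root. All
  these frequencies are multiples of \<open>modulus T\<close>, so it is constant on the
  corresponding blocks and factors through their polynomial.\<close>

lemma component:
  assumes T: "atom T"
  obtains g0 where "\<And>\<theta> x. \<theta> \<in> labellings \<Longrightarrow> x \<in> X \<Longrightarrow>
    of_int m * poly (g0 \<circ>\<^sub>p block_poly (modulus T)) (\<theta> x) = (\<Sum>y\<in>X. K (\<lambda>k. of_bool (k \<in> T)) x y * poly g (\<theta> y))"
proof -
  define M where "M = K (\<lambda>k. of_bool (k \<in> T))"
  have "(\<lambda>k. of_bool (k \<in> T)) \<in> A" using atom_aset[OF T] unfolding aset_def .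
  then have M: "invariant M" unfolding M_def A_def by blast
  define H where "H x \<theta> = (\<Sum>y\<in>X. M x y * poly g (\<theta> y)) / of_int m" for x \<theta>
  define x0 where "x0 = pt 0"
  have x0: "x0 \<in> X" by (simp add: x0_def pt_in_X)
  define D where "D = (\<Sum>y\<in>X. norm (M x0 y)) * (\<Sum>i\<le>degree g. norm (coeff g i)) / of_int m"
  obtain p where p: "\<And>\<theta> x. \<theta> \<in> labellings \<Longrightarrow> x \<in> X \<Longrightarrow> poly p (\<theta> x) = H x \<theta>"
  proof (rule equivariant_polynomial[of x0 H D "degree g"])
    show "\<exists>\<sigma>\<in>G. \<sigma> x0 = x" if "x \<in> X" for x using G_transitive x0 that by blast
    show "(\<lambda>t. H x0 (\<lambda>x. \<psi> x t)) holomorphic_on U" if "open U" "\<And>x. x \<in> X \<Longrightarrow> \<psi> x holomorphic_on U" for U \<psi>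
      unfolding H_def using that m_pos by (intro holomorphic_intros) auto
    show "H x0 \<theta> = H x0 \<theta>'" if "\<And>x. x \<in> X \<Longrightarrow> \<theta> x = \<theta>' x" for \<theta> \<theta>'
      unfolding H_def using that by simp
    show "H x0 (\<lambda>x. \<theta> (\<sigma> x)) = H (\<sigma> x0) \<theta>" if \<sigma>: "\<sigma> \<in> G" "\<theta> \<in> labellings" for \<sigma> \<theta>
    proof -
      have "(\<Sum>y\<in>X. M (\<sigma> x0) (\<sigma> y) * poly g (\<theta> (\<sigma> y))) = (\<Sum>y\<in>X. M (\<sigma> x0) y * poly g (\<theta> y))"
        by (rule sum_G[OF \<sigma>(1), of "\<lambda>y. M (\<sigma> x0) y * poly g (\<theta> y)"])
      then show ?thesis using invariantD[OF M \<sigma>(1) x0] by (simp add: H_def)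
    qed
    show "norm (H x0 \<theta>) \<le> D * B ^ degree g" if B: "B \<ge> 1" "\<And>x. x \<in> X \<Longrightarrow> norm (\<theta> x) \<le> B" for \<theta> B
    proof -
      have "norm (poly g (\<theta> y)) \<le> (\<Sum>i\<le>degree g. norm (coeff g i)) * B ^ degree g" if "y \<in> X" for y
      proof -
        have "norm (poly g (\<theta> y)) \<le> (\<Sum>i\<le>degree g. norm (coeff g i * \<theta> y ^ i))"
          unfolding poly_altdef by (rule norm_sum)
        also have "\<dots> \<le> (\<Sum>i\<le>degree g. norm (coeff g i) * B ^ degree g)"
        proof (rule sum_mono)
          fix i assume "i \<in> {..degree g}"
          have "norm (\<theta> y) ^ i \<le> B ^ i" using B(2)[OF that] by (intro power_mono) auto
          also have "\<dots> \<le> B ^ degree g" using B(1) \<open>i \<in> _\<close> by (intro power_increasing) auto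
          finally show "norm (coeff g i * \<theta> y ^ i) \<le> norm (coeff g i) * B ^ degree g"
            by (simp add: norm_mult norm_power mult_left_mono)
        qed
        finally show ?thesis by (simp add: sum_distrib_right)
      qed
      then have "norm (\<Sum>y\<in>X. M x0 y * poly g (\<theta> y)) \<le>
          (\<Sum>y\<in>X. norm (M x0 y) * ((\<Sum>i\<le>degree g. norm (coeff g i)) * B ^ degree g))"
        by (intro order_trans[OF norm_sum] sum_mono) (auto simp: norm_mult intro: mult_left_mono)
      also have "\<dots> = (\<Sum>y\<in>X. norm (M x0 y)) * (\<Sum>i\<le>degree g. norm (coeff g i)) * B ^ degree g"
        by (simp add: sum_distrib_right mult.assoc)
      finally show ?thesis using m_pos by (simp add: H_def D_def norm_divide divide_right_mono)
    qed
  qed (use x0 in blast)+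
  have "poly p (\<theta> y) = poly p (\<theta> z)"
    if t: "\<theta> \<in> labellings" "y \<in> X" "z \<in> X" "same_block (modulus T) y z" for \<theta> y z
  proof -
    have "modulus T dvd m" using asub_modulus[OF T] by (simp add: asub_def)
    then have "M y w = M z w" for w
      unfolding M_def K_def using character_same_block[OF _ modulus_dvd t(4)]
      by (intro sum.cong refl) (auto simp: of_bool_def)
    then show ?thesis using p t by (simp add: H_def)
  qed
  then obtain g0 where "p = g0 \<circ>\<^sub>p block_poly (modulus T)"
    using block_constant_factor[OF asub_modulus[OF T], of p] by blast
  then show thesis using that[of g0] p m_pos by (simp add: H_def M_def)
qed

text \<open>A permutation applied to \<open>n\<close> can be moved to the labelling, which becomes
  another labelling. So \<open>g\<close> is orthogonal to all translates of \<open>n\<close> and to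
  the characters that they span.\<close>

lemma spectral_sum_zero:
  assumes van: "\<And>\<theta>. \<theta> \<in> labellings \<Longrightarrow> (\<Sum>x\<in>X. of_int (n x) * poly g (\<theta> x)) = 0"
    and k: "k \<in> spectrum n" and \<theta>: "\<theta> \<in> labellings"
  shows "(\<Sum>y\<in>X. e k y * poly g (\<theta> y)) = 0"
proof -
  obtain \<pi> c where c: "\<And>j. \<pi> j \<in> G" "\<And>y. y \<in> X \<Longrightarrow> e k y = (\<Sum>j\<in>{0..<m}. c j * of_int (n (\<pi> j y)))"
    by (rule character_in_span[OF k]) blast
  have "(\<Sum>y\<in>X. of_int (n (\<pi> j y)) * poly g (\<theta> y)) = 0" for j
  proof -
    have "(\<Sum>y\<in>X. of_int (n (\<pi> j y)) * poly g (\<theta> y)) =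
        (\<Sum>y\<in>X. of_int (n (\<pi> j y)) * poly g (\<theta> (inv (\<pi> j) (\<pi> j y))))"
      by (simp add: G_inv_apply[OF c(1)])
    also have "\<dots> = (\<Sum>y\<in>X. of_int (n y) * poly g ((\<theta> \<circ> inv (\<pi> j)) y))"
      using sum_G[OF c(1), of "\<lambda>y. of_int (n y) * poly g (\<theta> (inv (\<pi> j) y))"] by simp
    also have "\<dots> = 0" by (rule van[OF labelling_compose_G[OF \<theta> G_inv[OF c(1)]]])
    finally show ?thesis .
  qed
  moreover have "(\<Sum>y\<in>X. e k y * poly g (\<theta> y)) =
      (\<Sum>j\<in>{0..<m}. c j * (\<Sum>y\<in>X. of_int (n (\<pi> j y)) * poly g (\<theta> y)))"
    using c(2) unfolding sum_distrib_left by (subst sum.swap) (simp add: sum_distrib_right mult.assoc)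
  ultimately show ?thesis by simp
qed

lemma sum_eq_0_if_not_spectrum:
  assumes "k \<notin> spectrum n" shows "(\<Sum>x\<in>X. of_int (n x) * e k x) = 0"
proof -
  have "id \<in> G" using G_funpow[of 0] by simp
  then have "(\<Sum>x\<in>X. of_int (n (id x)) * e k x) = 0" using assms unfolding spectrum_def by blast
  then show ?thesis by simp
qed

lemma K_expand: "(\<Sum>y\<in>X. K a x y * F y) = (\<Sum>k\<in>{0..<m}. a k * e k x * (\<Sum>y\<in>X. e (- k) y * F y))"
  unfolding K_def sum_distrib_left sum_distrib_right by (subst sum.swap) (simp add: mult.assoc)

text \<open>The spectrum has its indicator in the ring, so an atom lies inside it or is disjoint
  from it. Components of the first kind vanish; those of the second kind are orthogonal to
  \<open>n\<close>, which has no frequencies there, so each of the remaining summands has a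
  vanishing integral on its own.\<close>

lemma splitting:
  assumes van: "\<And>\<theta>. \<theta> \<in> labellings \<Longrightarrow> (\<Sum>x\<in>X. of_int (n x) * poly g (\<theta> x)) = 0"
  obtains c where "g = (\<Sum>T\<in>{T \<in> atoms. T \<inter> spectrum n = {}}. c T \<circ>\<^sub>p block_poly (modulus T))"
    "\<And>T \<theta>. atom T \<Longrightarrow> T \<inter> spectrum n = {} \<Longrightarrow> \<theta> \<in> labellings \<Longrightarrow>
      (\<Sum>x\<in>X. of_int (n x) * poly (c T \<circ>\<^sub>p block_poly (modulus T)) (\<theta> x)) = 0"
proof -
  have "\<forall>T. \<exists>g0. atom T \<longrightarrow> (\<forall>\<theta>\<in>labellings. \<forall>x\<in>X. of_int m * poly (g0 \<circ>\<^sub>p block_poly (modulus T)) (\<theta> x) =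
      (\<Sum>y\<in>X. K (\<lambda>k. of_bool (k \<in> T)) x y * poly g (\<theta> y)))"
  proof
    fix T show "\<exists>g0. atom T \<longrightarrow> (\<forall>\<theta>\<in>labellings. \<forall>x\<in>X. of_int m * poly (g0 \<circ>\<^sub>p block_poly (modulus T)) (\<theta> x) =
      (\<Sum>y\<in>X. K (\<lambda>k. of_bool (k \<in> T)) x y * poly g (\<theta> y)))"
    proof (cases "atom T")
      case True
      show ?thesis by (rule component[OF True, of g]) blast
    qed blast
  qed
  then obtain c where "\<forall>T. atom T \<longrightarrow> (\<forall>\<theta>\<in>labellings. \<forall>x\<in>X. of_int m * poly (c T \<circ>\<^sub>p block_poly (modulus T)) (\<theta> x) =
      (\<Sum>y\<in>X. K (\<lambda>k. of_bool (k \<in> T)) x y * poly g (\<theta> y)))" by (rule choice[THEN exE])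
  then have c: "of_int m * poly (c T \<circ>\<^sub>p block_poly (modulus T)) (\<theta> x) =
      (\<Sum>k\<in>{0..<m}. of_bool (k \<in> T) * e k x * (\<Sum>y\<in>X. e (- k) y * poly g (\<theta> y)))"
    if "atom T" "\<theta> \<in> labellings" "x \<in> X" for T \<theta> x
    using that by (simp add: K_expand)
  have m0: "of_int m \<noteq> (0 :: complex)" using m_pos by simp
  have vanish: "c T \<circ>\<^sub>p block_poly (modulus T) = 0" if T: "atom T" "T \<inter> spectrum n \<noteq> {}" for T
  proof (rule poly_eq_on_labellings)
    fix \<theta> x assume \<theta>: "\<theta> \<in> labellings" "x \<in> X"
    have "T \<subseteq> spectrum n" using atom_subset[OF T(1) aset_spectrum] T(2) by blast
    then have "of_int m * poly (c T \<circ>\<^sub>p block_poly (modulus T)) (\<theta> x) = 0"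
      unfolding c[OF T(1) \<theta>]
      by (intro sum.neutral ballI) (auto simp: of_bool_def spectrum_uminus intro!: spectral_sum_zero[OF van _ \<theta>(1)])
    then show "poly (c T \<circ>\<^sub>p block_poly (modulus T)) (\<theta> x) = poly 0 (\<theta> x)" using m0 by simp
  qed
  have all: "g = (\<Sum>T\<in>atoms. c T \<circ>\<^sub>p block_poly (modulus T))"
  proof (rule poly_eq_on_labellings)
    fix \<theta> x assume \<theta>: "\<theta> \<in> labellings" "x \<in> X"
    have one: "(\<Sum>T\<in>atoms. of_bool (k \<in> T)) = (1 :: complex)" for k
    proof -
      obtain S where S: "atom S" "k \<in> S" using atom_exists by blast
      have "(\<Sum>T\<in>atoms. of_bool (k \<in> T)) = (\<Sum>T\<in>atoms. if T = S then 1 else (0 :: complex))"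
        using S atom_disjoint by (intro sum.cong) (auto simp: atoms_def)
      then show ?thesis using finite_atoms S by (simp add: atoms_def)
    qed
    have "of_int m * poly (\<Sum>T\<in>atoms. c T \<circ>\<^sub>p block_poly (modulus T)) (\<theta> x) =
        (\<Sum>T\<in>atoms. of_int m * poly (c T \<circ>\<^sub>p block_poly (modulus T)) (\<theta> x))"
      by (simp only: poly_sum sum_distrib_left)
    also have "\<dots> = (\<Sum>T\<in>atoms. \<Sum>k\<in>{0..<m}. of_bool (k \<in> T) * e k x * (\<Sum>y\<in>X. e (- k) y * poly g (\<theta> y)))"
      by (intro sum.cong refl c \<theta>) (simp add: atoms_def)
    also have "\<dots> = (\<Sum>k\<in>{0..<m}. (\<Sum>T\<in>atoms. of_bool (k \<in> T)) * (e k x * (\<Sum>y\<in>X. e (- k) y * poly g (\<theta> y))))"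
      by (subst sum.swap) (simp only: sum_distrib_right mult.assoc)
    also have "\<dots> = (\<Sum>y\<in>X. K (\<lambda>_. 1) x y * poly g (\<theta> y))" unfolding one K_expand by simp
    also have "\<dots> = (\<Sum>y\<in>X. if y = x then of_int m * poly g (\<theta> y) else 0)"
      using \<theta> by (intro sum.cong) (auto simp: K_const)
    also have "\<dots> = of_int m * poly g (\<theta> x)" using \<theta> by simp
    finally show "poly g (\<theta> x) = poly (\<Sum>T\<in>atoms. c T \<circ>\<^sub>p block_poly (modulus T)) (\<theta> x)" using m0 by simp
  qed
  show thesis
  proof (rule that[of c])
    have "(\<Sum>T\<in>atoms. c T \<circ>\<^sub>p block_poly (modulus T)) =
        (\<Sum>T\<in>{T \<in> atoms. T \<inter> spectrum n = {}}. c T \<circ>\<^sub>p block_poly (modulus T))"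
      using vanish finite_atoms by (intro sum.mono_neutral_right) (auto simp: atoms_def)
    then show "g = (\<Sum>T\<in>{T \<in> atoms. T \<inter> spectrum n = {}}. c T \<circ>\<^sub>p block_poly (modulus T))" using all by simp
    fix T \<theta> assume T: "atom T" "T \<inter> spectrum n = {}" and \<theta>: "\<theta> \<in> labellings"
    have z: "(\<Sum>x\<in>X. of_int (n x) * e k x) = 0" if "k \<in> T" for k
      using T(2) that by (intro sum_eq_0_if_not_spectrum) blast
    have "of_int m * (\<Sum>x\<in>X. of_int (n x) * poly (c T \<circ>\<^sub>p block_poly (modulus T)) (\<theta> x)) =
        (\<Sum>x\<in>X. of_int (n x) * (of_int m * poly (c T \<circ>\<^sub>p block_poly (modulus T)) (\<theta> x)))"
      by (simp add: sum_distrib_left mult_ac)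
    also have "\<dots> = (\<Sum>x\<in>X. \<Sum>k\<in>{0..<m}. (of_bool (k \<in> T) * (\<Sum>y\<in>X. e (- k) y * poly g (\<theta> y))) * (of_int (n x) * e k x))"
      unfolding sum_distrib_left[symmetric]
      by (intro sum.cong refl, subst c[OF T(1) \<theta>]) (simp_all add: sum_distrib_left mult_ac)
    also have "\<dots> = (\<Sum>k\<in>{0..<m}. (of_bool (k \<in> T) * (\<Sum>y\<in>X. e (- k) y * poly g (\<theta> y))) * (\<Sum>x\<in>X. of_int (n x) * e k x))"
      by (subst sum.swap) (simp only: sum_distrib_left)
    also have "\<dots> = 0" using z by (intro sum.neutral) auto
    finally show "(\<Sum>x\<in>X. of_int (n x) * poly (c T \<circ>\<^sub>p block_poly (modulus T)) (\<theta> x)) = 0" using m0 by simp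
  qed
qed

end

section \<open>Balancedness of the projected cycles\<close>

context cyclic_point begin

lemma same_block_mono:
  assumes "asub d'" "d dvd d'" "same_block d y z" shows "same_block d' y z"
proof -
  have d': "d' > 0" "d' dvd m" using assms by (auto simp: asub_def)
  obtain c where c: "d' = d * c" using assms by auto
  obtain k where k: "m = d' * k" using d' by auto
  have "d \<noteq> 0" using c d' by auto
  then have "m div d' = k" "m div d = c * k" using d' k c by (auto simp: mult.assoc)
  then show ?thesis using assms(3) unfolding same_block_def by (auto intro: dvd_mult_right)
qed

text \<open>\<open>qs\<close> is an arbitrary full cycle for \<open>f0\<close>, unrelated to
  \<open>ps\<close>. Its test character \<open>U\<close>, pulled back along \<open>h\<close>, has
  only frequencies in \<open>T\<close>, where \<open>n\<close> has none, so Parseval gives zero. A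
  frequency not divisible by \<open>d\<close> drops out because the pull-back is constant on blocks.
  A frequency divisible by \<open>d\<close> but outside \<open>T\<close> lies in an atom whose
  modulus \<open>d'\<close> is a proper multiple of \<open>d\<close>. Its character factors through
  the coarser polynomial \<open>h'\<close>, and some rotation along \<open>qs\<close> preserves the
  fibres of the induced map \<open>q\<close> but multiplies \<open>U\<close> by a root of unity
  other than 1.\<close>

lemma projected_cycle_balanced:
  assumes T: "atom T" "T \<inter> spectrum n = {}" and f0: "f = f0 \<circ>\<^sub>p block_poly (modulus T)"
    and eps: "primitive_root_of_unity (degree f0) (\<epsilon> (degree f0))"
  shows "balanced \<epsilon> f0 t0 (projected_cycle f t0 (block_poly (modulus T)) n)"
  unfolding balanced_def
proof (intro allI impI)
  fix qs assume qs: "distinct qs \<and> set qs = fibre f0 t0 \<and> cycle_of_list qs \<in> Gamma_class f0 t0"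
  define d where "d = modulus T"
  define h where "h = block_poly d"
  have f0h: "f = f0 \<circ>\<^sub>p h" using f0 by (simp add: h_def d_def)
  have ad: "asub d" using asub_modulus T by (simp add: d_def)
  have d0: "d > 0" "d dvd m" using ad by (auto simp: asub_def)
  note h = block_poly[OF ad, folded h_def]
  interpret F: regular_point f0 t0 by (rule left_factor_regular[OF f0h])
  interpret F: cyclic_point f0 t0 qs
    using qs F.Gamma_class_subset_G by unfold_locales auto
  have hX: "poly h ` X = fibre f0 t0" by (rule left_factor_regular(3)[OF f0h])
  define D where "D = degree f0"
  have mD: "m = int D * d"
  proof -
    have "degree f = D * degree h" by (subst f0h) (simp add: degree_pcompose D_def)
    then show ?thesis using h(1) by (simp add: m_def)
  qed
  have FD: "F.m = int D" by (simp add: F.m_def D_def)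
  define w where "w = \<epsilon> D"
  have w: "w ^ D = 1" "\<And>k. 0 < k \<Longrightarrow> k < D \<Longrightarrow> w ^ k \<noteq> 1"
    using eps by (auto simp: primitive_root_of_unity_def w_def D_def)
  have wmod: "w ^ k = w ^ (k mod D)" for k
    by (metis w(1) div_mult_mod_eq mult.commute mult_1 power_add power_mult power_one)
  \<comment> \<open>\<open>Suc\<close> because the sum in \<open>balanced\<close> starts with
    exponent 1, while list positions and \<open>F.ix\<close> start with 0.\<close>
  define U where "U y = w ^ Suc (nat (F.ix y))" for y
  have U_rot: "U ((F.rot ^^ r) y) = w ^ r * U y" if "y \<in> fibre f0 t0" for r y
  proof -
    have ry: "(F.rot ^^ r) y \<in> fibre f0 t0" using F.G_in_X[OF F.G_funpow that] .
    have nn: "F.ix ((F.rot ^^ r) y) \<ge> 0" "F.ix y \<ge> 0" using F.ix(1)[OF ry] F.ix(1)[OF that] by auto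
    have "F.ix ((F.rot ^^ r) y) mod int D = (F.ix y + int r) mod int D"
      using F.ix_rot_funpow[OF that, of r] FD by (simp add: mod_eq_dvd_iff)
    then have "int (nat (F.ix ((F.rot ^^ r) y)) mod D) = int ((nat (F.ix y) + r) mod D)"
      using nn by (simp add: zmod_int)
    then have "nat (F.ix ((F.rot ^^ r) y)) mod D = (nat (F.ix y) + r) mod D" by simp
    then have "w ^ nat (F.ix ((F.rot ^^ r) y)) = w ^ (nat (F.ix y) + r)" using wmod by metis
    then show ?thesis by (simp add: U_def power_add mult_ac)
  qed
  have lq: "length qs = D" using F.length_ps FD by simp
  have "(\<Sum>i = 1..D. of_int (projected_cycle f t0 h n (qs ! (i - 1))) * w ^ i) =
      (\<Sum>j<D. of_int (projected_cycle f t0 h n (qs ! j)) * U (qs ! j))"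
  proof (rule sum.reindex_bij_witness[of _ Suc "\<lambda>i. i - 1"])
    fix i assume i: "i \<in> {1..D}"
    have "int (i - 1) mod int D = int (i - 1)" using i by (intro mod_pos_pos_trivial) auto
    then have "qs ! (i - 1) = F.pt (int (i - 1))" by (simp only: F.pt_def FD nat_int)
    moreover have "F.ix (F.pt (int (i - 1))) = int (i - 1)"
    proof -
      have "F.ix (F.pt (int (i - 1))) \<in> {0..<int D}" using F.ix(1)[OF F.pt_in_X] FD by simp
      moreover have "int D dvd F.ix (F.pt (int (i - 1))) - int (i - 1)" using F.ix_pt FD by simp
      ultimately show ?thesis using i
        by (metis (no_types, lifting) atLeastLessThan_iff mod_eq_dvd_iff mod_pos_pos_trivial
            of_nat_0_le_iff of_nat_less_iff atLeastAtMost_iff diff_less less_le_trans zero_less_one order_less_le_trans)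
    qed
    ultimately have "U (qs ! (i - 1)) = w ^ Suc (i - 1)" by (simp only: U_def nat_int)
    also have "Suc (i - 1) = i" using i by simp
    finally show "of_int (projected_cycle f t0 h n (qs ! (i - 1))) * U (qs ! (i - 1)) =
        of_int (projected_cycle f t0 h n (qs ! (i - 1))) * w ^ i" by simp
  qed auto
  also have "\<dots> = (\<Sum>y\<in>fibre f0 t0. of_int (projected_cycle f t0 h n y) * U y)"
    using bij_betw_nth[of qs "{..<D}" "fibre f0 t0"] qs lq
    by (intro sum.reindex_bij_betw) auto
  also have "\<dots> = (\<Sum>x\<in>X. of_int (n x) * U (poly h x))" by (rule projected_cycle_sum[OF f0h])
  also have "\<dots> = 0"
  proof -
    have zero: "(\<Sum>x\<in>X. U (poly h x) * e (- k) x) = 0" if k: "k \<notin> T" for k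
    proof (cases "d dvd k")
      case False
      define W where "W = (\<Sum>x\<in>X. U (poly h x) * e (- k) x)"
      \<comment> \<open>Rotation by D = m / d stays within blocks: it fixes the first factor and
        multiplies the character by a root of unity, which is not 1 when \<open>d\<close> does not
        divide \<open>k\<close>.\<close>
      have "W = (\<Sum>x\<in>X. U (poly h ((rot ^^ D) x)) * e (- k) ((rot ^^ D) x))"
        unfolding W_def by (rule sum_G[OF G_funpow, symmetric])
      also have "\<dots> = (\<Sum>x\<in>X. ru m (- k * int D) * (U (poly h x) * e (- k) x))"
      proof (intro sum.cong refl)
        fix x assume x: "x \<in> X"
        have "m div d = int D" using mD d0 by simp
        moreover have "m dvd ix ((rot ^^ D) x) - (ix x + int D)" by (rule ix_rot_funpow[OF x])
        then have "int D dvd ix ((rot ^^ D) x) - (ix x + int D)" by (rule dvd_trans[rotated]) (simp add: mD)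
        then have "int D dvd (ix ((rot ^^ D) x) - (ix x + int D)) + int D" by (rule dvd_add) simp
        ultimately have "same_block d ((rot ^^ D) x) x" by (simp add: same_block_def)
        then have "poly h ((rot ^^ D) x) = poly h x" using h(3) x G_in_X[OF G_funpow x] by blast
        then show "U (poly h ((rot ^^ D) x)) * e (- k) ((rot ^^ D) x) = ru m (- k * int D) * (U (poly h x) * e (- k) x)"
          by (simp add: e_rot[OF x] mult_ac)
      qed
      also have "\<dots> = ru m (- k * int D) * W" by (simp add: W_def sum_distrib_left)
      finally have "(1 - ru m (- k * int D)) * W = 0" by (simp add: algebra_simps)
      moreover have "\<not> m dvd - k * int D"
      proof
        assume "m dvd - k * int D"
        then have "int D * d dvd int D * k" by (simp add: mD mult.commute)
        then show False using False F.degree_pos by (simp add: D_def)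
      qed
      then have "ru m (- k * int D) \<noteq> 1" using ru_eq_1_iff[OF m_pos] by blast
      ultimately show ?thesis by (simp add: W_def)
    next
      case True
      obtain S where S: "atom S" "k \<in> S" using atom_exists by blast
      define d' where "d' = modulus S"
      have ad': "asub d'" using asub_modulus S by (simp add: d'_def)
      have d'0: "d' > 0" "d' dvd m" using ad' by (auto simp: asub_def)
      have "S \<subseteq> {x. d dvd x}" using atom_subset[OF S(1) _ _ S(2)] ad True by (auto simp: asub_def)
      then have dd': "d dvd d'" using d0 unfolding d'_def modulus_def by (intro Gcd_greatest) auto
      \<comment> \<open>\<open>k\<close> lies in \<open>S\<close> but not in \<open>T\<close>, and
        distinct atoms have distinct moduli. Without strictness no rotation as below would
        exist.\<close>
      have "d \<noteq> d'" using modulus_inj[OF T(1) S(1)] k S(2) by (auto simp: d_def d'_def)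
      have d'k: "d' dvd k" unfolding d'_def by (rule modulus_dvd[OF S(2)])
      define h' where "h' = block_poly d'"
      note h' = block_poly[OF ad', folded h'_def]
      have "poly h' (\<theta> y) = poly h' (\<theta> z)" if "\<theta> \<in> labellings" "y \<in> X" "z \<in> X" "same_block d y z" for \<theta> y z
        using h'(2) same_block_mono[OF ad' dd' that(4)] that unfolding block_constant_def by blast
      then obtain q where q: "h' = q \<circ>\<^sub>p h" using block_constant_factor[OF ad, of h'] h_def by blast
      obtain f1 where f1: "f = f1 \<circ>\<^sub>p h'" using block_decomposition[OF ad'] h'_def by metis
      have f0q: "f0 = f1 \<circ>\<^sub>p q"
      proof -
        have "(f0 - f1 \<circ>\<^sub>p q) \<circ>\<^sub>p h = 0" using f0h f1 q by (simp add: pcompose_diff pcompose_assoc)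
        then show ?thesis using pcompose_eq_0 h(1) d0 by fastforce
      qed
      define \<Phi> where "\<Phi> y = e (- k) (SOME x. x \<in> X \<and> poly h x = y)" for y
      have \<Phi>: "\<Phi> y = \<Phi> z" if "y \<in> fibre f0 t0" "z \<in> fibre f0 t0" "poly q y = poly q z" for y z
      proof -
        define s where "s y = (SOME x. x \<in> X \<and> poly h x = y)" for y
        have s: "s y \<in> X \<and> poly h (s y) = y" if "y \<in> fibre f0 t0" for y
        proof -
          have "\<exists>x. x \<in> X \<and> poly h x = y" using that unfolding hX[symmetric] by blast
          from someI_ex[OF this] show ?thesis by (simp add: s_def)
        qed
        have "poly h' (s y) = poly h' (s z)" using s[OF that(1)] s[OF that(2)] that(3) by (simp add: q poly_pcompose)
        then have "same_block d' (s y) (s z)" using h'(3) s that by blast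
        then have "e (- k) (s y) = e (- k) (s z)" using character_same_block[OF d'0(2), of "-k"] d'k by simp
        then show ?thesis by (simp add: \<Phi>_def s_def)
      qed
      have e\<Phi>: "e (- k) x = \<Phi> (poly h x)" if x: "x \<in> X" for x
      proof -
        define s where "s = (SOME z. z \<in> X \<and> poly h z = poly h x)"
        have "s \<in> X \<and> poly h s = poly h x" unfolding s_def by (rule someI[of _ x]) (simp add: x)
        then have "same_block d' x s" using h(3) x same_block_mono[OF ad' dd'] by metis
        then have "e (- k) x = e (- k) s" using character_same_block[OF d'0(2), of "-k"] d'k by simp
        then show ?thesis by (simp add: \<Phi>_def s_def)
      qed
      \<comment> \<open>A shift by m / d' stays in a \<open>d'\<close>-block but is too small to
        stay in a \<open>d\<close>-block, so \<open>h\<close> separates the two points while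
        \<open>q\<close> identifies their images.\<close>
      define y z where "y = pt 0" and "z = pt (m div d')"
      have yz: "y \<in> X" "z \<in> X" by (simp_all add: y_def z_def pt_in_X)
      have dvd: "l dvd ix z - ix y \<longleftrightarrow> l dvd m div d'" if "l dvd m" for l
      proof -
        have "m dvd (ix z - m div d') - (ix y - 0)"
          unfolding y_def z_def by (intro dvd_diff ix_pt)
        then have "l dvd (ix z - ix y) - m div d'" using that dvd_trans by (simp add: algebra_simps) blast
        then show ?thesis by (metis diff_add_cancel dvd_add dvd_diff diff_diff_eq2 add_diff_cancel_left')
      qed
      have "same_block d' z y"
        using dvd[of "m div d'"] d'0 by (simp add: same_block_def div_dvd_iff_mult)
      moreover have "\<not> same_block d z y"
      proof
        assume "same_block d z y"
        then have "m div d dvd m div d'" using dvd[of "m div d"] d0 by (simp add: same_block_def div_dvd_iff_mult)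
        moreover have "m div d' > 0" using d'0 m_pos by (metis dvd_div_eq_0_iff less_irrefl less_le pos_imp_zdiv_nonneg_iff)
        ultimately have "m div d \<le> m div d'" by (rule zdvd_imp_le)
        obtain c where c: "d' = d * c" using dd' by auto
        obtain l where l: "m = d' * l" using d'0 by auto
        have "m div d' = l" "m div d = c * l" using l c d0 d'0 by (auto simp: mult.assoc)
        then have "c * l \<le> 1 * l" "l > 0" using \<open>m div d \<le> m div d'\<close> \<open>m div d' > 0\<close> by auto
        then have "c \<le> 1" by (simp only: mult_le_cancel_right_pos)
        moreover have "c > 0" using c d0 d'0 by (simp add: zero_less_mult_iff)
        ultimately show False using c \<open>d \<noteq> d'\<close> by simp
      qed
      ultimately have hyz: "poly h y \<noteq> poly h z" "poly q (poly h y) = poly q (poly h z)"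
        using h(3) h'(3) yz same_block_sym by (auto simp: q poly_pcompose)
      have hy: "poly h y \<in> fibre f0 t0" "poly h z \<in> fibre f0 t0" using hX yz by blast+
      define r where "r = nat ((F.ix (poly h z) - F.ix (poly h y)) mod F.m)"
      have rot_r: "(F.rot ^^ r) (poly h y) = poly h z"
      proof -
        have "F.pt (F.ix (poly h y) + int r) = F.pt (F.ix (poly h z))"
          using F.m_pos by (simp add: r_def F.pt_def mod_add_right_eq)
        then show ?thesis using F.rot_funpow[of r "F.ix (poly h y)"] F.ix(2) hy by simp
      qed
      have "r \<noteq> 0" using rot_r hyz by (intro notI) simp
      moreover have "r < D" using F.m_pos FD by (simp add: r_def nat_less_iff)
      ultimately have wr: "w ^ r \<noteq> 1" using w(2) by simp
      \<comment> \<open>The relation between the images of \<open>y\<close> and \<open>z\<close>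
        survives rotation by any \<open>s\<close>, which commutes with rotation by \<open>r\<close>;
        transitivity spreads it from one pair to the whole fibre.\<close>
      have perm: "poly q ((F.rot ^^ r) v) = poly q v" if v: "v \<in> fibre f0 t0" for v
      proof -
        obtain s where s: "(F.rot ^^ s) (poly h y) = v"
        proof -
          define s where "s = nat ((F.ix v - F.ix (poly h y)) mod F.m)"
          have "F.pt (F.ix (poly h y) + int s) = F.pt (F.ix v)"
            using F.m_pos by (simp add: s_def F.pt_def mod_add_right_eq)
          then show ?thesis using that[of s] F.rot_funpow[of s "F.ix (poly h y)"] F.ix(2) hy v by simp
        qed
        have "(F.rot ^^ r) v = (F.rot ^^ s) (poly h z)"
          using rot_r s by (metis add.commute comp_apply funpow_add)
        moreover have "poly q ((F.rot ^^ s) (poly h z)) = poly q ((F.rot ^^ s) (poly h y))"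
          by (rule F.poly_relation_permanent[OF f0q hy(2,1) hyz(2)[symmetric] F.G_labelling[OF F.G_funpow]])
        ultimately show ?thesis using s by simp
      qed
      define W where "W = (\<Sum>y\<in>fibre f0 t0. U y * \<Phi> y)"
      have "W = (\<Sum>y\<in>fibre f0 t0. U ((F.rot ^^ r) y) * \<Phi> ((F.rot ^^ r) y))"
        unfolding W_def by (rule F.sum_G[OF F.G_funpow, symmetric])
      also have "\<dots> = (\<Sum>y\<in>fibre f0 t0. w ^ r * (U y * \<Phi> y))"
        using U_rot \<Phi>[OF F.G_in_X[OF F.G_funpow] _ perm] by (intro sum.cong) auto
      also have "\<dots> = w ^ r * W" by (simp add: W_def sum_distrib_left)
      finally have "(1 - w ^ r) * W = 0" by (simp add: algebra_simps)
      then have "W = 0" using wr by simp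
      have "(\<Sum>x\<in>X. U (poly h x) * e (- k) x) = (\<Sum>x\<in>X. U (poly h x) * \<Phi> (poly h x))"
        using e\<Phi> by simp
      also have "\<dots> = (\<Sum>y\<in>fibre f0 t0. \<Sum>x\<in>{x \<in> X. poly h x = y}. U (poly h x) * \<Phi> (poly h x))"
        using hX by (intro sum.group[symmetric]) auto
      also have "\<dots> = (\<Sum>y\<in>fibre f0 t0. of_int d * (U y * \<Phi> y))"
      proof (intro sum.cong refl)
        fix y assume "y \<in> fibre f0 t0"
        then obtain x where x: "x \<in> X" "poly h x = y" unfolding hX[symmetric] by blast
        have "poly h z = y \<longleftrightarrow> same_block d z x" if "z \<in> X" for z
          using h(3)[OF that x(1)] x(2) by simp
        then have "{z \<in> X. poly h z = y} = {z \<in> X. same_block d z x}" by blast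
        then have "int (card {z \<in> X. poly h z = y}) = d" using card_block[OF ad x(1)] by simp
        then have "of_nat (card {z \<in> X. poly h z = y}) = (of_int d :: complex)" by (metis of_int_of_nat_eq)
        then show "(\<Sum>x\<in>{x \<in> X. poly h x = y}. U (poly h x) * \<Phi> (poly h x)) = of_int d * (U y * \<Phi> y)" by simp
      qed
      also have "\<dots> = of_int d * W" by (simp add: W_def sum_distrib_left)
      finally show ?thesis using \<open>W = 0\<close> by simp
    qed
    have "(\<Sum>x\<in>X. of_int (n x) * e k x) = 0" if "k \<in> T" for k
      using T(2) that by (intro sum_eq_0_if_not_spectrum) blast
    then have "of_int m * (\<Sum>x\<in>X. of_int (n x) * U (poly h x)) = 0"
      unfolding e_parseval using zero by (intro sum.neutral) auto
    then show ?thesis using m_pos by simp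
  qed
  finally show "(\<Sum>i = 1..degree f0. of_int (projected_cycle f t0 (block_poly (modulus T)) n (qs ! (i - 1))) * \<epsilon> (degree f0) ^ i) = 0"
    by (simp add: D_def w_def h_def d_def)
qed

end

section \<open>Decomposition of polynomials with vanishing integral\<close>

context regular_point begin

theorem vanishing_integral_decomposition:
  assumes eps: "\<forall>m\<ge>1. primitive_root_of_unity m (\<epsilon> m)" and cyc: "is_cycle f t0 n"
    and nb: "\<not> balanced \<epsilon> f t0 n" and van: "integral_vanishes f t0 n g"
  shows "\<exists>s\<ge>1. \<exists>fs gs hs :: nat \<Rightarrow> complex poly. (\<forall>k\<in>{1..s}. f = fs k \<circ>\<^sub>p hs k) \<and>
    g = (\<Sum>k=1..s. gs k \<circ>\<^sub>p hs k) \<and>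
    (\<forall>k\<in>{1..s}. integral_vanishes (fs k) t0 (projected_cycle f t0 (hs k) n) (gs k) \<and>
       balanced \<epsilon> (fs k) t0 (projected_cycle f t0 (hs k) n))"
proof -
  obtain ps where "distinct ps" "set ps = X" "cycle_of_list ps \<in> Gamma_class f t0"
    using nb by (auto simp: balanced_def)
  then interpret cyclic_point f t0 ps using Gamma_class_subset_G by unfold_locales auto
  have "(\<Sum>x\<in>X. of_int (n x) * poly g (\<theta> x)) = 0" if "\<theta> \<in> labellings" for \<theta>
    using van that by (simp add: integral_vanishes_iff)
  then obtain c where c: "g = (\<Sum>T\<in>{T \<in> atoms. T \<inter> spectrum n = {}}. c T \<circ>\<^sub>p block_poly (modulus T))"
    "\<And>T \<theta>. atom T \<Longrightarrow> T \<inter> spectrum n = {} \<Longrightarrow> \<theta> \<in> labellings \<Longrightarrow>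
      (\<Sum>x\<in>X. of_int (n x) * poly (c T \<circ>\<^sub>p block_poly (modulus T)) (\<theta> x)) = 0"
    by (rule splitting[of n g]) blast+
  define I where "I = {T \<in> atoms. T \<inter> spectrum n = {}}"
  have finI: "finite I" using finite_atoms by (simp add: I_def)
  \<comment> \<open>At least one summand is required. The frequency 0 lies outside the spectrum
    because the coefficients of a cycle add up to 0, so its atom belongs to
    \<open>I\<close>.\<close>
  have "I \<noteq> {}"
  proof -
    have "0 \<notin> spectrum n"
    proof -
      have "(\<Sum>y\<in>X. of_int (n (\<sigma> y)) * e 0 y) = 0" if "\<sigma> \<in> G" for \<sigma>
        using sum_G[OF that, of n] cyc by (simp add: e_def is_cycle_def flip: of_int_sum)
      then show ?thesis by (simp add: spectrum_def)
    qed
    moreover obtain T where T: "atom T" "0 \<in> T" using atom_exists by blast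
    ultimately have "T \<inter> spectrum n = {}"
      using atom_subset[OF T(1) aset_Compl[OF aset_spectrum[of n]] _ T(2)] by auto
    then show ?thesis using T(1) by (auto simp: I_def atoms_def)
  qed
  define s where "s = card I"
  obtain b where b: "bij_betw b {1..s} I"
    using ex_bij_betw_nat_finite_1[OF finI] by (auto simp: s_def)
  define hs where "hs k = block_poly (modulus (b k))" for k
  define fs where "fs k = (SOME f0. f = f0 \<circ>\<^sub>p hs k)" for k
  have bI: "atom (b k)" "b k \<inter> spectrum n = {}" if "k \<in> {1..s}" for k
    using b that by (auto simp: bij_betw_def I_def atoms_def)
  have fs: "f = fs k \<circ>\<^sub>p hs k" if "k \<in> {1..s}" for k
  proof -
    have "\<exists>f0. f = f0 \<circ>\<^sub>p hs k" using block_decomposition[OF asub_modulus[OF bI(1)[OF that]]] by (metis hs_def)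
    from someI_ex[OF this] show ?thesis by (simp add: fs_def)
  qed
  have "g = (\<Sum>k=1..s. c (b k) \<circ>\<^sub>p hs k)"
    using sum.reindex_bij_betw[OF b, of "\<lambda>T. c T \<circ>\<^sub>p block_poly (modulus T)"] c(1) by (simp add: I_def hs_def)
  moreover have "integral_vanishes (fs k) t0 (projected_cycle f t0 (hs k) n) (c (b k)) \<and>
       balanced \<epsilon> (fs k) t0 (projected_cycle f t0 (hs k) n)" if k: "k \<in> {1..s}" for k
  proof
    show "integral_vanishes (fs k) t0 (projected_cycle f t0 (hs k) n) (c (b k))"
      unfolding integral_vanishes_projected[OF fs[OF k]] integral_vanishes_iff
      using c(2)[OF bI[OF k]] by (simp add: hs_def)
    have "degree (fs k) \<ge> 1"
      using left_factor_regular(1)[OF fs[OF k]] unfolding regular_point_def by linarith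
    then have "primitive_root_of_unity (degree (fs k)) (\<epsilon> (degree (fs k)))" using eps by blast
    then show "balanced \<epsilon> (fs k) t0 (projected_cycle f t0 (hs k) n)"
      by (rule projected_cycle_balanced[OF bI[OF k] fs[OF k, unfolded hs_def], folded hs_def])
  qed
  moreover have "s \<ge> 1" using \<open>I \<noteq> {}\<close> finI by (simp add: s_def Suc_le_eq card_gt_0_iff)
  ultimately show ?thesis using fs
    by (intro exI[of _ s] conjI exI[of _ fs] exI[of _ "\<lambda>k. c (b k)"] exI[of _ hs]) auto
qed

lemma vanishing_integral_sum:
  assumes "\<And>k. k \<in> {1..s::nat} \<Longrightarrow> f = fs k \<circ>\<^sub>p hs k" "g = (\<Sum>k=1..s. gs k \<circ>\<^sub>p hs k)"
    "\<And>k. k \<in> {1..s} \<Longrightarrow> integral_vanishes (fs k) t0 (projected_cycle f t0 (hs k) n) (gs k)"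
  shows "integral_vanishes f t0 n g"
proof -
  have "(\<Sum>x\<in>X. of_int (n x) * poly (gs k \<circ>\<^sub>p hs k) (\<theta> x)) = 0" if "k \<in> {1..s}" "\<theta> \<in> labellings" for k \<theta>
    using assms(3)[OF that(1)] that(2) unfolding integral_vanishes_projected[OF assms(1)[OF that(1)]] integral_vanishes_iff
    by blast
  then show ?thesis
    unfolding integral_vanishes_iff assms(2) poly_sum sum_distrib_left
    by (intro ballI, subst sum.swap) (simp add: sum.neutral)
qed

end

section \<open>Assembly of the two equivalences\<close>

theorem theorem2p2:
  fixes f g :: "complex poly" and t0 :: complex and n :: "complex \<Rightarrow> int"
    and \<epsilon> :: "nat \<Rightarrow> complex"
  assumes "degree f > 1"
    and "t0 \<notin> critical_values f"
    and "is_cycle f t0 n"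
    and "\<And>m. m \<ge> 1 \<Longrightarrow> primitive_root_of_unity m (\<epsilon> m)"
  shows "(totally_unbalanced \<epsilon> f t0 n \<longrightarrow>
           (integral_vanishes f t0 n g \<longleftrightarrow>
             (\<exists>s\<ge>1. \<exists>fs gs hs :: nat \<Rightarrow> complex poly.
                (\<forall>k\<in>{1..s}. f = fs k \<circ>\<^sub>p hs k) \<and>
                g = (\<Sum>k=1..s. gs k \<circ>\<^sub>p hs k) \<and>
                (\<forall>k\<in>{1..s}. trivial_cycle (fs k) t0 (projected_cycle f t0 (hs k) n)))))
       \<and> (\<not> balanced \<epsilon> f t0 n \<longrightarrow>
           (integral_vanishes f t0 n g \<longleftrightarrow>
             (\<exists>s\<ge>1. \<exists>fs gs hs :: nat \<Rightarrow> complex poly.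
                (\<forall>k\<in>{1..s}. f = fs k \<circ>\<^sub>p hs k) \<and>
                g = (\<Sum>k=1..s. gs k \<circ>\<^sub>p hs k) \<and>
                (\<forall>k\<in>{1..s}.
                   integral_vanishes (fs k) t0 (projected_cycle f t0 (hs k) n) (gs k) \<and>
                   (trivial_cycle (fs k) t0 (projected_cycle f t0 (hs k) n) \<or>
                    balanced \<epsilon> (fs k) t0 (projected_cycle f t0 (hs k) n))))))"
proof -
  interpret regular_point f t0 using assms(1,2) by unfold_locales auto
  have eps: "\<forall>m\<ge>1. primitive_root_of_unity m (\<epsilon> m)" using assms(4) by blast
  have decomposition: thesis
    if "\<not> balanced \<epsilon> f t0 n" "integral_vanishes f t0 n g"
      and *: "\<And>(s::nat) fs gs hs. s \<ge> 1 \<Longrightarrow> \<forall>k\<in>{1..s}. f = fs k \<circ>\<^sub>p hs k \<Longrightarrow> g = (\<Sum>k=1..s. gs k \<circ>\<^sub>p hs k) \<Longrightarrow>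
        \<forall>k\<in>{1..s}. integral_vanishes (fs k) t0 (projected_cycle f t0 (hs k) n) (gs k) \<and>
          balanced \<epsilon> (fs k) t0 (projected_cycle f t0 (hs k) n) \<Longrightarrow> thesis"
    for thesis
    using vanishing_integral_decomposition[OF eps assms(3) that(1,2)]
    by (elim exE conjE) (rule *)
  have backward: "integral_vanishes f t0 n g"
    if "\<forall>k\<in>{1..s}. f = fs k \<circ>\<^sub>p hs k" "g = (\<Sum>k=1..s. gs k \<circ>\<^sub>p hs k)"
      "\<And>k. k \<in> {1..s} \<Longrightarrow> integral_vanishes (fs k) t0 (projected_cycle f t0 (hs k) n) (gs k)"
    for s :: nat and fs gs hs
    using that by (intro vanishing_integral_sum) auto
  have triv: "trivial_cycle f0 t0 c \<Longrightarrow> integral_vanishes f0 t0 c g0" for f0 c g0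
    by (simp add: trivial_cycle_def integral_vanishes_def cycle_integral_def)
  show ?thesis
  proof (intro conjI impI iffI)
    assume tu: "totally_unbalanced \<epsilon> f t0 n" and van: "integral_vanishes f t0 n g"
    show "\<exists>s\<ge>1. \<exists>fs gs hs :: nat \<Rightarrow> complex poly. (\<forall>k\<in>{1..s}. f = fs k \<circ>\<^sub>p hs k) \<and>
        g = (\<Sum>k=1..s. gs k \<circ>\<^sub>p hs k) \<and>
        (\<forall>k\<in>{1..s}. trivial_cycle (fs k) t0 (projected_cycle f t0 (hs k) n))"
    proof (cases "balanced \<epsilon> f t0 n")
      case False
      then show ?thesis
      proof (rule decomposition[OF _ van])
        fix s :: nat and fs gs hs
        assume s: "s \<ge> 1" "\<forall>k\<in>{1..s}. f = fs k \<circ>\<^sub>p hs k" "g = (\<Sum>k=1..s. gs k \<circ>\<^sub>p hs k)"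
          "\<forall>k\<in>{1..s}. integral_vanishes (fs k) t0 (projected_cycle f t0 (hs k) n) (gs k) \<and>
            balanced \<epsilon> (fs k) t0 (projected_cycle f t0 (hs k) n)"
        \<comment> \<open>Each projected cycle of the decomposition is balanced, so total
          unbalancedness leaves only triviality.\<close>
        then have "\<forall>k\<in>{1..s}. trivial_cycle (fs k) t0 (projected_cycle f t0 (hs k) n)"
          using tu unfolding totally_unbalanced_def by blast
        with s show ?thesis
          by (intro exI[of _ s] exI[of _ fs] exI[of _ gs] exI[of _ hs] conjI)
      qed
    next
      case True
      \<comment> \<open>Projecting along the identity agrees with \<open>n\<close> on the fibre, so
        \<open>p\<close> inherits balancedness. Total unbalancedness then makes the cycle itself
        trivial, and a single summand with \<open>h\<close> the identity suffices.\<close>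
      define p where "p = projected_cycle f t0 [:0, 1:] n"
      have p: "p y = n y" if "y \<in> fibre f t0" for y
      proof -
        have "{x \<in> fibre f t0. poly [:0, 1:] x = y} = {y}" using that by auto
        then show ?thesis by (simp add: p_def projected_cycle_def)
      qed
      have "balanced \<epsilon> f t0 p"
        unfolding balanced_def
      proof (intro allI impI)
        fix ps assume ps: "distinct ps \<and> set ps = fibre f t0 \<and> cycle_of_list ps \<in> Gamma_class f t0"
        then have "length ps = degree f" using distinct_card[of ps] card_X by simp
        have "p (ps ! (i - 1)) = n (ps ! (i - 1))" if "i \<in> {1..degree f}" for i
        proof (rule p)
          have "i - 1 < length ps" using that \<open>length ps = degree f\<close> by auto
          then have "ps ! (i - 1) \<in> set ps" by (rule nth_mem)
          then show "ps ! (i - 1) \<in> fibre f t0" using ps by blast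
        qed
        then have "(\<Sum>i=1..degree f. of_int (p (ps ! (i - 1))) * \<epsilon> (degree f) ^ i) =
            (\<Sum>i=1..degree f. of_int (n (ps ! (i - 1))) * \<epsilon> (degree f) ^ i)"
          by (intro sum.cong) auto
        then show "(\<Sum>i=1..degree f. of_int (p (ps ! (i - 1))) * \<epsilon> (degree f) ^ i) = 0"
          using True ps unfolding balanced_def by simp
      qed
      then have "trivial_cycle f t0 p"
        using tu unfolding totally_unbalanced_def p_def by (metis pcompose_idR)
      then show ?thesis
        by (intro exI[of _ "1::nat"] conjI exI[of _ "\<lambda>_. f"] exI[of _ "\<lambda>_. g"] exI[of _ "\<lambda>_. [:0, 1:]"])
          (auto simp: pcompose_idR p_def)
    qed
  next
    assume "\<exists>s\<ge>1. \<exists>fs gs hs :: nat \<Rightarrow> complex poly. (\<forall>k\<in>{1..s}. f = fs k \<circ>\<^sub>p hs k) \<and>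
        g = (\<Sum>k=1..s. gs k \<circ>\<^sub>p hs k) \<and>
        (\<forall>k\<in>{1..s}. trivial_cycle (fs k) t0 (projected_cycle f t0 (hs k) n))"
    then show "integral_vanishes f t0 n g"
      by (elim exE conjE) (rule backward, assumption+, rule triv, blast)
  next
    assume "\<not> balanced \<epsilon> f t0 n" "integral_vanishes f t0 n g"
    then show "\<exists>s\<ge>1. \<exists>fs gs hs :: nat \<Rightarrow> complex poly. (\<forall>k\<in>{1..s}. f = fs k \<circ>\<^sub>p hs k) \<and>
        g = (\<Sum>k=1..s. gs k \<circ>\<^sub>p hs k) \<and>
        (\<forall>k\<in>{1..s}. integral_vanishes (fs k) t0 (projected_cycle f t0 (hs k) n) (gs k) \<and>
          (trivial_cycle (fs k) t0 (projected_cycle f t0 (hs k) n) \<or>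
           balanced \<epsilon> (fs k) t0 (projected_cycle f t0 (hs k) n)))"
    proof (rule decomposition)
      fix s :: nat and fs gs hs
      assume s: "s \<ge> 1" "\<forall>k\<in>{1..s}. f = fs k \<circ>\<^sub>p hs k" "g = (\<Sum>k=1..s. gs k \<circ>\<^sub>p hs k)"
        "\<forall>k\<in>{1..s}. integral_vanishes (fs k) t0 (projected_cycle f t0 (hs k) n) (gs k) \<and>
          balanced \<epsilon> (fs k) t0 (projected_cycle f t0 (hs k) n)"
      from s(4) have "\<forall>k\<in>{1..s}. integral_vanishes (fs k) t0 (projected_cycle f t0 (hs k) n) (gs k) \<and>
          (trivial_cycle (fs k) t0 (projected_cycle f t0 (hs k) n) \<or>
           balanced \<epsilon> (fs k) t0 (projected_cycle f t0 (hs k) n))" by blast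
      with s(1-3) show ?thesis
        by (intro exI[of _ s] exI[of _ fs] exI[of _ gs] exI[of _ hs] conjI)
    qed
  next
    assume "\<exists>s\<ge>1. \<exists>fs gs hs :: nat \<Rightarrow> complex poly. (\<forall>k\<in>{1..s}. f = fs k \<circ>\<^sub>p hs k) \<and>
        g = (\<Sum>k=1..s. gs k \<circ>\<^sub>p hs k) \<and>
        (\<forall>k\<in>{1..s}. integral_vanishes (fs k) t0 (projected_cycle f t0 (hs k) n) (gs k) \<and>
          (trivial_cycle (fs k) t0 (projected_cycle f t0 (hs k) n) \<or>
           balanced \<epsilon> (fs k) t0 (projected_cycle f t0 (hs k) n)))"
    then show "integral_vanishes f t0 n g"
      by (elim exE conjE) (rule backward, assumption+, blast)
  qed
qed

end
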